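(* Let $\Sigma\in\mathcal H_\alpha$ for some $\alpha>0$, where $\Sigma$ is the covariance matrix of the data distribution described in the context, and suppose that $\rho n^2/d\gtrsim(\log n)^{2\alpha+4}$. Then the Frobenius-thresholded adaptive blockwise tridiagonal estimator $\hat\Sigma^{\mathsf{Ada}}$ (described in the context; it does not use $\alpha$) is $\rho$-zCDP and satisfies $$ \frac1d\,\mathbb E\|\hat\Sigma^{\mathsf{Ada}}-\Sigma\|_F^2\;\lesssim\;\Bigl(n^{-\frac{2\alpha+1}{2\alpha+2}}\wedge\frac dn\Bigr)+\Bigl(\bigl(\tfrac{d\log n}{\rho n^2}\bigr)^{\frac{2\alpha+1}{2\alpha+3}}\wedge\frac{d^3\log n}{\rho n^2}\Bigr). $$
   Context: Norms: $\|\cdot\|_F$ is the Frobenius norm; $a\wedge b=\min(a,b)$. $\|X\|_{\psi_2}=\sup_{\|v\|_2=1}\inf\{t>0:\mathbb E e^{\langle X,v\rangle^2/t^2}\le2\}$. For a matrix $A$ and index set $B$, $A[B]$ denotes $A$ with entries outside $B$ set to zero. Privacy. Datasets are adjacent if they differ in one observation. For $\lambda>1$, $D_\lambda(P\|Q)=\frac1{\lambda-1}\log\int(\frac{dP}{dQ})^\lambda dQ$. A randomized algorithm $A$ is $\rho$-zCDP if $D_\lambda(A(S)\|A(S'))\le\rho\lambda$ for all adjacent $S,S'$ and all $\lambda\in(1,\infty)$. Model and class. $X_1,\dots,X_n$ are i.i.d. in $\mathbb R^d$ with mean $0$, covariance $\Sigma$, $\|X_1\|_{\psi_2}\le K$;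 $K,M_0,M$ are fixed. $\mathcal H_\alpha=\mathcal H_\alpha(M_0,M)$ is the set of covariance matrices with $0\preceq\Sigma\preceq M_0I_d$ and $|\Sigma_{ij}|\le M|i-j|^{-(\alpha+1)}$ for $i\ne j$. Regime. Statements are along sequences $(n,d,\rho)$, $n\to\infty$, with $d\gtrsim\log n$, $0<\rho\lesssim1$ (fixed upper bound), $d/(\rho n^2)\to0$. $a\lesssim b$ means $a\le Cb$ for all sufficiently large $n$, with $C$ not depending on $n,d,\rho$ or on the particular distribution (it may depend on $\alpha,K,M_0,M$ and the regime constants). Block primitive $\mathsf{DPCovBlock}(X,B;\rho_B,R)$, for a square block $B=I\times J$: with $\chi_R(z)=z\min\{1,R/\|z\|_2\}$ ($\chi_R(0)=0$), return $\frac1n\sum_{i=1}^n\chi_R(X_{i,I})\chi_R(X_{i,J})^\top+\sigma_BM_B$ (supported on $B$), where $\sigma_B^2=18R^4/(\rho_Bn^2)$ and $M_B$ is the $B$-block of a fresh random symmetric $d\times d$ matrix whose upper triangular entries (including the diagonal) are i.i.d. $N(0,1)$. The estimator. Fix sufficiently large constants $C_0,C,L_1$ and a sufficiently small constant $c_0>0$ (not depending on $n,d,\rho$ or $\alpha$). Set $k_0=d\wedge\lceil C_0\log n\rceil$, $k_m=2^mk_0$; the data are padded with deterministic zero coordinates so that $d=2^Jk_0$ for an integer $J\ge0$ (the estimate of the original $\Sigma$ being the corresponding principal submatrix). Let $S=1+\max\{m\ge0:k_m\le\min(c_0n,d)\}$ and $N_m=d/k_m$ for $0\le m<S$. For a block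 size $k$, $I_{k,\ell}=\{1+(\ell-1)k,\dots,\ell k\}$ and $B_{k;\ell,r}=I_{k,\ell}\times I_{k,\ell+r}$ (blocks with invalid indices are omitted). For $m\ge1$ and $1\le\ell<N_m$ let $\Gamma_{m,\ell}=B_{k_m;\ell,1}\setminus B_{k_{m-1};2\ell,1}$. (1) Start from $\hat\Sigma=0$. With $\rho_0=\rho/(2SN_0)$, set $\hat\Sigma[B_{k_0;\ell,r}]=\mathsf{DPCovBlock}(X,B_{k_0;\ell,r};\rho_0,\sqrt{Ck_0})$ for $\ell\in[N_0]$, $r\in\{0,1\}$. (2) For $m=1,\dots,S-1$, put $\rho_m=\rho/(SN_m)$ and $$\tau_m^2=L_1\Bigl(\frac{k_m+\log d}{n}+\frac{k_m^2(k_m+\log d)}{\rho_mn^2}+e^{-2k_m}\Bigr);$$ for each $\ell=1,\dots,N_m-1$ compute $A=\mathsf{DPCovBlock}(X,B_{k_m;\ell,1};\rho_m,\sqrt{Ck_m})[\Gamma_{m,\ell}]$ and set $\hat\Sigma[\Gamma_{m,\ell}]=A\cdot\mathbf 1\{\|A\|_F^2>k_m\tau_m^2\}$. (3) Fill in the lower triangular part by symmetry and return $\hat\Sigma^{\mathsf{Ada}}=\hat\Sigma$. *)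

theory Defs
  imports "HOL-Probability.Probability"
begin

section \<open>Vectors and matrices of varying dimension\<close>

text \<open>Dimensions occur as bound variables of the theorem, so vectors in d-space are functions on
  \<open>{1..d}\<close> and matrices are functions on pairs of indices, with the product sigma-algebras.\<close>

type_synonym mat = "nat \<times> nat \<Rightarrow> real"

abbreviation Vec :: "nat \<Rightarrow> (nat \<Rightarrow> real) measure" where
  "Vec d \<equiv> Pi\<^sub>M {1..d} (\<lambda>_. borel)"

abbreviation Mat :: "nat \<Rightarrow> mat measure" where
  "Mat d \<equiv> Pi\<^sub>M ({1..d} \<times> {1..d}) (\<lambda>_. borel)"

definition frob :: "nat \<Rightarrow> mat \<Rightarrow> real" where
  "frob d A = L2_set A ({1..d} \<times> {1..d})"

definition mat_on :: "mat \<Rightarrow> (nat \<times> nat) set \<Rightarrow> mat" where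
  "mat_on A B = (\<lambda>p. if p \<in> B then A p else 0)"

section \<open>Zero-concentrated differential privacy\<close>

text \<open>The integrand is the \<open>t\<close>-th power of the Radon-Nikodym derivative \<open>dP/dQ\<close>; as usual the
  divergence is infinite if \<open>P\<close> is not absolutely continuous with respect to \<open>Q\<close>.\<close>

definition renyi_divergence :: "real \<Rightarrow> 'a measure \<Rightarrow> 'a measure \<Rightarrow> ereal" where
  "renyi_divergence t P Q =
     (if absolutely_continuous Q P then
        (let I = \<integral>\<^sup>+ x. ennreal (enn2real (RN_deriv Q P x) powr t) \<partial>Q
         in if I = \<infinity> then \<infinity> else ereal (ln (enn2real I) / (t - 1)))
      else \<infinity>)"

text \<open>A dataset of \<open>n\<close> observations from the data space \<open>U\<close> is a function on \<open>{1..n}\<close>; a randomized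
  algorithm with output space \<open>V\<close> is a probability kernel from datasets to \<open>V\<close>.\<close>

abbreviation (input) Dataset :: "nat \<Rightarrow> 'a measure \<Rightarrow> (nat \<Rightarrow> 'a) measure" where
  "Dataset n U \<equiv> Pi\<^sub>M {1..n} (\<lambda>_. U)"

definition adjacent :: "nat \<Rightarrow> (nat \<Rightarrow> 'a) \<Rightarrow> (nat \<Rightarrow> 'a) \<Rightarrow> bool" where
  "adjacent n X X' \<longleftrightarrow> (\<exists>i\<in>{1..n}. \<forall>j\<in>{1..n} - {i}. X j = X' j)"

definition zCDP ::
  "nat \<Rightarrow> 'a measure \<Rightarrow> 'b measure \<Rightarrow> real \<Rightarrow> ((nat \<Rightarrow> 'a) \<Rightarrow> 'b measure) \<Rightarrow> bool" where
  "zCDP n U V \<rho> A \<longleftrightarrow>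
     A \<in> measurable (Dataset n U) (prob_algebra V) \<and>
     (\<forall>X\<in>space (Dataset n U). \<forall>X'\<in>space (Dataset n U). adjacent n X X' \<longrightarrow>
        (\<forall>t>1. renyi_divergence t (A X) (A X') \<le> ereal (\<rho> * t)))"

section \<open>Statistical model\<close>

definition psi2_norm :: "nat \<Rightarrow> (nat \<Rightarrow> real) measure \<Rightarrow> ennreal" where
  "psi2_norm d P =
     (SUP v \<in> {v :: nat \<Rightarrow> real. L2_set v {1..d} = 1}.
        INF t \<in> {t :: real. 0 < t \<and>
                   (\<integral>\<^sup>+ x. ennreal (exp ((\<Sum>a=1..d. v a * x a)\<^sup>2 / t\<^sup>2)) \<partial>P) \<le> 2}. ennreal t)"

definition mean :: "(nat \<Rightarrow> real) measure \<Rightarrow> nat \<Rightarrow> real" where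
  "mean P a = (\<integral>x. x a \<partial>P)"

definition covariance :: "(nat \<Rightarrow> real) measure \<Rightarrow> mat" where
  "covariance P = (\<lambda>(a, b). \<integral>x. (x a - mean P a) * (x b - mean P b) \<partial>P)"

text \<open>\<open>P\<close> is the law of a single observation. The moments below exist because a finite
  \<open>psi2_norm\<close> makes all coordinates sub-Gaussian.\<close>

definition data_distribution :: "nat \<Rightarrow> real \<Rightarrow> mat \<Rightarrow> (nat \<Rightarrow> real) measure \<Rightarrow> bool" where
  "data_distribution d K \<Sigma> P \<longleftrightarrow>
     prob_space P \<and> sets P = sets (Vec d) \<and>
     (\<forall>a\<in>{1..d}. mean P a = 0) \<and>
     (\<forall>a\<in>{1..d}. \<forall>b\<in>{1..d}. covariance P (a, b) = \<Sigma> (a, b)) \<and>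
     psi2_norm d P \<le> ennreal K"

definition quad_form :: "nat \<Rightarrow> mat \<Rightarrow> (nat \<Rightarrow> real) \<Rightarrow> real" where
  "quad_form d A v = (\<Sum>a=1..d. \<Sum>b=1..d. v a * A (a, b) * v b)"

definition cov_class :: "nat \<Rightarrow> real \<Rightarrow> real \<Rightarrow> real \<Rightarrow> mat set" where
  "cov_class d \<alpha> M0 M =
     {\<Sigma>. (\<forall>i\<in>{1..d}. \<forall>j\<in>{1..d}. \<Sigma> (i, j) = \<Sigma> (j, i)) \<and>
          (\<forall>v. 0 \<le> quad_form d \<Sigma> v \<and> quad_form d \<Sigma> v \<le> M0 * (\<Sum>i=1..d. (v i)\<^sup>2)) \<and>
          (\<forall>i\<in>{1..d}. \<forall>j\<in>{1..d}. i \<noteq> j \<longrightarrow>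
             \<bar>\<Sigma> (i, j)\<bar> \<le> M * \<bar>real i - real j\<bar> powr (- (\<alpha> + 1)))}"

section \<open>Block primitive\<close>

text \<open>\<open>clip R I z\<close> is \<open>\<chi>\<^sub>R\<close> of the subvector of \<open>z\<close> indexed by \<open>I\<close>, to be read at indices in \<open>I\<close>;
  division by zero being zero, it maps the zero vector to zero.\<close>

definition clip :: "real \<Rightarrow> nat set \<Rightarrow> (nat \<Rightarrow> real) \<Rightarrow> nat \<Rightarrow> real" where
  "clip R I z = (\<lambda>a. z a * min 1 (R / L2_set z I))"

definition sym_gauss :: "nat \<Rightarrow> mat measure" where
  "sym_gauss D =
     distr (Pi\<^sub>M {(a, b). 1 \<le> a \<and> a \<le> b \<and> b \<le> D} (\<lambda>_. std_normal_distribution)) (Mat D)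
       (\<lambda>z. restrict (\<lambda>(a, b). z (min a b, max a b)) ({1..D} \<times> {1..D}))"

definition dp_cov_block ::
  "nat \<Rightarrow> nat \<Rightarrow> (nat \<Rightarrow> nat \<Rightarrow> real) \<Rightarrow> nat set \<Rightarrow> nat set \<Rightarrow> real \<Rightarrow> real \<Rightarrow> mat measure" where
  "dp_cov_block D n X I J \<rho>\<^sub>B R =
     distr (sym_gauss D) (Mat D)
       (\<lambda>G. restrict
          (mat_on (\<lambda>(a, b). (1 / real n) * (\<Sum>i=1..n. clip R I (X i) a * clip R J (X i) b)
                      + sqrt (18 * R ^ 4 / (\<rho>\<^sub>B * (real n)\<^sup>2)) * G (a, b))
             (I \<times> J))
          ({1..D} \<times> {1..D}))"

section \<open>Adaptive estimator\<close>

locale adaptive_estimator =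
  fixes C0 C L1 c0 :: real and n d :: nat and \<rho> :: real
begin

definition k0 :: nat where
  "k0 = min d (nat \<lceil>C0 * ln (real n)\<rceil>)"

definition k :: "nat \<Rightarrow> nat" where
  "k m = 2 ^ m * k0"

text \<open>Padded dimension: the least \<open>2^J * k0\<close> that is at least \<open>d\<close>. It replaces \<open>d\<close> below; note that
  \<open>k0\<close> is the same for \<open>d\<close> and \<open>D\<close>.\<close>

definition D :: nat where
  "D = 2 ^ (LEAST J. d \<le> 2 ^ J * k0) * k0"

text \<open>The parameters for which \<open>k0\<close> is positive and the maximum in \<open>S\<close> is over a nonempty set.\<close>

definition admissible :: bool where
  "admissible \<longleftrightarrow> 1 \<le> k0 \<and> real k0 \<le> c0 * real n"

definition S :: nat where
  "S = 1 + Max {m. real (k m) \<le> min (c0 * real n) (real D)}"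

text \<open>The division is exact for \<open>m < S\<close>.\<close>

definition N :: "nat \<Rightarrow> nat" where
  "N m = D div k m"

definition I :: "nat \<Rightarrow> nat \<Rightarrow> nat set" where
  "I m l = {1 + (l - 1) * k m .. l * k m}"

definition B :: "nat \<Rightarrow> nat \<Rightarrow> nat \<Rightarrow> (nat \<times> nat) set" where
  "B m l r = I m l \<times> I m (l + r)"

definition \<Gamma> :: "nat \<Rightarrow> nat \<Rightarrow> (nat \<times> nat) set" where
  "\<Gamma> m l = B m l 1 - B (m - 1) (2 * l) 1"

definition budget :: "nat \<Rightarrow> real" where
  "budget m = (if m = 0 then \<rho> / (2 * real S * real (N 0)) else \<rho> / (real S * real (N m)))"

definition tau_sq :: "nat \<Rightarrow> real" where
  "tau_sq m = L1 * ((real (k m) + ln (real D)) / real n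
                    + (real (k m))\<^sup>2 * (real (k m) + ln (real D)) / (budget m * (real n)\<^sup>2)
                    + exp (- 2 * real (k m)))"

text \<open>Triples \<open>(m, l, r)\<close> for which the estimator queries the block \<open>B m l r\<close>.\<close>

definition queries :: "(nat \<times> nat \<times> nat) set" where
  "queries = {(0, l, r) | l r. l \<in> {1..N 0} \<and> r \<in> {0, 1} \<and> l + r \<le> N 0}
             \<union> {(m, l, 1) | m l. m \<in> {1..S - 1} \<and> l \<in> {1..N m - 1}}"

definition pad :: "(nat \<Rightarrow> nat \<Rightarrow> real) \<Rightarrow> nat \<Rightarrow> nat \<Rightarrow> real" where
  "pad X i a = (if a \<in> {1..d} then X i a else 0)"

text \<open>The joint law of the answers, which are independent given the data.\<close>

definition answers :: "(nat \<Rightarrow> nat \<Rightarrow> real) \<Rightarrow> (nat \<times> nat \<times> nat \<Rightarrow> mat) measure" where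
  "answers X =
     Pi\<^sub>M queries (\<lambda>(m, l, r).
       dp_cov_block D n (pad X) (I m l) (I m (l + r)) (budget m) (sqrt (C * real (k m))))"

definition contribution :: "(nat \<times> nat \<times> nat \<Rightarrow> mat) \<Rightarrow> nat \<times> nat \<times> nat \<Rightarrow> mat" where
  "contribution A = (\<lambda>(m, l, r).
     if m = 0 then mat_on (A (0, l, r)) (B 0 l r)
     else let A' = mat_on (A (m, l, r)) (\<Gamma> m l)
          in if (frob D A')\<^sup>2 > real (k m) * tau_sq m then A' else (\<lambda>_. 0))"

text \<open>The regions written by different queries are disjoint, so the successive assignments to a
  matrix that starts at zero amount to a sum. All regions off the diagonal blocks are above the
  diagonal, and the entries below it are filled in by symmetry.\<close>

definition assemble :: "(nat \<times> nat \<times> nat \<Rightarrow> mat) \<Rightarrow> mat" where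
  "assemble A = restrict (\<lambda>(a, b). \<Sum>q\<in>queries. contribution A q (min a b, max a b))
                  ({1..d} \<times> {1..d})"

text \<open>The law of the estimator given the dataset \<open>X\<close>.\<close>

definition estimator :: "(nat \<Rightarrow> nat \<Rightarrow> real) \<Rightarrow> mat measure" where
  "estimator X = distr (answers X) (Mat d) assemble"

end

section \<open>Risk and asymptotic regime\<close>

text \<open>Expected squared Frobenius error for \<open>n\<close> independent observations from \<open>P\<close>; the expectation
  is over the data and the internal randomness of \<open>A\<close>.\<close>

definition frob_risk ::
  "nat \<Rightarrow> nat \<Rightarrow> (nat \<Rightarrow> real) measure \<Rightarrow> ((nat \<Rightarrow> nat \<Rightarrow> real) \<Rightarrow> mat measure) \<Rightarrow> mat \<Rightarrow> ennreal" where
  "frob_risk n d P A \<Sigma> =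
     (\<integral>\<^sup>+ X. (\<integral>\<^sup>+ E. ennreal ((frob d (\<lambda>p. E p - \<Sigma> p))\<^sup>2) \<partial>A X) \<partial>Pi\<^sub>M {1..n} (\<lambda>_. P))"

text \<open>Sequences \<open>(n, d, \<rho>)\<close> are indexed by \<open>s\<close>. The regime constants are \<open>c\<close> (in
  \<open>log n \<le> c d\<close>) and \<open>\<rho>max\<close>.\<close>

definition regime ::
  "real \<Rightarrow> real \<Rightarrow> (nat \<Rightarrow> nat) \<Rightarrow> (nat \<Rightarrow> nat) \<Rightarrow> (nat \<Rightarrow> real) \<Rightarrow> bool" where
  "regime c \<rho>max n d \<rho> \<longleftrightarrow>
     filterlim n at_top sequentially \<and>
     (\<forall>\<^sub>F s in sequentially. ln (real (n s)) \<le> c * real (d s)) \<and>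
     (\<forall>\<^sub>F s in sequentially. 0 < \<rho> s \<and> \<rho> s \<le> \<rho>max) \<and>
     (\<lambda>s. real (d s) / (\<rho> s * (real (n s))\<^sup>2)) \<longlonglongrightarrow> 0"

definition rate :: "real \<Rightarrow> nat \<Rightarrow> nat \<Rightarrow> real \<Rightarrow> real" where
  "rate \<alpha> n d \<rho> =
     min (real n powr (- ((2 * \<alpha> + 1) / (2 * \<alpha> + 2)))) (real d / real n)
     + min ((real d * ln (real n) / (\<rho> * (real n)\<^sup>2)) powr ((2 * \<alpha> + 1) / (2 * \<alpha> + 3)))
           (real d ^ 3 * ln (real n) / (\<rho> * (real n)\<^sup>2))"

end

theory Submission
  imports Defs "HOL-Real_Asymp.Real_Asymp"
begin

text \<open>Privacy. Given the data, every answer is a clipped second-moment matrix plus Gaussian noise, so the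
  estimator is the image, under one map that does not depend on the data, of a standard Gaussian
  array shifted by the rescaled clipped matrices. A map cannot increase the Renyi divergence
  (\<open>renyi_divergence_distr_density_le\<close>), and between two shifts of a Gaussian array the divergence of
  order \<open>t\<close> is \<open>t/2\<close> times the squared distance of the shifts. Replacing one observation moves a matrix
  clipped at radius \<open>R\<close> by at most \<open>2 R\<^sup>2 / n\<close> in Frobenius norm, so that a query adds at most
  \<open>2/9\<close> of its budget to that squared distance, and the budgets add up to at most \<open>\<rho>\<close>
  (\<open>estimator_zCDP\<close>).

  Risk. Above the diagonal, the regions written by the queries partition the pairs that are not too
  far from it: a pair belongs to the first level on which its indices lie in equal or neighbouring intervals
  (\<open>region_level_iff\<close>). On a region of level \<open>m \<ge> 1\<close> with block size \<open>k\<close> let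
      \<open>\<Theta>\<close> be the covariance,
  \<open>E\<close> the error of the noisy answer and \<open>T = k \<tau>\<^sup>2\<close> the threshold. Thresholding costs at most
  \<open>10 min (|\<Theta>|\<^sup>2, T) + 10 |E|\<^sup>2 1{|E|\<^sup>2 > T/4}\<close> (\<open>threshold_error_le\<close>), where
      \<open>|\<cdot>|\<close> is the Frobenius
  norm. The indices of such a region are more than \<open>k/2\<close> apart, hence \<open>|\<Theta>|\<^sup>2\<close> is of order
  \<open>k powr (- 2 \<alpha>)\<close>, while \<open>T\<close> is of the order of the variance of the answer plus a negligible
      term. Over dyadic \<open>k\<close> the sum of
  these minima is dominated by the block size at which the two terms balance
  (\<open>sum_dyadic_powr_min_le\<close>), which gives the two powers in the rate without any knowledge of \<open>\<alpha>\<close>;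
  keeping only the variances gives the terms in \<open>d\<close>.

  It remains to see that \<open>|E|\<^sup>2\<close> rarely exceeds \<open>T/4\<close>. For the Gaussian noise this is a chi-square
  tail. For the sampling error \<open>W\<close> of a block of size \<open>k\<close>, deviations of \<open>|W|\<^sup>2\<close>
      beyond \<open>L k\<^sup>2 / n\<close> have to be exponentially rare in \<open>k\<close>, although the entries of an
  observation may be dependent. With independent standard Gaussian vectors \<open>u\<close> and \<open>v\<close>, the moment of
  order \<open>2 p\<close> of \<open>u\<^sup>T W v\<close> is at least \<open>|W|\<^bsup>2 p\<^esup>\<close> times the
      corresponding moment of one Gaussian variable
  (\<open>frob_power_le_Gauss_bilinear\<close>), and for fixed \<open>u\<close>
      and \<open>v\<close> it is the moment of a sum of independent
  centred sub-exponential variables. For \<open>p = k\<close> this gives a bound \<open>(c k\<^sup>2 / n)\<^sup>k\<close> on the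
      expectation of
  \<open>|W|\<^bsup>2 k\<^esup>\<close> (\<open>sample_cov_frob_moment\<close>), so the part of the expectation of
      \<open>|W|\<^sup>2\<close> above a large
  multiple of \<open>k\<^sup>2 / n\<close> is exponentially small in \<open>k\<close>. The bias of clipping is exponentially small too,
  because a Gaussian mixture of the sub-Gaussian bounds controls an exponential moment of the squared
  norm of an observation restricted to a block (\<open>sub_gaussian_norm_exp\<close>).

  Two contributions are left. The blocks of the lowest level are never thresholded; their noise is
  what the growth condition on \<open>\<rho> n\<^sup>2 / d\<close> pays for (\<open>k0_delta_rate\<close>). Pairs outside all
  regions exist only if the padded dimension exceeds \<open>c0 n\<close>, and then they are more than \<open>c0 n / 2\<close> away
  from the diagonal, where the decay of the covariance suffices (\<open>tail_signal_le\<close>).\<close>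

section \<open>Renyi divergence under post-processing\<close>

lemma powr_young:
  fixes x y t :: real
  assumes "1 < t" "0 \<le> x" "0 \<le> y"
  shows "x powr (t - 1) * y \<le> (t - 1) / t * x powr t + y powr t / t"
proof -
  have "x powr (t - 1) * y \<le> (x powr (t - 1)) powr (t / (t - 1)) / (t / (t - 1)) + y powr t / t"
    by (rule Youngs_inequality) (use assms in \<open>auto simp: field_simps\<close>)
  also have "(x powr (t - 1)) powr (t / (t - 1)) = x powr t"
    using assms by (simp add: powr_powr)
  finally show ?thesis by (simp add: mult.commute)
qed

text \<open>Monotone convergence reduces a moment to its truncations, which are finite and may therefore be
  cancelled in inequalities.\<close>

lemma nn_integral_powr_truncated_le:
  fixes h :: "'a \<Rightarrow> real"
  assumes Q: "prob_space Q" and h[measurable]: "h \<in> borel_measurable Q" and h0: "\<And>x. 0 \<le> h x" and t: "0 < t"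
    and F: "\<And>N. (\<integral>\<^sup>+ x. ennreal (min (h x) (real N) powr t) \<partial>Q) \<le> F"
  shows "(\<integral>\<^sup>+ x. ennreal (h x powr t) \<partial>Q) \<le> F"
proof -
  have eq: "ennreal (h x powr t) = (SUP N. ennreal (min (h x) (real N) powr t))" for x
  proof (rule antisym)
    obtain N where "h x \<le> real N" using real_arch_simple by blast
    then have "min (h x) (real N) = h x" by simp
    then show "ennreal (h x powr t) \<le> (SUP N. ennreal (min (h x) (real N) powr t))"
      by (metis SUP_upper UNIV_I)
    show "(SUP N. ennreal (min (h x) (real N) powr t)) \<le> ennreal (h x powr t)"
      by (intro SUP_least ennreal_leI powr_mono2) (use h0 t in auto)
  qed
  have "(\<integral>\<^sup>+ x. ennreal (h x powr t) \<partial>Q)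
      = (SUP N. \<integral>\<^sup>+ x. ennreal (min (h x) (real N) powr t) \<partial>Q)"
    unfolding eq
  proof (rule nn_integral_monotone_convergence_SUP)
    show "incseq (\<lambda>N x. ennreal (min (h x) (real N) powr t))"
      by (intro incseq_SucI le_funI ennreal_leI powr_mono2) (use h0 t in auto)
  qed measurable
  also have "\<dots> \<le> F" using F by (intro SUP_least) auto
  finally show ?thesis .
qed

text \<open>Data processing. Let \<open>h\<close> be the density of the image of \<open>P\<close> with respect to the image of \<open>Q\<close>. Then
  \<open>\<integral>h\<^sup>t\<close> is the integral of \<open>h\<^bsup>t-1\<^esup>\<close> against the image of \<open>P\<close>, that is of \<open>(h \<circ> g)\<^bsup>t-1\<^esup> f\<close> against \<open>Q\<close>, and
  Young's inequality bounds it by a proper convex combination of \<open>\<integral>h\<^sup>t\<close> itself and \<open>\<integral>f\<^sup>t\<close>. No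
  conditional expectation is involved.\<close>

lemma renyi_divergence_distr_density_le:
  fixes f :: "'a \<Rightarrow> real"
  assumes Q: "prob_space Q" and P: "prob_space P" and f[measurable]: "f \<in> borel_measurable Q"
    and f0: "\<And>x. 0 \<le> f x" and Pf: "P = density Q (\<lambda>x. ennreal (f x))"
    and g[measurable]: "g \<in> measurable Q V" and t: "1 < t" and b: "0 \<le> b"
    and F: "(\<integral>\<^sup>+ x. ennreal (f x powr t) \<partial>Q) \<le> ennreal (exp ((t - 1) * b))"
  shows "renyi_divergence t (distr P V g) (distr Q V g) \<le> ereal b"
proof -
  let ?P = "distr P V g" and ?Q = "distr Q V g"
  have gP[measurable]: "g \<in> measurable P V" unfolding Pf by simp
  interpret Q': prob_space ?Q using Q g by (rule prob_space.prob_space_distr)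
  interpret P': prob_space ?P using P gP by (rule prob_space.prob_space_distr)
  interpret Q: prob_space Q by fact
  have ac: "absolutely_continuous ?Q ?P"
    unfolding absolutely_continuous_def
  proof safe
    fix A assume A: "A \<in> null_sets ?Q"
    then have AV: "A \<in> sets V" by auto
    have "g -` A \<inter> space Q \<in> null_sets Q"
      using A AV by (auto simp: null_sets_def emeasure_distr)
    moreover have "absolutely_continuous Q P" unfolding Pf
      by (rule absolutely_continuousI_density) simp
    ultimately have "g -` A \<inter> space Q \<in> null_sets P"
      by (auto simp: absolutely_continuous_def)
    moreover have "space P = space Q" unfolding Pf by simp
    ultimately show "A \<in> null_sets ?P" using AV by (auto simp: null_sets_def emeasure_distr)
  qed
  define h where "h = (\<lambda>y. enn2real (RN_deriv ?Q ?P y))"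
  have hm[measurable]: "h \<in> borel_measurable V" unfolding h_def by measurable
  have h0: "0 \<le> h y" for y unfolding h_def by simp
  have dens: "density ?Q (RN_deriv ?Q ?P) = ?P"
    by (rule Q'.density_RN_deriv[OF ac]) simp
  have fin: "AE y in ?Q. RN_deriv ?Q ?P y \<noteq> \<infinity>"
    by (rule Q'.RN_deriv_finite[OF _ ac]) (auto intro: P'.sigma_finite_measure_axioms)
  have "density ?Q (RN_deriv ?Q ?P) = density ?Q (\<lambda>y. ennreal (h y))"
    unfolding h_def by (intro density_cong) (use fin in \<open>auto simp: less_top\<close>)
  then have dens_h: "?P = density ?Q (\<lambda>y. ennreal (h y))" using dens by simp
  \<comment> \<open>Truncation makes the moment finite, so that its share on the right-hand side can be subtracted.\<close>
  have trunc: "(\<integral>\<^sup>+ y. ennreal (min (h y) (real N) powr t) \<partial>?Q)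
      \<le> (\<integral>\<^sup>+ x. ennreal (f x powr t) \<partial>Q)"
    (is "?a \<le> ?F") for N
  proof -
    let ?h = "\<lambda>y. min (h y) (real N)"
    have h0': "0 \<le> ?h y" for y using h0 by simp
    have a_fin: "?a < \<infinity>"
    proof -
      have "?a \<le> (\<integral>\<^sup>+ y. ennreal (real N powr t) \<partial>?Q)"
        by (intro nn_integral_mono ennreal_leI powr_mono2) (use h0 t in auto)
      also have "\<dots> = ennreal (real N powr t)" using Q'.emeasure_space_1 by simp
      finally show ?thesis by (simp add: le_less_trans)
    qed
    have "?a \<le> (\<integral>\<^sup>+ y. ennreal (h y) * ennreal (?h y powr (t - 1)) \<partial>?Q)"
    proof (intro nn_integral_mono)
      fix y
      have "?h y powr t = ?h y powr (t - 1) * ?h y"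
        using h0'[of y] by (cases "?h y = 0") (auto simp: powr_diff t)
      also have "\<dots> \<le> h y * ?h y powr (t - 1)"
        using h0[of y] by (simp add: mult_mono mult.commute)
      finally show "ennreal (?h y powr t) \<le> ennreal (h y) * ennreal (?h y powr (t - 1))"
        using h0 by (simp add: ennreal_mult[symmetric] ennreal_leI)
    qed
    also have "\<dots> = (\<integral>\<^sup>+ y. ennreal (?h y powr (t - 1)) \<partial>?P)"
      using arg_cong[OF dens_h, of "\<lambda>M. nn_integral M (\<lambda>y. ennreal (?h y powr (t - 1)))"]
      by (simp add: nn_integral_density)
    also have "\<dots> = (\<integral>\<^sup>+ x. ennreal (?h (g x) powr (t - 1)) \<partial>P)"
      by (simp add: nn_integral_distr)
    also have "\<dots> = (\<integral>\<^sup>+ x. ennreal (f x) * ennreal (?h (g x) powr (t - 1)) \<partial>Q)"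
      unfolding Pf by (simp add: nn_integral_density)
    also have "\<dots> \<le> (\<integral>\<^sup>+ x. ennreal ((t - 1) / t) * ennreal (?h (g x) powr t)
        + ennreal (1 / t) * ennreal (f x powr t) \<partial>Q)"
    proof (intro nn_integral_mono)
      fix x
      have "f x * ?h (g x) powr (t - 1) \<le> (t - 1) / t * ?h (g x) powr t + 1 / t * f x powr t"
        using powr_young[OF t h0' f0, of "g x" x] by (simp add: mult.commute)
      then show "ennreal (f x) * ennreal (?h (g x) powr (t - 1))
          \<le> ennreal ((t - 1) / t) * ennreal (?h (g x) powr t) + ennreal (1 / t) * ennreal (f x powr t)"
        using t f0[of x] by (simp add: ennreal_mult[symmetric] ennreal_plus[symmetric] ennreal_leI del: ennreal_plus)
    qed
    also have "\<dots> = ennreal ((t - 1) / t) * ?a + ennreal (1 / t) * ?F"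
      by (subst nn_integral_add) (auto simp: nn_integral_cmult nn_integral_distr)
    finally have *: "?a \<le> ennreal ((t - 1) / t) * ?a + ennreal (1 / t) * ?F" .
    have Ffin: "?F < \<infinity>" using F by (simp add: le_less_trans)
    obtain a where a: "?a = ennreal a" "0 \<le> a" using a_fin by (cases ?a) auto
    obtain F' where F': "?F = ennreal F'" "0 \<le> F'" using Ffin by (cases ?F) auto
    have "a \<le> (t - 1) / t * a + 1 / t * F'"
      using * a F' t by (simp add: ennreal_mult[symmetric] ennreal_plus[symmetric] ennreal_le_iff del: ennreal_plus)
    then have "a \<le> F'" using t by (simp add: field_simps)
    then show ?thesis using a F' by (simp add: ennreal_leI)
  qed
  have I_le: "(\<integral>\<^sup>+ y. ennreal (h y powr t) \<partial>?Q) \<le> ennreal (exp ((t - 1) * b))"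
    using nn_integral_powr_truncated_le[OF Q'.prob_space_axioms _ h0 _ trunc] F t
    by (auto intro: order_trans)
  then have fin': "(\<integral>\<^sup>+ y. ennreal (h y powr t) \<partial>?Q) \<noteq> \<infinity>" by (auto simp: top_unique)
  define I where "I = enn2real (\<integral>\<^sup>+ y. ennreal (h y powr t) \<partial>?Q)"
  have "I \<le> exp ((t - 1) * b)" unfolding I_def
    using enn2real_mono[OF I_le] by simp
  moreover have "0 \<le> I" unfolding I_def by simp
  ultimately have "ln I \<le> (t - 1) * b"
  proof (cases "I = 0")
    case True
    then show ?thesis using t b by simp
  next
    case False
    then have "ln I \<le> ln (exp ((t - 1) * b))"
      using \<open>0 \<le> I\<close> \<open>I \<le> exp ((t - 1) * b)\<close> by (subst ln_le_cancel_iff) auto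
    then show ?thesis by simp
  qed
  then have "ln I / (t - 1) \<le> b" using t by (simp add: field_simps)
  moreover have "renyi_divergence t ?P ?Q = ereal (ln I / (t - 1))"
    using ac fin' unfolding renyi_divergence_def I_def h_def by (simp add: Let_def)
  ultimately show ?thesis by simp
qed

section \<open>Gaussian product measures and their shifts\<close>

abbreviation Gauss :: "'i set \<Rightarrow> ('i \<Rightarrow> real) measure" where
  "Gauss W \<equiv> Pi\<^sub>M W (\<lambda>_. std_normal_distribution)"

lemma prob_space_std_normal: "prob_space std_normal_distribution"
  by (rule prob_space_normal_density) simp

lemma prob_space_Gauss: "prob_space (Gauss W)"
  by (intro prob_space_PiM prob_space_std_normal)

lemma sets_Gauss [measurable_cong]: "sets (Gauss W) = sets (Pi\<^sub>M W (\<lambda>_. borel))"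
  by (intro sets_PiM_cong) auto

lemma product_sigma_finite_prob: "(\<And>i. prob_space (M i)) \<Longrightarrow> product_sigma_finite M"
  unfolding product_sigma_finite_def by (simp add: prob_space_imp_sigma_finite)

lemma nn_integral_exp_linear_quadratic_normal:
  fixes s \<theta> :: real
  assumes \<theta>: "2 * \<theta> < 1"
  shows "(\<integral>\<^sup>+ x. ennreal (exp (s * x + \<theta> * x\<^sup>2)) \<partial>std_normal_distribution)
    = ennreal (exp (s\<^sup>2 / (2 * (1 - 2 * \<theta>))) / sqrt (1 - 2 * \<theta>))"
proof -
  define \<sigma> where "\<sigma> = 1 / sqrt (1 - 2 * \<theta>)"
  have \<sigma>: "0 < \<sigma>" "\<sigma>\<^sup>2 = 1 / (1 - 2 * \<theta>)" using \<theta> by (auto simp: \<sigma>_def power_divide)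
  have eq: "std_normal_density x * exp (s * x + \<theta> * x\<^sup>2)
    = exp (s\<^sup>2 / (2 * (1 - 2 * \<theta>))) / sqrt (1 - 2 * \<theta>) * normal_density (s * \<sigma>\<^sup>2) \<sigma> x" for x
  proof -
    have sq: "- x\<^sup>2 / 2 + (s * x + (1 - q) / 2 * x\<^sup>2) = s\<^sup>2 / (2 * q) + - (x - s * (1 / q))\<^sup>2 / (2 * (1 / q))"
      if "0 < q" for q :: real
      using that by (simp add: field_simps power2_eq_square)
    have "- x\<^sup>2 / 2 + (s * x + \<theta> * x\<^sup>2)
        = s\<^sup>2 / (2 * (1 - 2 * \<theta>)) + - (x - s * \<sigma>\<^sup>2)\<^sup>2 / (2 * \<sigma>\<^sup>2)"
      unfolding \<sigma>(2) using sq[of "1 - 2 * \<theta>"] \<theta> by simp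
    then have e: "exp (- x\<^sup>2 / 2) * exp (s * x + \<theta> * x\<^sup>2)
        = exp (s\<^sup>2 / (2 * (1 - 2 * \<theta>))) * exp (- (x - s * \<sigma>\<^sup>2)\<^sup>2 / (2 * \<sigma>\<^sup>2))"
      by (simp only: exp_add[symmetric])
    have q: "sqrt (2 * pi * \<sigma>\<^sup>2) = sqrt (2 * pi) / sqrt (1 - 2 * \<theta>)"
      unfolding \<sigma>(2) using \<theta> by (simp add: real_sqrt_mult real_sqrt_divide)
    have "sqrt (1 - 2 * \<theta>) > 0" using \<theta> by simp
    then show ?thesis unfolding std_normal_density_def normal_density_def q using e
      by (simp add: field_simps)
  qed
  have "(\<integral>\<^sup>+ x. ennreal (exp (s * x + \<theta> * x\<^sup>2)) \<partial>std_normal_distribution)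
    = (\<integral>\<^sup>+ x. ennreal (exp (s\<^sup>2 / (2 * (1 - 2 * \<theta>))) / sqrt (1 - 2 * \<theta>))
        * ennreal (normal_density (s * \<sigma>\<^sup>2) \<sigma> x) \<partial>lborel)"
    using \<theta> by (subst nn_integral_density) (auto simp: ennreal_mult[symmetric] eq)
  also have "\<dots> = ennreal (exp (s\<^sup>2 / (2 * (1 - 2 * \<theta>))) / sqrt (1 - 2 * \<theta>))"
    using \<sigma> by (simp add: nn_integral_cmult nn_integral_eq_integral)
  finally show ?thesis .
qed

lemma nn_integral_exp_Gauss:
  fixes s :: "'i \<Rightarrow> real"
  assumes W: "finite W" and \<theta>: "2 * \<theta> < 1"
  shows "(\<integral>\<^sup>+ z. ennreal (exp (\<Sum>w\<in>W. s w * z w + \<theta> * (z w)\<^sup>2)) \<partial>Gauss W)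
    = ennreal (exp ((\<Sum>w\<in>W. (s w)\<^sup>2) / (2 * (1 - 2 * \<theta>))) / sqrt (1 - 2 * \<theta>) ^ card W)"
proof -
  interpret product_sigma_finite "\<lambda>_::'i. std_normal_distribution"
    by (intro product_sigma_finite_prob prob_space_std_normal)
  have "(\<integral>\<^sup>+ z. ennreal (exp (\<Sum>w\<in>W. s w * z w + \<theta> * (z w)\<^sup>2)) \<partial>Gauss W)
     = (\<integral>\<^sup>+ z. (\<Prod>w\<in>W. ennreal (exp (s w * z w + \<theta> * (z w)\<^sup>2))) \<partial>Gauss W)"
    by (simp add: exp_sum W prod_ennreal)
  also have "\<dots> = (\<Prod>w\<in>W. \<integral>\<^sup>+ x. ennreal (exp (s w * x
      + \<theta> * x\<^sup>2)) \<partial>std_normal_distribution)"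
    by (rule product_nn_integral_prod[OF W]) simp
  also have "\<dots> = (\<Prod>w\<in>W. ennreal (exp ((s w)\<^sup>2 / (2 * (1 - 2 * \<theta>))) / sqrt (1 - 2 * \<theta>)))"
    by (simp add: nn_integral_exp_linear_quadratic_normal[OF \<theta>])
  also have "\<dots> = ennreal (exp ((\<Sum>w\<in>W. (s w)\<^sup>2) / (2 * (1 - 2 * \<theta>))) / sqrt (1 - 2 * \<theta>) ^ card W)"
    using \<theta> by (simp add: prod_ennreal prod_dividef exp_sum W sum_divide_distrib)
  finally show ?thesis .
qed

text \<open>This and the next lemma let product measures be handled coordinate by coordinate; both follow by
  comparing the measures on boxes.\<close>

lemma PiM_distr:
  assumes I: "finite I" and M: "\<And>i. prob_space (M i)" and f[measurable]: "\<And>i. f i \<in> measurable (M i) (N i)"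
  shows "Pi\<^sub>M I (\<lambda>i. distr (M i) (N i) (f i))
      = distr (Pi\<^sub>M I M) (Pi\<^sub>M I N) (\<lambda>z. \<lambda>i\<in>I. f i (z i))"
    (is "_ = ?L")
proof (rule sym)
  let ?N = "\<lambda>i. distr (M i) (N i) (f i)"
  interpret p: product_sigma_finite M by (intro product_sigma_finite_prob M)
  interpret q: product_sigma_finite ?N
    by (intro product_sigma_finite_prob prob_space.prob_space_distr M f)
  have ms: "(\<lambda>z. \<lambda>i\<in>I. f i (z i)) \<in> measurable (Pi\<^sub>M I M) (Pi\<^sub>M I N)"
    by (intro measurable_restrict) measurable
  show "?L = Pi\<^sub>M I ?N"
  proof (rule q.PiM_eqI[OF I])
    show "sets ?L = sets (Pi\<^sub>M I ?N)" by (simp cong: sets_PiM_cong)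
    fix A assume A: "\<And>i. i \<in> I \<Longrightarrow> A i \<in> sets (?N i)"
    then have "Pi\<^sub>E I A \<in> sets (Pi\<^sub>M I N)" by (intro sets_PiM_I_finite I) auto
    with ms have "emeasure ?L (Pi\<^sub>E I A) = emeasure (Pi\<^sub>M I M) ((\<lambda>z. \<lambda>i\<in>I. f i (z i)) -`
        Pi\<^sub>E I A \<inter> space (Pi\<^sub>M I M))"
      by (rule emeasure_distr)
    also have "(\<lambda>z. \<lambda>i\<in>I. f i (z i)) -` Pi\<^sub>E I A \<inter> space (Pi\<^sub>M I M)
        = Pi\<^sub>E I (\<lambda>i. f i -` A i \<inter> space (M i))"
      by (auto simp: space_PiM PiE_iff)
    also have "emeasure (Pi\<^sub>M I M) \<dots> = (\<Prod>i\<in>I. emeasure (M i) (f i -` A i \<inter> space (M i)))"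
      using A by (intro p.emeasure_PiM I) auto
    also have "\<dots> = (\<Prod>i\<in>I. emeasure (?N i) (A i))"
      using A by (intro prod.cong refl) (auto simp: emeasure_distr)
    finally show "emeasure ?L (Pi\<^sub>E I A) = (\<Prod>i\<in>I. emeasure (?N i) (A i))" .
  qed
qed

lemma PiM_density:
  assumes I: "finite I" and M: "\<And>i. prob_space (M i)" and f[measurable]: "\<And>i. f i \<in> borel_measurable (M i)"
    and D: "\<And>i. prob_space (density (M i) (f i))"
  shows "Pi\<^sub>M I (\<lambda>i. density (M i) (f i)) = density (Pi\<^sub>M I M) (\<lambda>z. \<Prod>i\<in>I. f i (z i))"
    (is "_ = ?R")
proof (rule sym)
  let ?N = "\<lambda>i. density (M i) (f i)"
  interpret p: product_sigma_finite M by (intro product_sigma_finite_prob M)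
  interpret q: product_sigma_finite ?N by (intro product_sigma_finite_prob D)
  show "?R = Pi\<^sub>M I ?N"
  proof (rule q.PiM_eqI[OF I])
    show "sets ?R = sets (Pi\<^sub>M I ?N)" by (simp cong: sets_PiM_cong)
    fix A assume A: "\<And>i. i \<in> I \<Longrightarrow> A i \<in> sets (?N i)"
    then have A': "Pi\<^sub>E I A \<in> sets (Pi\<^sub>M I M)" by (intro sets_PiM_I_finite I) auto
    have "emeasure ?R (Pi\<^sub>E I A) = (\<integral>\<^sup>+ z. (\<Prod>i\<in>I. f i (z i))
        * indicator (Pi\<^sub>E I A) z \<partial>Pi\<^sub>M I M)"
      using A' by (subst emeasure_density) auto
    also have "\<dots> = (\<integral>\<^sup>+ z. (\<Prod>i\<in>I. f i (z i) * indicator (A i) (z i)) \<partial>Pi\<^sub>M I M)"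
    proof (intro nn_integral_cong)
      fix z assume z: "z \<in> space (Pi\<^sub>M I M)"
      have "indicator (Pi\<^sub>E I A) z = (\<Prod>i\<in>I. indicator (A i) (z i) :: ennreal)"
      proof (cases "z \<in> Pi\<^sub>E I A")
        case True
        then show ?thesis by (auto simp: PiE_iff intro!: prod.neutral[symmetric])
      next
        case False
        then obtain w where "w \<in> I" "z w \<notin> A w"
          using z by (auto simp: space_PiM PiE_iff)
        then have "(\<Prod>i\<in>I. indicator (A i) (z i) :: ennreal) = 0"
          using I by (intro prod_zero bexI[of _ w]) auto
        then show ?thesis using False by simp
      qed
      then show "(\<Prod>i\<in>I. f i (z i)) * indicator (Pi\<^sub>E I A) z = (\<Prod>i\<in>I. f i (z i) * indicator (A i) (z i))"
        by (simp add: prod.distrib)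
    qed
    also have "\<dots> = (\<Prod>i\<in>I. \<integral>\<^sup>+ x. f i x * indicator (A i) x \<partial>M i)"
    proof (rule p.product_nn_integral_prod[OF I])
      fix i assume "i \<in> I"
      then have [measurable]: "A i \<in> sets (M i)" using A by auto
      show "(\<lambda>x. f i x * indicator (A i) x) \<in> borel_measurable (M i)" by measurable
    qed
    also have "\<dots> = (\<Prod>i\<in>I. emeasure (?N i) (A i))"
      using A by (intro prod.cong refl) (auto simp: emeasure_density)
    finally show "emeasure ?R (Pi\<^sub>E I A) = (\<Prod>i\<in>I. emeasure (?N i) (A i))" .
  qed
qed

lemma distr_std_normal_shift:
  "distr std_normal_distribution std_normal_distribution (\<lambda>x. x + \<delta>)
    = density std_normal_distribution (\<lambda>x. ennreal (exp (\<delta> * x - \<delta>\<^sup>2 / 2)))" (is "?L = ?R")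
proof (rule measure_eqI)
  fix A assume "A \<in> sets ?L"
  then have A[measurable]: "A \<in> sets borel" by simp
  have "emeasure ?L A = (\<integral>\<^sup>+ x. indicator A x \<partial>?L)" by simp
  also have "\<dots> = (\<integral>\<^sup>+ x. indicator A (x + \<delta>) \<partial>std_normal_distribution)"
    by (subst nn_integral_distr) auto
  also have "\<dots> = (\<integral>\<^sup>+ x. ennreal (std_normal_density x) * indicator A (x + \<delta>) \<partial>lborel)"
    by (subst nn_integral_density) auto
  also have "\<dots> = (\<integral>\<^sup>+ x. ennreal (std_normal_density (x - \<delta>)) * indicator A x \<partial>lborel)"
    by (subst nn_integral_real_affine[where c=1 and t="- \<delta>"]) (auto simp: algebra_simps)
  also have "\<dots> = (\<integral>\<^sup>+ x. ennreal (std_normal_density x) * (ennreal (exp (\<delta>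
      * x - \<delta>\<^sup>2 / 2)) * indicator A x) \<partial>lborel)"
  proof -
    have "std_normal_density (x - \<delta>) = std_normal_density x * exp (\<delta> * x - \<delta>\<^sup>2 / 2)" for x
      by (simp add: std_normal_density_def exp_add[symmetric] power2_eq_square field_simps)
    then show ?thesis by (simp add: ennreal_mult mult.assoc)
  qed
  also have "\<dots> = (\<integral>\<^sup>+ x. ennreal (exp (\<delta> * x - \<delta>\<^sup>2 / 2))
      * indicator A x \<partial>std_normal_distribution)"
    by (subst nn_integral_density) auto
  also have "\<dots> = emeasure ?R A" by (subst emeasure_density) auto
  finally show "emeasure ?L A = emeasure ?R A" .
qed simp

lemma distr_Gauss_shift:
  fixes \<delta> :: "'i \<Rightarrow> real"
  assumes W: "finite W"
  shows "distr (Gauss W) (Gauss W) (\<lambda>z. \<lambda>w\<in>W. z w + \<delta> w)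
    = density (Gauss W) (\<lambda>z. ennreal (exp (\<Sum>w\<in>W. \<delta> w * z w - (\<delta> w)\<^sup>2 / 2)))"
proof -
  have p: "prob_space (density std_normal_distribution (\<lambda>x. ennreal (exp (\<delta> w * x - (\<delta> w)\<^sup>2 / 2))))" for w
    unfolding distr_std_normal_shift[symmetric]
    by (intro prob_space.prob_space_distr prob_space_std_normal) simp
  have "distr (Gauss W) (Gauss W) (\<lambda>z. \<lambda>w\<in>W. z w + \<delta> w)
    = Pi\<^sub>M W (\<lambda>w. density std_normal_distribution (\<lambda>x. ennreal (exp (\<delta> w * x - (\<delta> w)\<^sup>2 / 2))))"
    unfolding distr_std_normal_shift[symmetric]
    by (rule PiM_distr[symmetric, OF W prob_space_std_normal]) simp
  also have "\<dots> = density (Gauss W) (\<lambda>z. \<Prod>w\<in>W. ennreal (exp (\<delta> w * z w - (\<delta> w)\<^sup>2 / 2)))"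
    by (rule PiM_density[OF W prob_space_std_normal _ p]) simp
  finally show ?thesis by (simp add: exp_sum W prod_ennreal)
qed

text \<open>The index set is a product because the noise consists of one array per query. Both laws are images
  of the second shift followed by \<open>g\<close>, so data processing reduces the claim to the density of the
  shift by the difference \<open>\<delta>\<close>, whose moments are Gaussian integrals.\<close>

lemma renyi_divergence_Gauss_shift_le:
  fixes \<mu> \<mu>' :: "'j \<Rightarrow> 'i \<Rightarrow> real"
  assumes Q: "finite Q" and W: "finite W" and t: "1 < t"
    and g[measurable]: "g \<in> measurable (Pi\<^sub>M Q (\<lambda>_. Gauss W)) V"
  shows "renyi_divergence t (distr (Pi\<^sub>M Q (\<lambda>_. Gauss W)) V (\<lambda>z. g (\<lambda>q\<in>Q. \<lambda>w\<in>W. z q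
      w + \<mu> q w)))
                            (distr (Pi\<^sub>M Q (\<lambda>_. Gauss W)) V (\<lambda>z. g (\<lambda>q\<in>Q. \<lambda>w\<in>W. z q
                                w + \<mu>' q w)))
          \<le> ereal (t * (\<Sum>q\<in>Q. \<Sum>w\<in>W. (\<mu> q w - \<mu>' q w)\<^sup>2) / 2)"
proof -
  let ?G = "Pi\<^sub>M Q (\<lambda>_. Gauss W)"
  define \<delta> where "\<delta> q w = \<mu> q w - \<mu>' q w" for q w
  define sh1 where "sh1 \<nu> z = (\<lambda>w\<in>W. z w + \<nu> w)" for \<nu> z :: "'i \<Rightarrow> real"
  define sh where "sh \<nu> z = (\<lambda>q\<in>Q. sh1 (\<nu> q) (z q))" for \<nu> z :: "'j \<Rightarrow> 'i \<Rightarrow> real"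
  define f where "f q z = exp (\<Sum>w\<in>W. \<delta> q w * z w - (\<delta> q w)\<^sup>2 / 2)" for q z
  have sh1[measurable]: "sh1 \<nu> \<in> measurable (Gauss W) (Gauss W)" for \<nu>
    unfolding sh1_def by (intro measurable_restrict) measurable
  have sh[measurable]: "sh \<nu> \<in> measurable ?G ?G" for \<nu>
    unfolding sh_def by (intro measurable_restrict) measurable
  have f[measurable]: "f q \<in> borel_measurable (Gauss W)" for q
    unfolding f_def by measurable
  have f0: "0 < f q z" for q z by (simp add: f_def)
  let ?P = "distr ?G ?G (sh \<delta>)" and ?f = "\<lambda>z. \<Prod>q\<in>Q. f q (z q)"
  have pG: "prob_space ?G" by (intro prob_space_PiM prob_space_Gauss)
  have shift: "distr (Gauss W) (Gauss W) (sh1 (\<delta> q)) = density (Gauss W) (\<lambda>z. ennreal (f q z))" for q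
    unfolding f_def sh1_def[abs_def] by (rule distr_Gauss_shift[OF W])
  have p1: "prob_space (density (Gauss W) (\<lambda>z. ennreal (f q z)))" for q
    unfolding shift[symmetric] by (intro prob_space.prob_space_distr prob_space_Gauss sh1)
  have "?P = Pi\<^sub>M Q (\<lambda>q. distr (Gauss W) (Gauss W) (sh1 (\<delta> q)))"
    unfolding sh_def[abs_def] by (rule PiM_distr[symmetric, OF Q prob_space_Gauss sh1])
  also have "\<dots> = density ?G (\<lambda>z. \<Prod>q\<in>Q. ennreal (f q (z q)))"
    unfolding shift by (rule PiM_density[OF Q prob_space_Gauss _ p1]) simp
  also have "\<dots> = density ?G (\<lambda>z. ennreal (?f z))"
    by (intro density_cong AE_I2) (auto simp: prod_ennreal f0 less_imp_le)
  finally have Pf: "?P = density ?G (\<lambda>z. ennreal (?f z))" .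
  have I1: "(\<integral>\<^sup>+ z. ennreal (f q z powr t) \<partial>Gauss W)
      = ennreal (exp ((t - 1) * (t * (\<Sum>w\<in>W. (\<delta> q w)\<^sup>2) / 2)))" for q
  proof -
    have "(\<integral>\<^sup>+ z. ennreal (f q z powr t) \<partial>Gauss W)
      = (\<integral>\<^sup>+ z. ennreal (exp (- t * (\<Sum>w\<in>W. (\<delta> q w)\<^sup>2) / 2))
          * ennreal (exp (\<Sum>w\<in>W. (t * \<delta> q w) * z w + 0 * (z w)\<^sup>2)) \<partial>Gauss W)"
      unfolding f_def by (intro nn_integral_cong)
         (simp add: powr_def ennreal_mult[symmetric] exp_add[symmetric] sum_subtractf sum_distrib_left sum_divide_distrib
             algebra_simps sum_negf)
    also have "\<dots> = ennreal (exp (- t * (\<Sum>w\<in>W. (\<delta> q w)\<^sup>2) / 2)) * ennreal (exp ((\<Sum>w\<in>W. (t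
        * \<delta> q w)\<^sup>2) / 2))"
      using nn_integral_exp_Gauss[OF W, of 0 "\<lambda>w. t * \<delta> q w"] by (subst nn_integral_cmult) auto
    also have "\<dots> = ennreal (exp ((t - 1) * (t * (\<Sum>w\<in>W. (\<delta> q w)\<^sup>2) / 2)))"
      by (simp add: ennreal_mult[symmetric] exp_add[symmetric] power_mult_distrib sum_distrib_left[symmetric])
         (simp add: power2_eq_square field_simps)
    finally show ?thesis .
  qed
  interpret G: product_sigma_finite "\<lambda>_::'j. Gauss W"
    by (intro product_sigma_finite_prob prob_space_Gauss)
  have "(\<integral>\<^sup>+ z. ennreal (?f z powr t) \<partial>?G)
      = (\<integral>\<^sup>+ z. (\<Prod>q\<in>Q. ennreal (f q (z q) powr t)) \<partial>?G)"
    by (intro nn_integral_cong) (simp add: prod_ennreal prod_powr_distrib f0 less_imp_le)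
  also have "\<dots> = (\<Prod>q\<in>Q. \<integral>\<^sup>+ z. ennreal (f q z powr t) \<partial>Gauss W)"
    by (rule G.product_nn_integral_prod[OF Q]) simp
  also have "\<dots> = ennreal (exp ((t - 1) * (t * (\<Sum>q\<in>Q. \<Sum>w\<in>W. (\<delta> q w)\<^sup>2) / 2)))"
    unfolding I1 by (simp add: prod_ennreal exp_sum[OF Q, symmetric] sum_distrib_left sum_divide_distrib)
  finally have I: "(\<integral>\<^sup>+ z. ennreal (?f z powr t) \<partial>?G) = \<dots>" .
  have comp: "sh \<mu> z = sh \<mu>' (sh \<delta> z)" for z
    by (intro ext) (simp add: sh_def sh1_def \<delta>_def restrict_def)
  have P: "distr ?G V (\<lambda>z. g (sh \<mu> z)) = distr ?P V (\<lambda>z. g (sh \<mu>' z))"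
    by (simp add: distr_distr comp comp_def)
  have "renyi_divergence t (distr ?P V (\<lambda>z. g (sh \<mu>' z))) (distr ?G V (\<lambda>z. g (sh \<mu>' z)))
     \<le> ereal (t * (\<Sum>q\<in>Q. \<Sum>w\<in>W. (\<delta> q w)\<^sup>2) / 2)"
  proof (rule renyi_divergence_distr_density_le[OF pG _ _ _ Pf])
    show "prob_space ?P" by (intro prob_space.prob_space_distr pG sh)
    show "0 \<le> t * (\<Sum>q\<in>Q. \<Sum>w\<in>W. (\<delta> q w)\<^sup>2) / 2" using t by (simp add: sum_nonneg)
  qed (use t I f0 in \<open>auto intro!: prod_nonneg simp: less_imp_le\<close>)
  then show ?thesis unfolding P[symmetric] by (simp add: sh_def sh1_def \<delta>_def)
qed

section \<open>Gaussian moments\<close>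

lemma Gauss_component: "w \<in> W \<Longrightarrow> (\<lambda>z. z w) \<in> borel_measurable (Gauss W)"
  using measurable_component_singleton[of w W "\<lambda>_. std_normal_distribution"] by simp

lemma distr_Gauss_component:
  assumes "w \<in> W" shows "distr (Gauss W) borel (\<lambda>z. z w) = std_normal_distribution"
proof -
  have "distr (Gauss W) borel (\<lambda>z. z w) = distr (Gauss W) std_normal_distribution (\<lambda>z. z w)"
    by (intro distr_cong) auto
  also have "\<dots> = std_normal_distribution"
    using assms by (intro distr_PiM_component prob_space_std_normal)
  finally show ?thesis .
qed

text \<open>A linear form in independent standard Gaussian variables is Gaussian; coordinates with coefficient
  zero are dropped first because the convolution lemma needs positive variances.\<close>

lemma nn_integral_Gauss_linear_power:
  fixes c :: "'i \<Rightarrow> real"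
  assumes W: "finite W"
  shows "(\<integral>\<^sup>+ z. ennreal ((\<Sum>w\<in>W. c w * z w) ^ (2 * p)) \<partial>Gauss W)
    = ennreal (fact (2 * p) / (2 ^ p * fact p) * (\<Sum>w\<in>W. (c w)\<^sup>2) ^ p)"
proof -
  define W' where "W' = {w\<in>W. c w \<noteq> 0}"
  have W': "finite W'" "W' \<subseteq> W" using W by (auto simp: W'_def)
  have s: "(\<Sum>w\<in>W. c w * z w) = (\<Sum>w\<in>W'. c w * z w)" "(\<Sum>w\<in>W. (c w)\<^sup>2)
      = (\<Sum>w\<in>W'. (c w)\<^sup>2)" for z
    using W by (auto simp: W'_def intro!: sum.mono_neutral_right)
  interpret G: prob_space "Gauss W" by (rule prob_space_Gauss)
  show ?thesis
  proof (cases "W' = {}")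
    case True
    then show ?thesis unfolding s by (cases p) (simp_all add: G.emeasure_space_1)
  next
    case False
    let ?s2 = "\<Sum>w\<in>W'. (c w)\<^sup>2"
    have s2: "0 < ?s2" using W' False by (intro sum_pos) (auto simp: W'_def)
    have dist1: "distributed (Gauss W) lborel (\<lambda>z. c w * z w) (normal_density 0 \<bar>c w\<bar>)" if w: "w \<in> W'" for w
    proof -
      have "distr (Gauss W) lborel (\<lambda>z. z w) = distr (Gauss W) borel (\<lambda>z. z w)"
        by (intro distr_cong) auto
      then have "distributed (Gauss W) lborel (\<lambda>z. z w) (normal_density 0 1)"
        using w W' Gauss_component[of w W] distr_Gauss_component[of w W] by (auto simp: distributed_def)
      from G.normal_density_affine[OF this, of "c w" 0] show ?thesis using w by (simp add: W'_def)
    qed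
    have m: "(\<lambda>z. c w * z w) \<in> borel_measurable (Gauss W)" if "w \<in> W'" for w
      using Gauss_component[of w W] W' that by auto
    have indep: "G.indep_vars (\<lambda>i. borel) (\<lambda>w z. c w * z w) W'"
    proof (subst G.indep_vars_iff_distr_eq_PiM')
      let ?r = "\<lambda>z. restrict z W'"
      have r: "distr (Gauss W) (Gauss W') ?r = Gauss W'"
        using prob_space_std_normal W' by (intro product_prob_space.distr_PiM_restrict_finite) 
          (auto intro!: product_prob_spaceI)
      have rm: "?r \<in> measurable (Gauss W) (Gauss W')" using W'(2) by (rule measurable_restrict_subset)
      have "Pi\<^sub>M W' (\<lambda>w. distr std_normal_distribution borel (\<lambda>x. c w * x))
          = distr (Gauss W') (Pi\<^sub>M W' (\<lambda>_. borel)) (\<lambda>z. \<lambda>w\<in>W'. c w * z w)"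
        by (rule PiM_distr[OF W'(1) prob_space_std_normal]) simp
      also have "\<dots> = distr (distr (Gauss W) (Gauss W') ?r) (Pi\<^sub>M W' (\<lambda>_. borel)) (\<lambda>z.
          \<lambda>w\<in>W'. c w * z w)"
        by (simp only: r)
      also have "\<dots> = distr (Gauss W) (Pi\<^sub>M W' (\<lambda>_. borel)) ((\<lambda>z. \<lambda>w\<in>W'. c w * z w) \<circ> ?r)"
        using Gauss_component by (intro distr_distr rm measurable_restrict) auto
      also have "(\<lambda>z. \<lambda>w\<in>W'. c w * z w) \<circ> ?r = (\<lambda>z. \<lambda>w\<in>W'. c w * z w)"
          by (auto simp: fun_eq_iff)
      finally have "distr (Gauss W) (Pi\<^sub>M W' (\<lambda>_. borel)) (\<lambda>z. \<lambda>w\<in>W'. c w * z w)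
          = Pi\<^sub>M W' (\<lambda>w. distr std_normal_distribution borel (\<lambda>x. c w * x))" ..
      also have "\<dots> = Pi\<^sub>M W' (\<lambda>w. distr (Gauss W) borel (\<lambda>z. c w * z w))"
      proof (intro PiM_cong refl)
        fix w assume "w \<in> W'"
        then have w: "w \<in> W" using W' by auto
        show "distr std_normal_distribution borel (\<lambda>x. c w * x) = distr (Gauss W) borel (\<lambda>z. c w * z w)"
        proof -
          have "distr std_normal_distribution borel (\<lambda>x. c w * x)
              = distr (distr (Gauss W) borel (\<lambda>z. z w)) borel (\<lambda>x. c w * x)"
            by (simp only: distr_Gauss_component[OF w])
          also have "\<dots> = distr (Gauss W) borel ((\<lambda>x. c w * x) \<circ> (\<lambda>z. z w))"
            using Gauss_component[OF w] by (intro distr_distr) auto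
          finally show ?thesis by (simp add: comp_def)
        qed
      qed
      finally show "distr (Gauss W) (Pi\<^sub>M W' (\<lambda>i. borel)) (\<lambda>x. \<lambda>i\<in>W'. c i * x i)
          = Pi\<^sub>M W' (\<lambda>i. distr (Gauss W) borel (\<lambda>z. c i * z i))" .
    qed (use m False in auto)
    have "distributed (Gauss W) lborel (\<lambda>z. \<Sum>w\<in>W'. c w
        * z w) (normal_density (\<Sum>w\<in>W'. 0) (sqrt (\<Sum>w\<in>W'. \<bar>c w\<bar>\<^sup>2)))"
      by (rule G.sum_indep_normal[OF W'(1) False indep _ dist1]) (auto simp: W'_def)
    then have dist: "distributed (Gauss W) lborel (\<lambda>z. \<Sum>w\<in>W'. c w * z w) (normal_density 0 (sqrt ?s2))" by simp
    have "(\<integral>\<^sup>+ z. ennreal ((\<Sum>w\<in>W'. c w * z w) ^ (2 * p)) \<partial>Gauss W)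
       = (\<integral>\<^sup>+ x. ennreal (normal_density 0 (sqrt ?s2) x) * ennreal (x ^ (2 * p)) \<partial>lborel)"
      by (rule distributed_nn_integral[OF dist, symmetric]) simp
    also have "\<dots> = (\<integral>\<^sup>+ x. ennreal (normal_density 0 (sqrt ?s2) x * (x - 0) ^ (2 * p)) \<partial>lborel)"
      by (simp add: ennreal_mult[symmetric])
    also have "\<dots> = ennreal (fact (2 * p) / ((2 / (sqrt ?s2)\<^sup>2) ^ p * fact p))"
    proof -
      have "has_bochner_integral lborel (\<lambda>x. normal_density 0 (sqrt ?s2) x * (x - 0) ^ (2 * p)) (fact (2
          * p) / ((2 / (sqrt ?s2)\<^sup>2) ^ p * fact p))"
        using s2 by (intro normal_moment_even) simp
      then show ?thesis
        by (subst nn_integral_eq_integral) (simp_all only: has_bochner_integral_iff, simp_all)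
    qed
    also have "\<dots> = ennreal (fact (2 * p) / (2 ^ p * fact p) * ?s2 ^ p)"
      using s2 by (simp add: power_divide)
    finally show ?thesis unfolding s .
  qed
qed

text \<open>The tangent to \<open>y ^ p\<close> at \<open>e\<close> lies below the graph.\<close>

lemma power_tangent_le:
  fixes e y :: real
  assumes p: "1 \<le> p" and e: "0 \<le> e" and y: "0 \<le> y"
  shows "real p * e ^ (p - 1) * y \<le> y ^ p + real (p - 1) * e ^ p"
proof (cases "e = 0")
  case True
  then show ?thesis using p y by (cases "p = 1") (auto simp: power_0_left)
next
  case False
  then have e: "0 < e" using e by simp
  have "1 + real p * (y / e - 1) \<le> (1 + (y / e - 1)) ^ p"
    using y e by (intro Bernoulli_inequality) simp
  then have "e ^ p * (1 + real p * (y / e - 1)) \<le> e ^ p * (y / e) ^ p"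
    using e by (intro mult_left_mono) auto
  then have "e ^ p * (1 + real p * (y / e - 1)) \<le> y ^ p" using e by (simp add: power_divide)
  moreover have ep: "e ^ p = e * e ^ (p - 1)" using p by (cases p) auto
  moreover have "e * e ^ (p - 1) * (1 + real p * (y / e - 1)) = e ^ p + real p * e ^ (p - 1) * y - real p * e ^ p"
    unfolding ep using e by (simp add: field_simps)
  ultimately show ?thesis using p by (simp add: of_nat_diff algebra_simps)
qed

text \<open>Integrate the tangent inequality at the point \<open>e\<close>; a limit covers \<open>e = 0\<close>.\<close>

lemma power_mean_nn_integral:
  assumes P: "prob_space P" and p: "1 \<le> p" and f[measurable]: "f \<in> borel_measurable P" and f0: "\<And>x. 0 \<le> f x"
    and e: "0 \<le> e" and E: "(\<integral>\<^sup>+ x. ennreal (f x ^ p) \<partial>P) \<le> ennreal (e ^ p)"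
  shows "(\<integral>\<^sup>+ x. ennreal (f x) \<partial>P) \<le> ennreal e"
proof -
  interpret prob_space P by fact
  have *: "ennreal (real p * e ^ (p - 1)) * (\<integral>\<^sup>+ x. ennreal (f x) \<partial>P)
      \<le> ennreal (real p * e ^ p)" if "0 \<le> e" "(\<integral>\<^sup>+ x. ennreal (f x ^ p) \<partial>P) \<le> ennreal (e ^ p)" for e
  proof -
    have "ennreal (real p * e ^ (p - 1)) * (\<integral>\<^sup>+ x. ennreal (f x) \<partial>P)
        = (\<integral>\<^sup>+ x. ennreal (real p * e ^ (p - 1)) * ennreal (f x) \<partial>P)"
      by (simp add: nn_integral_cmult)
    also have "\<dots> \<le> (\<integral>\<^sup>+ x. ennreal (f x ^ p) + ennreal (real (p - 1) * e ^ p) \<partial>P)"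
      using power_tangent_le[OF p that(1) f0] that(1) f0
          by (intro nn_integral_mono) (simp add: ennreal_mult[symmetric] ennreal_plus[symmetric] ennreal_leI del: ennreal_plus)
    also have "\<dots> = (\<integral>\<^sup>+ x. ennreal (f x ^ p) \<partial>P) + ennreal (real (p - 1) * e ^ p)"
      by (subst nn_integral_add) (auto simp: emeasure_space_1)
    also have "\<dots> \<le> ennreal (e ^ p) + ennreal (real (p - 1) * e ^ p)" using that(2) by (rule add_right_mono)
    also have "\<dots> = ennreal (e ^ p + real (p - 1) * e ^ p)"
      using that(1) by (intro ennreal_plus[symmetric]) auto
    also have "e ^ p + real (p - 1) * e ^ p = real p * e ^ p" using p by (simp add: of_nat_diff algebra_simps)
    finally show ?thesis .
  qed
  have pos: "(\<integral>\<^sup>+ x. ennreal (f x) \<partial>P)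
      \<le> ennreal e" if e: "0 < e" "(\<integral>\<^sup>+ x. ennreal (f x ^ p) \<partial>P) \<le> ennreal (e ^ p)" for e
  proof -
    have "e ^ p = e ^ (p - 1) * e" using p by (cases p) auto
    then have "ennreal (real p * e ^ (p - 1)) * (\<integral>\<^sup>+ x. ennreal (f x) \<partial>P)
        \<le> ennreal (real p * e ^ (p - 1)) * ennreal e"
      using *[of e] e by (simp add: ennreal_mult[symmetric] mult.assoc)
    then show ?thesis using e p by (subst (asm) ennreal_mult_le_mult_iff) auto
  qed
  show ?thesis
  proof (rule ennreal_le_epsilon)
    fix r :: real assume r: "0 < r"
    have "e ^ p \<le> (e + r) ^ p" using r e by (intro power_mono) auto
    then have "(\<integral>\<^sup>+ x. ennreal (f x ^ p) \<partial>P) \<le> ennreal ((e + r) ^ p)"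
      using E by (auto intro: order_trans ennreal_leI)
    from pos[OF _ this] show "(\<integral>\<^sup>+ x. ennreal (f x) \<partial>P) \<le> ennreal e + ennreal r"
      using e r by (simp add: ennreal_plus[symmetric] del: ennreal_plus)
  qed
qed

text \<open>Decoupling by Gaussian vectors. For fixed \<open>v\<close>, the form is linear in \<open>u\<close> with variance \<open>|A v|\<^sup>2\<close>; the
  expectation of \<open>|A v|\<^sup>2\<close> over \<open>v\<close> is the squared Frobenius norm, and the power mean inequality
  moves the power inside.\<close>

lemma frob_power_le_Gauss_bilinear:
  fixes A :: "'i \<Rightarrow> 'j \<Rightarrow> real"
  assumes I: "finite I" and J: "finite J" and p: "1 \<le> p"
  shows "ennreal (fact (2 * p) / (2 ^ p * fact p) * (\<Sum>a\<in>I. \<Sum>b\<in>J. (A a b)\<^sup>2) ^ p)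
    \<le> (\<integral>\<^sup>+ v. (\<integral>\<^sup>+ u. ennreal ((\<Sum>a\<in>I. (\<Sum>b\<in>J. A a b * v b) * u a) ^ (2
        * p)) \<partial>Gauss I) \<partial>Gauss J)"
proof -
  let ?c = "fact (2 * p) / (2 ^ p * fact p) :: real"
  let ?h = "\<lambda>v. \<Sum>a\<in>I. (\<Sum>b\<in>J. A a b * v b)\<^sup>2"
  have h0: "0 \<le> ?h v" for v by (intro sum_nonneg) simp
  have h1: "0 \<le> (\<Sum>a\<in>I. \<Sum>b\<in>J. (A a b)\<^sup>2)" by (intro sum_nonneg) simp
  have hm[measurable]: "(\<lambda>v. (\<Sum>b\<in>J. A a b * v b)) \<in> borel_measurable (Gauss J)" for a
    by (intro borel_measurable_sum borel_measurable_times borel_measurable_const Gauss_component)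
  have E: "(\<integral>\<^sup>+ v. ennreal (?h v) \<partial>Gauss J) = ennreal (\<Sum>a\<in>I. \<Sum>b\<in>J. (A a b)\<^sup>2)"
  proof -
    have "(\<integral>\<^sup>+ v. ennreal (?h v) \<partial>Gauss J)
        = (\<Sum>a\<in>I. \<integral>\<^sup>+ v. ennreal ((\<Sum>b\<in>J. A a b * v b)\<^sup>2) \<partial>Gauss J)"
      by (subst nn_integral_sum[symmetric]) (auto simp: sum_ennreal)
    also have "\<dots> = (\<Sum>a\<in>I. ennreal (\<Sum>b\<in>J. (A a b)\<^sup>2))"
      using nn_integral_Gauss_linear_power[OF J, of _ 1] by simp
    finally show ?thesis by (simp add: sum_ennreal sum_nonneg)
  qed
  have "ennreal (?c * (\<Sum>a\<in>I. \<Sum>b\<in>J. (A a b)\<^sup>2) ^ p)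
      = ennreal ?c * ennreal ((\<Sum>a\<in>I. \<Sum>b\<in>J. (A a b)\<^sup>2) ^ p)"
    by (intro ennreal_mult zero_le_power h1) simp
  also have "\<dots> \<le> ennreal ?c * (\<integral>\<^sup>+ v. ennreal (?h v ^ p) \<partial>Gauss J)"
  proof (rule mult_left_mono)
   show "ennreal ((\<Sum>a\<in>I. \<Sum>b\<in>J. (A a b)\<^sup>2) ^ p) \<le> (\<integral>\<^sup>+ v. ennreal (?h v ^ p) \<partial>Gauss J)"
  proof (cases "\<integral>\<^sup>+ v. ennreal (?h v ^ p) \<partial>Gauss J")
    case (real r)
    let ?e = "root p r"
    have e: "?e ^ p = r" "0 \<le> ?e" using p real by (auto simp: real_root_pow_pos2)
    have "(\<integral>\<^sup>+ v. ennreal (?h v) \<partial>Gauss J) \<le> ennreal ?e"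
      by (rule power_mean_nn_integral[OF prob_space_Gauss p _ h0 e(2)]) (use real e in auto)
    from iffD1[OF ennreal_le_iff this[unfolded E]] e
    have "(\<Sum>a\<in>I. \<Sum>b\<in>J. (A a b)\<^sup>2) ^ p \<le> ?e ^ p" by (intro power_mono h1) auto
    then show ?thesis using real e by (simp add: ennreal_leI)
   qed simp
  qed simp
  also have "\<dots> = (\<integral>\<^sup>+ v. ennreal ?c * ennreal (?h v ^ p) \<partial>Gauss J)"
    by (subst nn_integral_cmult) auto
  also have "\<dots> = (\<integral>\<^sup>+ v. (\<integral>\<^sup>+ u. ennreal ((\<Sum>a\<in>I. (\<Sum>b\<in>J. A a b * v b)
      * u a) ^ (2 * p)) \<partial>Gauss I) \<partial>Gauss J)"
    unfolding nn_integral_Gauss_linear_power[OF I]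
    by (intro nn_integral_cong ennreal_mult[symmetric] zero_le_power h0) simp
  finally show ?thesis .
qed

text \<open>Linear forms of norm at most one, instead of exactly one, make the notion stable under padding
  with zero coordinates.\<close>

definition sub_gaussian :: "'x measure \<Rightarrow> real \<Rightarrow> 'i set \<Rightarrow> ('i \<Rightarrow> 'x \<Rightarrow>
    real) \<Rightarrow> bool" where
  "sub_gaussian P \<kappa> I X \<longleftrightarrow> (\<forall>a\<in>I. X a \<in> borel_measurable P) \<and>
    (\<forall>u. (\<Sum>a\<in>I. (u a)\<^sup>2) \<le> 1 \<longrightarrow> (\<integral>\<^sup>+ x. ennreal (exp ((\<Sum>a\<in>I. u
        a * X a x)\<^sup>2 / \<kappa>\<^sup>2)) \<partial>P) \<le> 2)"

lemma sub_gaussian_linear: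
  assumes sg: "sub_gaussian P \<kappa> I X" and s: "0 < (\<Sum>a\<in>I. (v a)\<^sup>2)"
  shows "(\<integral>\<^sup>+ x. ennreal (exp ((\<Sum>a\<in>I. v a * X a x)\<^sup>2 / (\<kappa>\<^sup>2
      * (\<Sum>a\<in>I. (v a)\<^sup>2)))) \<partial>P) \<le> 2"
proof -
  let ?s = "\<Sum>a\<in>I. (v a)\<^sup>2"
  define u where "u a = v a / sqrt ?s" for a
  have "(\<Sum>a\<in>I. (u a)\<^sup>2) = 1" using s by (simp add: u_def power_divide sum_divide_distrib[symmetric])
  moreover have "(\<Sum>a\<in>I. u a * X a x)\<^sup>2 / \<kappa>\<^sup>2
      = (\<Sum>a\<in>I. v a * X a x)\<^sup>2 / (\<kappa>\<^sup>2 * ?s)" for x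
    using s by (simp add: u_def sum_divide_distrib[symmetric] power_divide mult.commute)
  ultimately show ?thesis using sg unfolding sub_gaussian_def by (auto dest!: spec[of _ u])
qed

text \<open>Write \<open>exp (|X|\<^sup>2 / 2)\<close> as a Gaussian mixture of exponentials of linear forms and exchange the
  integrals. This bound grows like \<open>sqrt 2 ^ card I\<close>, which clipping at a radius of order
  \<open>sqrt (card I)\<close> can beat.\<close>

lemma sub_gaussian_norm_exp:
  assumes P: "prob_space P" and I: "finite I" and \<kappa>: "0 < \<kappa>" and sg: "sub_gaussian P \<kappa> I X"
  shows "(\<integral>\<^sup>+ x. ennreal (exp ((\<Sum>a\<in>I. (X a x)\<^sup>2) / (2 * \<kappa>\<^sup>2))) \<partial>P)
      \<le> ennreal (2 * sqrt 2 ^ card I)"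
proof -
  interpret P: prob_space P by fact
  interpret G: prob_space "Gauss I" by (rule prob_space_Gauss)
  interpret PG: pair_sigma_finite P "Gauss I" ..
  have X[measurable]: "a \<in> I \<Longrightarrow> X a \<in> borel_measurable P" for a using sg by (auto simp: sub_gaussian_def)
  have [measurable]: "(\<lambda>p. \<Sum>a\<in>I. snd p a * X a (fst p)) \<in> borel_measurable (P \<Otimes>\<^sub>M Gauss I)"
    by (intro borel_measurable_sum borel_measurable_times measurable_compose[OF measurable_snd Gauss_component]
       measurable_compose[OF measurable_fst X])
  have "(\<integral>\<^sup>+ x. ennreal (exp ((\<Sum>a\<in>I. (X a x)\<^sup>2) / (2 * \<kappa>\<^sup>2))) \<partial>P)
     = (\<integral>\<^sup>+ x. (\<integral>\<^sup>+ g. ennreal (exp ((\<Sum>a\<in>I. g a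
         * X a x) / \<kappa>)) \<partial>Gauss I) \<partial>P)"
  proof (intro nn_integral_cong)
    fix x
    show "ennreal (exp ((\<Sum>a\<in>I. (X a x)\<^sup>2) / (2 * \<kappa>\<^sup>2)))
        = (\<integral>\<^sup>+ g. ennreal (exp ((\<Sum>a\<in>I. g a * X a x) / \<kappa>)) \<partial>Gauss I)"
      using nn_integral_exp_Gauss[OF I, of 0 "\<lambda>a. X a x / \<kappa>"]
      by (simp add: power_divide sum_divide_distrib[symmetric] mult.commute divide_divide_eq_left)
  qed
  also have "\<dots> = (\<integral>\<^sup>+ g. (\<integral>\<^sup>+ x. ennreal (exp ((\<Sum>a\<in>I. g a
      * X a x) / \<kappa>)) \<partial>P) \<partial>Gauss I)"
    by (intro PG.Fubini'[symmetric]) (simp add: split_def)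
  also have "\<dots> \<le> (\<integral>\<^sup>+ g. 2 * ennreal (exp (\<Sum>a\<in>I. 0 * g a + 1 / 4 * (g a)\<^sup>2)) \<partial>Gauss I)"
  proof (intro nn_integral_mono)
    fix g
    let ?s = "\<Sum>a\<in>I. (g a)\<^sup>2" and ?Y = "\<lambda>x. \<Sum>a\<in>I. g a * X a x"
    have s0: "0 \<le> ?s" by (simp add: sum_nonneg)
    show "(\<integral>\<^sup>+ x. ennreal (exp (?Y x / \<kappa>)) \<partial>P)
        \<le> 2 * ennreal (exp (\<Sum>a\<in>I. 0 * g a + 1 / 4 * (g a)\<^sup>2))"
    proof (cases "?s = 0")
      case True
      then have "\<forall>a\<in>I. g a = 0" using I by (simp add: sum_nonneg_eq_0_iff)
      then show ?thesis by (simp add: P.emeasure_space_1)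
    next
      case False
      then have s: "0 < ?s" using s0 by linarith
      have "?Y x / \<kappa> \<le> ?s / 4 + (?Y x)\<^sup>2 / (\<kappa>\<^sup>2 * ?s)" for x
      proof -
        have "2 * (sqrt ?s / 2) * (?Y x / (\<kappa> * sqrt ?s)) \<le> (sqrt ?s / 2)\<^sup>2 + (?Y x / (\<kappa> * sqrt ?s))\<^sup>2"
          by (rule sum_squares_bound)
        then show ?thesis using s \<kappa> by (simp add: power_divide power_mult_distrib)
      qed
      then have "(\<integral>\<^sup>+ x. ennreal (exp (?Y x / \<kappa>)) \<partial>P)
          \<le> (\<integral>\<^sup>+ x. ennreal (exp (?s / 4)) * ennreal (exp ((?Y x)\<^sup>2 / (\<kappa>\<^sup>2 * ?s))) \<partial>P)"
        by (intro nn_integral_mono) (simp add: ennreal_mult[symmetric] exp_add[symmetric] ennreal_leI)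
      also have "\<dots> = ennreal (exp (?s / 4)) * (\<integral>\<^sup>+ x. ennreal (exp ((?Y x)\<^sup>2 / (\<kappa>\<^sup>2
          * ?s))) \<partial>P)"
        by (subst nn_integral_cmult) auto
      also have "\<dots> \<le> ennreal (exp (?s / 4)) * 2"
        by (intro mult_left_mono sub_gaussian_linear[OF sg s]) auto
      finally show ?thesis by (simp add: sum_divide_distrib mult.commute)
    qed
  qed
  also have "\<dots> = 2 * ennreal (1 / sqrt (1 / 2) ^ card I)"
    using nn_integral_exp_Gauss[OF I, of "1/4" "\<lambda>_. 0"]
    by (subst nn_integral_cmult) (auto intro!: borel_measurable_sum Gauss_component)
  also have "\<dots> = ennreal (2 * sqrt 2 ^ card I)"
    by (simp add: real_sqrt_divide power_one_over[symmetric] ennreal_mult)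
  finally show ?thesis .
qed

section \<open>Sums of sub-exponential variables\<close>

text \<open>Taylor's formula, with the remainder absorbed by the exponential.\<close>

lemma exp_le_quadratic:
  fixes s z :: real
  assumes s: "\<bar>s\<bar> \<le> 1/2"
  shows "exp (s * z) \<le> 1 + s * z + 4 * s\<^sup>2 * exp \<bar>z\<bar>"
proof -
  let ?x = "s * z"
  obtain t where t: "\<bar>t\<bar> \<le> \<bar>?x\<bar>" "exp ?x = (\<Sum>m<2. ?x ^ m / fact m) + exp t / fact 2 * ?x ^ 2"
    using Maclaurin_exp_le[of ?x 2] by blast
  have xz: "\<bar>?x\<bar> \<le> \<bar>z\<bar> / 2" using mult_right_mono[OF s, of "\<bar>z\<bar>"] by (simp add: abs_mult)
  have "exp t \<le> exp (\<bar>z\<bar> / 2)" using t(1) xz by simp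
  moreover have "z\<^sup>2 \<le> 8 * exp (\<bar>z\<bar> / 2)"
    using exp_lower_Taylor_quadratic[of "\<bar>z\<bar> / 2"] by (simp add: power_divide)
  ultimately have "exp t * z\<^sup>2 \<le> exp (\<bar>z\<bar> / 2) * (8 * exp (\<bar>z\<bar> / 2))" by (intro mult_mono) auto
  also have "\<dots> = 8 * exp \<bar>z\<bar>" by (simp add: exp_add[symmetric])
  finally have "s\<^sup>2 * (exp t * z\<^sup>2) \<le> s\<^sup>2 * (8 * exp \<bar>z\<bar>)" by (intro mult_left_mono) auto
  then show ?thesis unfolding t(2) by (simp add: numeral_2_eq_2 power_mult_distrib field_simps)
qed

lemma exp_moment_integrable:
  assumes P: "prob_space P" and y[measurable]: "y \<in> borel_measurable P"
    and E: "(\<integral>\<^sup>+ x. ennreal (exp \<bar>y x\<bar>) \<partial>P) \<le> 2"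
  shows "integrable P (\<lambda>x. exp \<bar>y x\<bar>)" "integrable P y" "\<bar>integral\<^sup>L P y\<bar>
      \<le> 1" "(\<integral>x. exp \<bar>y x\<bar> \<partial>P) \<le> 2"
proof -
  interpret prob_space P by fact
  show i: "integrable P (\<lambda>x. exp \<bar>y x\<bar>)"
    using E by (intro integrableI_nonneg) (auto simp: le_less_trans[OF E])
  have le: "\<bar>y x\<bar> \<le> exp \<bar>y x\<bar>" "\<bar>y x\<bar> \<le> exp \<bar>y x\<bar> - 1" for x
      using exp_ge_add_one_self[of "\<bar>y x\<bar>"] by linarith+
  show iy: "integrable P y"
    by (rule Bochner_Integration.integrable_bound[OF i]) (use le in auto)
  have "ennreal (\<integral>x. exp \<bar>y x\<bar> \<partial>P) \<le> ennreal 2"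
    using E nn_integral_eq_integral[OF i] by simp
  from iffD1[OF ennreal_le_iff this] show e2: "(\<integral>x. exp \<bar>y x\<bar> \<partial>P) \<le> 2" by simp
  have "\<bar>integral\<^sup>L P y\<bar> \<le> (\<integral>x. \<bar>y x\<bar> \<partial>P)" using integral_abs_bound by blast
  also have "\<dots> \<le> (\<integral>x. exp \<bar>y x\<bar> - 1 \<partial>P)" using iy i le by (intro integral_mono) auto
  also have "\<dots> \<le> 1" using i e2 by (simp add: prob_space)
  finally show "\<bar>integral\<^sup>L P y\<bar> \<le> 1" .
qed

lemma exp_moment_centered_mgf:
  assumes P: "prob_space P" and y[measurable]: "y \<in> borel_measurable P"
    and E: "(\<integral>\<^sup>+ x. ennreal (exp \<bar>y x\<bar>) \<partial>P) \<le> 2" and s: "\<bar>s\<bar> \<le> 1/2"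
  shows "(\<integral>\<^sup>+ x. ennreal (exp (s * (y x - integral\<^sup>L P y))) \<partial>P) \<le> ennreal (exp (24 * s\<^sup>2))"
proof -
  interpret prob_space P by fact
  note I = exp_moment_integrable[OF P y E]
  let ?m = "integral\<^sup>L P y"
  let ?b = "\<lambda>x. 1 + s * (y x - ?m) + 12 * s\<^sup>2 * exp \<bar>y x\<bar>"
  have le: "exp (s * (y x - ?m)) \<le> ?b x" for x
  proof -
    have "exp \<bar>y x - ?m\<bar> \<le> exp (1 + \<bar>y x\<bar>)" using I(3) by simp
    also have "\<dots> \<le> 3 * exp \<bar>y x\<bar>" using exp_le by (simp add: exp_add)
    finally have "4 * s\<^sup>2 * exp \<bar>y x - ?m\<bar> \<le> 4 * s\<^sup>2 * (3 * exp \<bar>y x\<bar>)" by (intro mult_left_mono) auto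
    then show ?thesis using exp_le_quadratic[OF s, of "y x - ?m"] by linarith
  qed
  have ib: "integrable P ?b" using I(1,2) by auto
  have "(\<integral>\<^sup>+ x. ennreal (exp (s * (y x - ?m))) \<partial>P) \<le> (\<integral>\<^sup>+ x. ennreal (?b x) \<partial>P)"
    using le by (intro nn_integral_mono ennreal_leI)
  also have "\<dots> = ennreal (integral\<^sup>L P ?b)"
    by (intro nn_integral_eq_integral[OF ib] AE_I2 order_trans[OF _ le]) simp
  also have "integral\<^sup>L P ?b = 1 + 12 * s\<^sup>2 * (\<integral>x. exp \<bar>y x\<bar> \<partial>P)"
    using I(1,2) by (simp add: prob_space)
  also have "\<dots> \<le> 1 + 12 * s\<^sup>2 * 2" using I(4) by (intro add_left_mono mult_left_mono) auto
  also have "\<dots> \<le> exp (24 * s\<^sup>2)" using exp_ge_add_one_self[of "24 * s\<^sup>2"] by simp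
  finally show ?thesis by (simp add: ennreal_leI)
qed

lemma power_le_fact_exp:
  fixes x :: real
  assumes "0 \<le> x" shows "x ^ p \<le> fact p * exp x"
proof -
  obtain t where t: "exp x = (\<Sum>m<Suc p. x ^ m / fact m) + exp t / fact (Suc p) * x ^ Suc p"
    using Maclaurin_exp_le[of x "Suc p"] by blast
  have "x ^ p / fact p \<le> (\<Sum>m<Suc p. x ^ m / fact m)"
    using assms by (intro member_le_sum[of p _ "\<lambda>m. x ^ m / fact m"]) auto
  also have "\<dots> \<le> exp x" unfolding t using assms by simp
  finally show ?thesis by (simp add: field_simps)
qed

lemma even_power_le_fact_exp:
  fixes x :: real
  shows "x ^ (2 * p) \<le> fact (2 * p) * (exp x + exp (- x))"
proof -
  have "x ^ (2 * p) = \<bar>x\<bar> ^ (2 * p)" by (simp add: power_mult)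
  also have "\<dots> \<le> fact (2 * p) * exp \<bar>x\<bar>" by (rule power_le_fact_exp) simp
  also have "\<dots> \<le> fact (2 * p) * (exp x + exp (- x))"
    by (intro mult_left_mono) (auto simp: abs_if)
  finally show ?thesis .
qed

text \<open>Moments from the moment generating function at the point \<open>s\<close> that balances
  \<open>s ^ (- 2 p)\<close> against \<open>exp (24 n s\<^sup>2)\<close>.\<close>

lemma exp_moment_iid_sum_power:
  assumes P: "prob_space P" and y[measurable]: "y \<in> borel_measurable P"
    and E: "(\<integral>\<^sup>+ x. ennreal (exp \<bar>y x\<bar>) \<partial>P) \<le> 2" and p: "1 \<le> p" "p \<le> n"
  shows "(\<integral>\<^sup>+ X. ennreal ((\<Sum>i=1..n. y (X i) - integral\<^sup>L P y) ^ (2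
      * p)) \<partial>Pi\<^sub>M {1..n} (\<lambda>_. P))
    \<le> ennreal (2 * fact (2 * p) * (72 * real n / real p) ^ p)"
proof -
  let ?z = "\<lambda>x. y x - integral\<^sup>L P y" and ?M = "Pi\<^sub>M {1..n} (\<lambda>_. P)"
  interpret product_sigma_finite "\<lambda>_::nat. P" by (intro product_sigma_finite_prob P)
  have mgf: "(\<integral>\<^sup>+ X. ennreal (exp (s * (\<Sum>i=1..n. ?z (X i)))) \<partial>?M)
      \<le> ennreal (exp (24 * s\<^sup>2 * real n))"
    if s: "\<bar>s\<bar> \<le> 1/2" for s
  proof -
    have "(\<integral>\<^sup>+ X. ennreal (exp (s * (\<Sum>i=1..n. ?z (X i)))) \<partial>?M)
        = (\<integral>\<^sup>+ X. (\<Prod>i=1..n. ennreal (exp (s * ?z (X i)))) \<partial>?M)"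
      by (simp add: prod_ennreal exp_sum[symmetric] sum_distrib_left)
    also have "\<dots> = (\<Prod>i=1..n. \<integral>\<^sup>+ x. ennreal (exp (s * ?z x)) \<partial>P)"
      by (rule product_nn_integral_prod) auto
    also have "\<dots> \<le> (\<Prod>i=1..n. ennreal (exp (24 * s\<^sup>2)))"
      by (intro prod_mono_ennreal exp_moment_centered_mgf[OF P y E s])
    also have "\<dots> = ennreal (exp (24 * s\<^sup>2 * real n))"
      by (simp add: ennreal_power exp_of_nat_mult[symmetric] mult.commute)
    finally show ?thesis .
  qed
  define s where "s = sqrt (real p / (24 * real n))"
  have n: "0 < n" using p by simp
  have s2: "s\<^sup>2 = real p / (24 * real n)" by (simp add: s_def)
  have s_pos: "0 < s" using p n by (simp add: s_def)
  have "s\<^sup>2 \<le> (1/2)\<^sup>2" unfolding s2 using p n by (simp add: field_simps power2_eq_square)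
  then have s_le: "s \<le> 1/2" using s_pos by (simp add: power2_le_iff_abs_le)
  have [measurable]: "(\<lambda>X. \<Sum>i=1..n. ?z (X i)) \<in> borel_measurable ?M" by measurable
  let ?S = "\<lambda>X. \<Sum>i=1..n. ?z (X i)"
  have "(\<integral>\<^sup>+ X. ennreal (?S X ^ (2 * p)) \<partial>?M)
     \<le> (\<integral>\<^sup>+ X. ennreal (fact (2 * p) / s ^ (2 * p)) * (ennreal (exp (s * ?S X))
         + ennreal (exp (- s * ?S X))) \<partial>?M)"
  proof (intro nn_integral_mono)
    fix X
    have "(s * ?S X) ^ (2 * p) \<le> fact (2 * p) * (exp (s * ?S X) + exp (- (s * ?S X)))"
      by (rule even_power_le_fact_exp)
    then have "?S X ^ (2 * p) \<le> fact (2 * p) / s ^ (2 * p) * (exp (s * ?S X) + exp (- s * ?S X))"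
      using s_pos by (simp add: power_mult_distrib field_simps)
    then show "ennreal (?S X ^ (2 * p)) \<le> ennreal (fact (2 * p) / s ^ (2 * p)) * (ennreal (exp (s * ?S X))
        + ennreal (exp (- s * ?S X)))"
      using s_pos by (simp add: ennreal_plus[symmetric] ennreal_mult[symmetric] ennreal_leI del: ennreal_plus)
  qed
  also have "\<dots> = ennreal (fact (2 * p) / s ^ (2 * p)) * ((\<integral>\<^sup>+ X. ennreal (exp (s * ?S X)) \<partial>?M)
      + (\<integral>\<^sup>+ X. ennreal (exp (- s * ?S X)) \<partial>?M))"
    by (subst nn_integral_cmult) (auto simp: nn_integral_add)
  also have "\<dots> \<le> ennreal (fact (2 * p) / s ^ (2 * p)) * (ennreal (exp (24 * s\<^sup>2 * real n))
      + ennreal (exp (24 * (- s)\<^sup>2 * real n)))"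
    using s_pos s_le by (intro mult_left_mono add_mono mgf) auto
  also have "24 * s\<^sup>2 * real n = real p" unfolding s2 using n by simp
  also have "24 * (- s)\<^sup>2 * real n = real p" using s2 n by simp
  also have "ennreal (fact (2 * p) / s ^ (2 * p)) * (ennreal (exp (real p)) + ennreal (exp (real p)))
     = ennreal (2 * fact (2 * p) * (exp 1 / s\<^sup>2) ^ p)"
    using s_pos by (simp add: ennreal_plus[symmetric] ennreal_mult[symmetric] power_mult power_divide exp_of_nat_mult[of _ 1,
        simplified] del: ennreal_plus)
  also have "\<dots> \<le> ennreal (2 * fact (2 * p) * (72 * real n / real p) ^ p)"
  proof (intro ennreal_leI mult_left_mono power_mono)
    show "exp 1 / s\<^sup>2 \<le> 72 * real n / real p"
      unfolding s2 using exp_le p n mult_right_mono[OF exp_le, of "24 * real n"] by (simp add: field_simps)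
  qed (use s_pos in auto)
  finally show ?thesis .
qed

text \<open>A product of two sub-Gaussian variables is sub-exponential, by the inequality of arithmetic and
  geometric means applied twice.\<close>

lemma exp_moment_mult:
  assumes f[measurable]: "f \<in> borel_measurable P" and g[measurable]: "g \<in> borel_measurable P"
    and s: "0 < s" and t: "0 < t"
    and Ef: "(\<integral>\<^sup>+ x. ennreal (exp ((f x)\<^sup>2 / s\<^sup>2)) \<partial>P)
        \<le> 2" and Eg: "(\<integral>\<^sup>+ x. ennreal (exp ((g x)\<^sup>2 / t\<^sup>2)) \<partial>P) \<le> 2"
  shows "(\<integral>\<^sup>+ x. ennreal (exp \<bar>f x * g x / (s * t)\<bar>) \<partial>P) \<le> 2"
proof -
  have le: "exp \<bar>f x * g x / (s * t)\<bar> \<le> 1/2 * exp ((f x)\<^sup>2 / s\<^sup>2) + 1/2 * exp ((g x)\<^sup>2 / t\<^sup>2)" for x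
  proof -
    let ?a = "\<bar>f x\<bar> / s" and ?b = "\<bar>g x\<bar> / t"
    have "\<bar>f x * g x / (s * t)\<bar> = ?a * ?b" using s t by (simp add: abs_mult)
    also have "\<dots> \<le> ?a\<^sup>2 / 2 + ?b\<^sup>2 / 2" using sum_squares_bound[of ?a ?b] by simp
    finally have "exp \<bar>f x * g x / (s * t)\<bar> \<le> exp (?a\<^sup>2 / 2) * exp (?b\<^sup>2 / 2)" by (simp add: exp_add[symmetric])
    also have "\<dots> \<le> (exp (?a\<^sup>2 / 2))\<^sup>2 / 2 + (exp (?b\<^sup>2 / 2))\<^sup>2 / 2"
      using sum_squares_bound[of "exp (?a\<^sup>2 / 2)" "exp (?b\<^sup>2 / 2)"] by simp
    finally show ?thesis by (simp add: exp_double[symmetric] power_divide)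
  qed
  define h :: real where "h = 1/2"
  have h: "0 \<le> h" by (simp add: h_def)
  have "(\<integral>\<^sup>+ x. ennreal (exp \<bar>f x * g x / (s * t)\<bar>) \<partial>P)
     \<le> (\<integral>\<^sup>+ x. ennreal h * ennreal (exp ((f x)\<^sup>2 / s\<^sup>2))
         + ennreal h * ennreal (exp ((g x)\<^sup>2 / t\<^sup>2)) \<partial>P)"
    using le[folded h_def] h by (intro nn_integral_mono) (simp add: ennreal_plus[symmetric] ennreal_mult[symmetric] ennreal_leI
        del: ennreal_plus)
  also have "\<dots> = ennreal h * (\<integral>\<^sup>+ x. ennreal (exp ((f x)\<^sup>2 / s\<^sup>2)) \<partial>P)
      + ennreal h * (\<integral>\<^sup>+ x. ennreal (exp ((g x)\<^sup>2 / t\<^sup>2)) \<partial>P)"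
    by (subst nn_integral_add) (auto simp: nn_integral_cmult)
  also have "\<dots> \<le> ennreal h * ennreal 2 + ennreal h * ennreal 2"
    using Ef Eg by (intro add_mono mult_left_mono) auto
  also have "\<dots> = ennreal (h * 2 + h * 2)"
    using h by (simp only: ennreal_mult[symmetric] ennreal_plus[symmetric] mult_nonneg_nonneg zero_le_numeral)
  finally show ?thesis by (simp add: h_def)
qed

text \<open>A chi-square moment whose order equals the number of degrees of freedom, bounded by an exponential
  moment.\<close>

lemma nn_integral_Gauss_norm_power:
  assumes I: "finite I" "card I = k" "1 \<le> k"
  shows "(\<integral>\<^sup>+ u. ennreal ((\<Sum>a\<in>I. (u a)\<^sup>2) ^ k) \<partial>Gauss I) \<le> ennreal ((6 * real k) ^ k)"
proof -
  have "(\<integral>\<^sup>+ u. ennreal ((\<Sum>a\<in>I. (u a)\<^sup>2) ^ k) \<partial>Gauss I)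
     \<le> (\<integral>\<^sup>+ u. ennreal (4 ^ k * fact k) * ennreal (exp (\<Sum>a\<in>I. 0 * u a
         + 1/4 * (u a)\<^sup>2)) \<partial>Gauss I)"
  proof (intro nn_integral_mono)
    fix u :: "'a \<Rightarrow> real"
    let ?s = "\<Sum>a\<in>I. (u a)\<^sup>2"
    have "(?s / 4) ^ k \<le> fact k * exp (?s / 4)" by (rule power_le_fact_exp) (simp add: sum_nonneg)
    then have b: "?s ^ k \<le> 4 ^ k * fact k * exp (?s / 4)" by (simp add: power_divide field_simps)
    have e: "(\<Sum>a\<in>I. 0 * u a + 1/4 * (u a)\<^sup>2) = ?s / 4" by (simp add: sum_divide_distrib)
    show "ennreal (?s ^ k) \<le> ennreal (4 ^ k * fact k) * ennreal (exp (\<Sum>a\<in>I. 0 * u a + 1/4 * (u a)\<^sup>2))"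
      unfolding e by (subst ennreal_mult[symmetric]) (use b in \<open>auto intro: ennreal_leI\<close>)
  qed
  also have "\<dots> = ennreal (4 ^ k * fact k) * ennreal (sqrt 2 ^ k)"
    using nn_integral_exp_Gauss[OF I(1), of "1/4" "\<lambda>_. 0"] I(2)
    by (subst nn_integral_cmult) (auto intro!: borel_measurable_sum Gauss_component simp: real_sqrt_divide power_divide)
  also have "\<dots> = ennreal (4 ^ k * fact k * sqrt 2 ^ k)" by (simp add: ennreal_mult)
  also have "\<dots> \<le> ennreal (4 ^ k * real k ^ k * (3/2) ^ k)"
  proof (intro ennreal_leI mult_mono power_mono)
    show "sqrt 2 \<le> 3/2" by (rule real_le_lsqrt) (auto simp: power2_eq_square)
    show "fact k \<le> real k ^ k" using fact_le_power[of k, where 'a=real] by simp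
  qed auto
  also have "4 ^ k * real k ^ k * (3/2) ^ k = (4 * real k * (3/2)) ^ k" by (simp only: power_mult_distrib)
  also have "4 * real k * (3/2) = 6 * real k" by simp
  finally show ?thesis .
qed

section \<open>Frobenius deviation of sample covariances\<close>

lemma sub_gaussian_measurable: "sub_gaussian P \<kappa> I X \<Longrightarrow> a \<in> I \<Longrightarrow> X a \<in> borel_measurable P"
  by (simp add: sub_gaussian_def)

lemma sub_gaussian_coord:
  assumes sg: "sub_gaussian P \<kappa> I X" and I: "finite I" and a: "a \<in> I"
  shows "(\<integral>\<^sup>+ x. ennreal (exp ((X a x)\<^sup>2 / \<kappa>\<^sup>2)) \<partial>P) \<le> 2"
proof -
  define u where "u b = (if b = a then 1 else 0 :: real)" for b
  have "(\<Sum>b\<in>I. (u b)\<^sup>2) = (\<Sum>b\<in>I. if b = a then 1 else 0)" by (intro sum.cong) (auto simp: u_def)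
  then have "(\<Sum>b\<in>I. (u b)\<^sup>2) = 1" using I a by simp
  moreover have "(\<Sum>b\<in>I. u b * X b x) = X a x" for x
  proof -
    have "(\<Sum>b\<in>I. u b * X b x) = (\<Sum>b\<in>I. if b = a then X a x else 0)" by (intro sum.cong) (auto simp: u_def)
    then show ?thesis using I a by simp
  qed
  ultimately show ?thesis using sg unfolding sub_gaussian_def by (auto dest!: spec[of _ u])
qed

text \<open>Clipping multiplies all coordinates by one factor in the unit interval, so linear forms shrink.\<close>

lemma sub_gaussian_clip:
  assumes sg: "sub_gaussian P \<kappa> I X" and R: "0 \<le> R"
  shows "sub_gaussian P \<kappa> I (\<lambda>a x. clip R I (\<lambda>a. X a x) a)"
  unfolding sub_gaussian_def
proof (intro conjI ballI allI impI)
  note [measurable] = sub_gaussian_measurable[OF sg]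
  fix a assume "a \<in> I"
  then show "(\<lambda>x. clip R I (\<lambda>a. X a x) a) \<in> borel_measurable P"
    unfolding clip_def L2_set_def by measurable
next
  fix u :: "nat \<Rightarrow> real" assume u: "(\<Sum>a\<in>I. (u a)\<^sup>2) \<le> 1"
  have "(\<Sum>a\<in>I. u a * clip R I (\<lambda>a. X a x) a)\<^sup>2 \<le> (\<Sum>a\<in>I. u a * X a x)\<^sup>2" for x
  proof -
    let ?m = "min 1 (R / L2_set (\<lambda>a. X a x) I)"
    have m: "0 \<le> ?m" "?m \<le> 1" using R L2_set_nonneg by auto
    have "(\<Sum>a\<in>I. u a * clip R I (\<lambda>a. X a x) a) = (\<Sum>a\<in>I. u a * X a x) * ?m"
      unfolding clip_def sum_distrib_right by (simp add: mult.assoc)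
    moreover have "?m\<^sup>2 \<le> 1" using m by (simp add: power_le_one)
    ultimately show ?thesis by (simp add: power_mult_distrib mult_left_le)
  qed
  then have "(\<integral>\<^sup>+ x. ennreal (exp ((\<Sum>a\<in>I. u a
      * clip R I (\<lambda>a. X a x) a)\<^sup>2 / \<kappa>\<^sup>2)) \<partial>P)
     \<le> (\<integral>\<^sup>+ x. ennreal (exp ((\<Sum>a\<in>I. u a * X a x)\<^sup>2 / \<kappa>\<^sup>2)) \<partial>P)"
    by (intro nn_integral_mono ennreal_leI) (simp add: divide_right_mono)
  also have "\<dots> \<le> 2" using sg u unfolding sub_gaussian_def by blast
  finally show "(\<integral>\<^sup>+ x. ennreal (exp ((\<Sum>a\<in>I. u a
      * clip R I (\<lambda>a. X a x) a)\<^sup>2 / \<kappa>\<^sup>2)) \<partial>P) \<le> 2" .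
qed

lemma sub_gaussian_product_integrable:
  assumes P: "prob_space P" and \<kappa>: "0 < \<kappa>" and sg: "sub_gaussian P \<kappa> I X" "sub_gaussian P \<kappa> J Y"
    and I: "finite I" "a \<in> I" and J: "finite J" "b \<in> J"
  shows "integrable P (\<lambda>x. X a x * Y b x)"
proof -
  have m: "X a \<in> borel_measurable P" "Y b \<in> borel_measurable P"
    by (rule sub_gaussian_measurable[OF sg(1) I(2)], rule sub_gaussian_measurable[OF sg(2) J(2)])
  then have m': "(\<lambda>x. X a x * Y b x / (\<kappa> * \<kappa>)) \<in> borel_measurable P" by simp
  have "integrable P (\<lambda>x. X a x * Y b x / (\<kappa> * \<kappa>))"
    by (rule exp_moment_integrable(2)[OF P m' exp_moment_mult[OF m \<kappa> \<kappa>]])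
       (use sub_gaussian_coord[OF sg(1) I] sub_gaussian_coord[OF sg(2) J] in auto)
  then have "integrable P (\<lambda>x. (\<kappa> * \<kappa>) * (X a x * Y b x / (\<kappa> * \<kappa>)))" by (rule integrable_mult_right)
  then show ?thesis using \<kappa> by simp
qed

text \<open>For fixed \<open>u\<close> and \<open>v\<close> the bilinear form of the centred sample covariance is a multiple of a sum of
  independent centred copies of \<open>y\<close>, the product of two linear forms normalised by their
  sub-Gaussian scales.\<close>

lemma sub_gaussian_bilinear_moment:
  assumes P: "prob_space P" and \<kappa>: "0 < \<kappa>" and sg: "sub_gaussian P \<kappa> I X" "sub_gaussian P \<kappa> J Y"
    and I: "finite I" and J: "finite J" and p: "1 \<le> p" "p \<le> n"
  shows "(\<integral>\<^sup>+ Z. ennreal ((\<Sum>a\<in>I. (\<Sum>b\<in>J. ((1 / real n) * (\<Sum>i=1..n. X a (Z i)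
      * Y b (Z i)) - (\<integral>x. X a x * Y b x \<partial>P)) * v b) * u a) ^ (2 * p))
           \<partial>Pi\<^sub>M {1..n} (\<lambda>_. P))
    \<le> ennreal (2 * fact (2 * p) * (72 * \<kappa> ^ 4 / (real n * real p)) ^ p * ((\<Sum>a\<in>I. (u a)\<^sup>2) ^ p
        * (\<Sum>b\<in>J. (v b)\<^sup>2) ^ p))"
    (is "?L \<le> ennreal (?K * (?s ^ p * ?t ^ p))")
proof (cases "?s = 0 \<or> ?t = 0")
  case True
  then have "(\<Sum>a\<in>I. (\<Sum>b\<in>J. W a b * v b) * u a) = 0" for W
    using I J by (auto simp: sum_nonneg_eq_0_iff)
  then have "?L = 0" using p by (simp add: power_0_left)
  then show ?thesis by simp
next
  case False
  then have st: "0 < ?s" "0 < ?t" by (auto simp: less_le sum_nonneg)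
  define f g where "f x = (\<Sum>a\<in>I. u a * X a x)" and "g x = (\<Sum>b\<in>J. v b * Y b x)" for x
  define \<sigma> \<tau> where "\<sigma> = \<kappa> * sqrt ?s" and "\<tau> = \<kappa> * sqrt ?t"
  have pos: "0 < \<sigma>" "0 < \<tau>" using \<kappa> st by (auto simp: \<sigma>_def \<tau>_def)
  have sq: "\<sigma>\<^sup>2 = \<kappa>\<^sup>2 * ?s" "\<tau>\<^sup>2 = \<kappa>\<^sup>2 * ?t"
      using st by (auto simp: \<sigma>_def \<tau>_def power_mult_distrib)
  note [measurable] = sub_gaussian_measurable[OF sg(1)] sub_gaussian_measurable[OF sg(2)]
  have fm[measurable]: "f \<in> borel_measurable P" and gm[measurable]: "g \<in> borel_measurable P"
    unfolding f_def g_def by measurable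
  define y where "y x = f x * g x / (\<sigma> * \<tau>)" for x
  have ym[measurable]: "y \<in> borel_measurable P" unfolding y_def by measurable
  have E: "(\<integral>\<^sup>+ x. ennreal (exp \<bar>y x\<bar>) \<partial>P) \<le> 2"
    unfolding y_def using sub_gaussian_linear[OF sg(1) st(1)] sub_gaussian_linear[OF sg(2) st(2)]
    by (intro exp_moment_mult fm gm pos) (auto simp: f_def g_def sq)
  have fg: "f x * g x = (\<Sum>a\<in>I. \<Sum>b\<in>J. (u a * v b) * (X a x * Y b x))" for x
    by (simp add: f_def g_def sum_product mult_ac)
  have "integral\<^sup>L P y = (\<integral>x. (\<Sum>a\<in>I. \<Sum>b\<in>J. (u a * v b) * (X a x
      * Y b x)) \<partial>P) / (\<sigma> * \<tau>)"
    unfolding y_def fg by simp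
  also have "(\<integral>x. (\<Sum>a\<in>I. \<Sum>b\<in>J. (u a * v b) * (X a x * Y b x)) \<partial>P)
      = (\<Sum>a\<in>I. \<Sum>b\<in>J. (u a * v b) * (\<integral>x. X a x * Y b x \<partial>P))"
  proof -
    note i = sub_gaussian_product_integrable[OF P \<kappa> sg I _ J]
    have "(\<integral>x. (\<Sum>a\<in>I. \<Sum>b\<in>J. (u a * v b) * (X a x * Y b x)) \<partial>P)
        = (\<Sum>a\<in>I. (\<integral>x. (\<Sum>b\<in>J. (u a * v b) * (X a x * Y b x)) \<partial>P))"
      by (intro Bochner_Integration.integral_sum Bochner_Integration.integrable_sum integrable_mult_right i)
    also have "\<dots> = (\<Sum>a\<in>I. \<Sum>b\<in>J. (\<integral>x. (u a * v b) * (X a x * Y b x) \<partial>P))"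
      by (intro sum.cong refl Bochner_Integration.integral_sum integrable_mult_right i)
    finally show ?thesis by simp
  qed
  finally have mean: "(\<sigma> * \<tau>) * integral\<^sup>L P y
      = (\<Sum>a\<in>I. \<Sum>b\<in>J. (u a * v b) * (\<integral>x. X a x * Y b x \<partial>P))"
    using pos by simp
  let ?c = "\<sigma> * \<tau> / real n"
  have n: "0 < n" using p by simp
  have form: "(\<Sum>a\<in>I. (\<Sum>b\<in>J. ((1 / real n) * (\<Sum>i=1..n. X a (Z i) * Y b (Z i)) - (\<integral>x. X a x
      * Y b x \<partial>P)) * v b) * u a)
     = ?c * (\<Sum>i=1..n. y (Z i) - integral\<^sup>L P y)" for Z
  proof -
    have "(\<Sum>a\<in>I. (\<Sum>b\<in>J. ((1 / real n) * (\<Sum>i=1..n. X a (Z i) * Y b (Z i)) - (\<integral>x. X a x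
        * Y b x \<partial>P)) * v b) * u a)
       = (1 / real n) * (\<Sum>a\<in>I. \<Sum>b\<in>J. \<Sum>i=1..n. (u a * v b) * (X a (Z i)
           * Y b (Z i))) - (\<Sum>a\<in>I. \<Sum>b\<in>J. (u a * v b) * (\<integral>x. X a x * Y b x \<partial>P))"
      by (simp add: sum_distrib_left sum_distrib_right sum_subtractf left_diff_distrib right_diff_distrib mult_ac)
    also have "(\<Sum>a\<in>I. \<Sum>b\<in>J. \<Sum>i=1..n. (u a * v b) * (X a (Z i) * Y b (Z i))) = (\<Sum>i=1..n. f (Z i) * g (Z i))"
      unfolding fg by (subst sum.swap, subst (2) sum.swap) (simp add: sum.swap[of _ J])
    also have "\<dots> = (\<sigma> * \<tau>) * (\<Sum>i=1..n. y (Z i))" using pos by (simp add: y_def sum_divide_distrib[symmetric])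
    also have "(1 / real n) * \<dots> - (\<Sum>a\<in>I. \<Sum>b\<in>J. (u a * v b) * (\<integral>x. X a x * Y b x \<partial>P))
        = ?c * (\<Sum>i=1..n. y (Z i) - integral\<^sup>L P y)"
      unfolding mean[symmetric] using n by (simp add: sum_subtractf field_simps)
    finally show ?thesis .
  qed
  have "?L = (\<integral>\<^sup>+ Z. ennreal (?c ^ (2 * p)) * ennreal ((\<Sum>i=1..n. y (Z i) - integral\<^sup>L P y) ^ (2
      * p)) \<partial>Pi\<^sub>M {1..n} (\<lambda>_. P))"
    unfolding form using pos by (intro nn_integral_cong) (simp only: power_mult_distrib, intro ennreal_mult, auto)
  also have "\<dots> = ennreal (?c ^ (2 * p)) * (\<integral>\<^sup>+ Z. ennreal ((\<Sum>i=1..n. y (Z i) - integral\<^sup>L P y) ^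
      (2 * p)) \<partial>Pi\<^sub>M {1..n} (\<lambda>_. P))"
    by (intro nn_integral_cmult) measurable
  also have "\<dots> \<le> ennreal (?c ^ (2 * p)) * ennreal (2 * fact (2 * p) * (72 * real n / real p) ^ p)"
    by (intro mult_left_mono exp_moment_iid_sum_power[OF P ym E p]) auto
  also have "\<dots> = ennreal (?c ^ (2 * p) * (2 * fact (2 * p) * (72 * real n / real p) ^ p))"
    using pos by (intro ennreal_mult[symmetric]) auto
  also have "?c ^ (2 * p) * (2 * fact (2 * p) * (72 * real n / real p) ^ p) = ?K * (?s ^ p * ?t ^ p)"
  proof -
    have "?c ^ (2 * p) = (\<kappa> ^ 4 * ?s * ?t / (real n)\<^sup>2) ^ p"
    proof -
      have "?c\<^sup>2 = \<kappa> ^ 4 * ?s * ?t / (real n)\<^sup>2"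
        by (simp add: power_divide power_mult_distrib sq)
      then show ?thesis by (simp add: power_mult)
    qed
    then have e: "?c ^ (2 * p) * (72 * real n / real p) ^ p = ((72 * \<kappa> ^ 4 / (real n * real p)) * (?s * ?t)) ^ p"
    proof -
      have "(\<kappa> ^ 4 * ?s * ?t / (real n)\<^sup>2) ^ p * (72 * real n / real p) ^ p
          = ((\<kappa> ^ 4 * ?s * ?t / (real n)\<^sup>2) * (72 * real n / real p)) ^ p"
        by (rule power_mult_distrib[symmetric])
      also have "(\<kappa> ^ 4 * ?s * ?t / (real n)\<^sup>2) * (72 * real n / real p) = (72 * \<kappa> ^ 4 / (real n * real p)) * (?s * ?t)"
        using n by (simp add: power2_eq_square)
      finally show ?thesis using \<open>?c ^ (2 * p) = (\<kappa> ^ 4 * ?s * ?t / (real n)\<^sup>2) ^ p\<close> by simp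
    qed
    have "?c ^ (2 * p) * (2 * fact (2 * p) * (72 * real n / real p) ^ p) = 2 * fact (2 * p) * (?c ^ (2 * p) * (72 * real n / real p) ^ p)"
      by (simp only: mult_ac)
    also have "\<dots> = ?K * (?s ^ p * ?t ^ p)" unfolding e by (simp only: power_mult_distrib mult.assoc)
    finally show ?thesis .
  qed
  finally show ?thesis .
qed

text \<open>Decoupling, an exchange of integrals and the previous lemma. The constant is \<open>10368 = 2 * 144 * 36\<close>:
  a power of \<open>144\<close> comes from the moment of the sum divided by the Gaussian moment, \<open>36\<close> from the
  chi-square moments of \<open>u\<close> and \<open>v\<close>, and the leading factor two is absorbed into the power.\<close>

lemma sample_cov_frob_moment:
  assumes P: "prob_space P" and \<kappa>: "0 < \<kappa>" and sg: "sub_gaussian P \<kappa> I X" "sub_gaussian P \<kappa> J Y"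
    and I: "finite I" "card I = k" and J: "finite J" "card J = k" and k: "1 \<le> k" "k \<le> n"
  shows "(\<integral>\<^sup>+ Z. ennreal ((\<Sum>a\<in>I. \<Sum>b\<in>J. ((1 / real n) * (\<Sum>i=1..n. X a (Z i)
      * Y b (Z i)) - (\<integral>x. X a x * Y b x \<partial>P))\<^sup>2) ^ k)
           \<partial>Pi\<^sub>M {1..n} (\<lambda>_. P))
    \<le> ennreal ((10368 * \<kappa> ^ 4 * (real k)\<^sup>2 / real n) ^ k)"
proof -
  let ?M = "Pi\<^sub>M {1..n} (\<lambda>_. P)"
  define W where "W Z a b = (1 / real n) * (\<Sum>i=1..n. X a (Z i) * Y b (Z i)) - (\<integral>x. X a x * Y b x \<partial>P)" for Z a b
  define c where "c = (fact (2 * k) / (2 ^ k * fact k) :: real)"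
  have c: "0 < c" by (simp add: c_def)
  define K where "K = 2 * fact (2 * k) * (72 * \<kappa> ^ 4 / (real n * real k)) ^ k"
  have K: "0 \<le> K" by (simp add: K_def)
  interpret M: prob_space ?M using P by (intro prob_space_PiM)
  interpret GI: prob_space "Gauss I" by (rule prob_space_Gauss)
  interpret GJ: prob_space "Gauss J" by (rule prob_space_Gauss)
  interpret MJ: pair_sigma_finite ?M "Gauss J" ..
  interpret MI: pair_sigma_finite ?M "Gauss I" ..
  note [measurable] = sub_gaussian_measurable[OF sg(1)] sub_gaussian_measurable[OF sg(2)]
  have W[measurable]: "(\<lambda>Z. W Z a b) \<in> borel_measurable ?M" if "a \<in> I" "b \<in> J" for a b
    unfolding W_def using that by measurable
  let ?F = "\<lambda>Z v u. (\<Sum>a\<in>I. (\<Sum>b\<in>J. W Z a b * v b) * u a) ^ (2 * k)"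
  have m3: "(\<lambda>q. ennreal (?F (fst (fst q)) (snd (fst q)) (snd q))) \<in> borel_measurable ((?M \<Otimes>\<^sub>M Gauss J)
      \<Otimes>\<^sub>M Gauss I)"
    by (intro measurable_compose[OF _ measurable_ennreal] borel_measurable_power borel_measurable_sum borel_measurable_times
       measurable_compose[OF measurable_snd Gauss_component]
       measurable_compose[OF measurable_compose[OF measurable_fst measurable_snd] Gauss_component]
       measurable_compose[OF measurable_compose[OF measurable_fst measurable_fst] W])
  have mH: "(\<lambda>(Z, v). \<integral>\<^sup>+ u. ennreal (?F Z v u) \<partial>Gauss I) \<in> borel_measurable (?M
      \<Otimes>\<^sub>M Gauss J)"
    using GI.borel_measurable_nn_integral[of "\<lambda>p u. ennreal (?F (fst p) (snd p) u)" "?M \<Otimes>\<^sub>M Gauss J"] m3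
    by (simp add: split_def)
  have m2: "(\<lambda>(Z, u). ennreal (?F Z v u)) \<in> borel_measurable (?M \<Otimes>\<^sub>M Gauss I)" for v
    unfolding split_def
    by (intro measurable_compose[OF _ measurable_ennreal] borel_measurable_power borel_measurable_sum borel_measurable_times
        borel_measurable_const
       measurable_compose[OF measurable_snd Gauss_component] measurable_compose[OF measurable_fst W])
  have mW: "(\<lambda>Z. ennreal ((\<Sum>a\<in>I. \<Sum>b\<in>J. (W Z a b)\<^sup>2) ^ k)) \<in> borel_measurable ?M"
    by measurable
  have gmI: "(\<lambda>u. ennreal ((\<Sum>a\<in>I. (u a)\<^sup>2) ^ k)) \<in> borel_measurable (Gauss I)"
    by (intro measurable_compose[OF _ measurable_ennreal] borel_measurable_power borel_measurable_sum Gauss_component)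
  have gmJ: "(\<lambda>u. ennreal ((\<Sum>a\<in>J. (u a)\<^sup>2) ^ k)) \<in> borel_measurable (Gauss J)"
    by (intro measurable_compose[OF _ measurable_ennreal] borel_measurable_power borel_measurable_sum Gauss_component)
  have "ennreal c * (\<integral>\<^sup>+ Z. ennreal ((\<Sum>a\<in>I. \<Sum>b\<in>J. (W Z a b)\<^sup>2) ^ k) \<partial>?M)
      = (\<integral>\<^sup>+ Z. ennreal c * ennreal ((\<Sum>a\<in>I. \<Sum>b\<in>J. (W Z a b)\<^sup>2) ^ k) \<partial>?M)"
    using mW by (rule nn_integral_cmult[symmetric])
  also have "\<dots> \<le> (\<integral>\<^sup>+ Z. (\<integral>\<^sup>+ v. (\<integral>\<^sup>+ u. ennreal (?F Z v u)
      \<partial>Gauss I) \<partial>Gauss J) \<partial>?M)"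
  proof (intro nn_integral_mono)
    fix Z
    have "0 \<le> (\<Sum>a\<in>I. \<Sum>b\<in>J. (W Z a b)\<^sup>2)" by (intro sum_nonneg) simp
    then show "ennreal c * ennreal ((\<Sum>a\<in>I. \<Sum>b\<in>J. (W Z a b)\<^sup>2) ^ k)
        \<le> (\<integral>\<^sup>+ v. (\<integral>\<^sup>+ u. ennreal (?F Z v u) \<partial>Gauss I) \<partial>Gauss J)"
      using frob_power_le_Gauss_bilinear[OF I(1) J(1) k(1), of "W Z"] c unfolding c_def[symmetric] by (simp add: ennreal_mult)
  qed
  also have "\<dots> = (\<integral>\<^sup>+ v. (\<integral>\<^sup>+ Z. (\<integral>\<^sup>+ u. ennreal (?F Z v u) \<partial>Gauss
      I) \<partial>?M) \<partial>Gauss J)"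
    by (rule MJ.Fubini'[OF mH, symmetric])
  also have "\<dots> = (\<integral>\<^sup>+ v. (\<integral>\<^sup>+ u. (\<integral>\<^sup>+ Z. ennreal (?F Z v u) \<partial>?M)
      \<partial>Gauss I) \<partial>Gauss J)"
    by (intro nn_integral_cong MI.Fubini'[OF m2, symmetric])
  also have "\<dots> \<le> (\<integral>\<^sup>+ v. (\<integral>\<^sup>+ u. ennreal (K * (\<Sum>b\<in>J. (v b)\<^sup>2) ^ k)
      * ennreal ((\<Sum>a\<in>I. (u a)\<^sup>2) ^ k) \<partial>Gauss I) \<partial>Gauss J)"
  proof (intro nn_integral_mono)
    fix v u
    have "ennreal (K * (\<Sum>b\<in>J. (v b)\<^sup>2) ^ k) * ennreal ((\<Sum>a\<in>I. (u a)\<^sup>2) ^ k)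
        = ennreal (K * ((\<Sum>a\<in>I. (u a)\<^sup>2) ^ k * (\<Sum>b\<in>J. (v b)\<^sup>2) ^ k))"
      using K by (simp add: ennreal_mult[symmetric] sum_nonneg mult_ac)
    then show "(\<integral>\<^sup>+ Z. ennreal (?F Z v u) \<partial>?M)
        \<le> ennreal (K * (\<Sum>b\<in>J. (v b)\<^sup>2) ^ k) * ennreal ((\<Sum>a\<in>I. (u a)\<^sup>2) ^ k)"
      using sub_gaussian_bilinear_moment[OF P \<kappa> sg I(1) J(1) k, of v u] unfolding W_def K_def by simp
  qed
  also have "\<dots> \<le> (\<integral>\<^sup>+ v. ennreal (K * (\<Sum>b\<in>J. (v b)\<^sup>2) ^ k) * ennreal ((6
      * real k) ^ k) \<partial>Gauss J)"
    using nn_integral_Gauss_norm_power[OF I k(1)] gmI by (intro nn_integral_mono) (auto simp: nn_integral_cmult intro!: mult_left_mono)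
  also have "\<dots> = (\<integral>\<^sup>+ v. ennreal (K * (6 * real k) ^ k)
      * ennreal ((\<Sum>b\<in>J. (v b)\<^sup>2) ^ k) \<partial>Gauss J)"
    using K by (intro nn_integral_cong) (simp add: ennreal_mult[symmetric] sum_nonneg mult_ac)
  also have "\<dots> \<le> ennreal (K * (6 * real k) ^ k) * ennreal ((6 * real k) ^ k)"
    using nn_integral_Gauss_norm_power[OF J k(1)] gmJ by (auto simp: nn_integral_cmult intro!: mult_left_mono)
  also have "\<dots> = ennreal (K * (36 * (real k)\<^sup>2) ^ k)"
  proof -
    have "(6 * real k) ^ k * (6 * real k) ^ k = ((6 * real k) * (6 * real k)) ^ k" by (rule power_mult_distrib[symmetric])
    also have "(6 * real k) * (6 * real k) = 36 * (real k)\<^sup>2" by (simp add: power2_eq_square)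
    finally have e1: "K * (6 * real k) ^ k * (6 * real k) ^ k = K * (36 * (real k)\<^sup>2) ^ k" by (simp add: mult.assoc)
    have e2: "ennreal (K * (6 * real k) ^ k) * ennreal ((6 * real k) ^ k) = ennreal (K * (6 * real k) ^ k * (6 * real k) ^ k)"
      using K by (intro ennreal_mult[symmetric]) auto
    from e2[unfolded e1] show ?thesis .
  qed
  also have "\<dots> \<le> ennreal (c * (10368 * \<kappa> ^ 4 * (real k)\<^sup>2 / real n) ^ k)"
  proof (rule ennreal_leI)
    have n: "0 < n" using k by simp
    have f: "fact k \<le> real k ^ k" using fact_le_power[of k, where 'a=real] by simp
    have two: "(2::real) \<le> 2 ^ k" using power_increasing[of 1 k "2::real"] k by simp
    have Kc: "K = c * (2 * (fact k * 2 ^ k) * (72 * \<kappa> ^ 4 / (real n * real k)) ^ k)" by (simp add: K_def c_def)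
    have "2 * (fact k * 2 ^ k) * (72 * \<kappa> ^ 4 / (real n * real k)) ^ k * (36 * (real k)\<^sup>2) ^ k
       \<le> 2 ^ k * (real k ^ k * 2 ^ k) * (72 * \<kappa> ^ 4 / (real n * real k)) ^ k * (36 * (real k)\<^sup>2) ^ k"
      using f two by (intro mult_right_mono mult_mono) auto
    also have "\<dots> = (2 * (real k * 2) * (72 * \<kappa> ^ 4 / (real n * real k)) * (36 * (real k)\<^sup>2)) ^ k"
      by (simp only: power_mult_distrib)
    also have "2 * (real k * 2) * (72 * \<kappa> ^ 4 / (real n * real k)) * (36 * (real k)\<^sup>2)
        = 10368 * \<kappa> ^ 4 * (real k)\<^sup>2 / real n"
      using k n by (simp add: field_simps)
    finally show "K * (36 * (real k)\<^sup>2) ^ k \<le> c * (10368 * \<kappa> ^ 4 * (real k)\<^sup>2 / real n) ^ k"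
      unfolding Kc using c by (simp add: mult.assoc)
  qed
  also have "\<dots> = ennreal c * ennreal ((10368 * \<kappa> ^ 4 * (real k)\<^sup>2 / real n) ^ k)" using c by (simp add: ennreal_mult)
  finally show ?thesis unfolding W_def using c by (subst (asm) ennreal_mult_le_mult_iff) auto
qed

section \<open>Clipping bias, Gaussian noise and thresholding\<close>

lemma clip_id:
  assumes "a \<in> I" "finite I" "L2_set z I \<le> R"
  shows "clip R I z a = z a"
proof (cases "L2_set z I = 0")
  case True
  then have "z a = 0" using assms by (simp add: L2_set_eq_0_iff)
  then show ?thesis by (simp add: clip_def)
next
  case False
  then have "0 < L2_set z I" using L2_set_nonneg[of z I] by (simp add: less_le)
  then have "1 \<le> R / L2_set z I" using assms(3) by (simp add: le_divide_eq)
  then show ?thesis by (simp add: clip_def)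
qed

text \<open>Clipping changes a product only if one of the two subvectors is longer than \<open>R\<close>. Each indicator is
  replaced by \<open>exp ((N - R\<^sup>2) / (4 \<kappa>\<^sup>2))\<close> with \<open>N\<close> the squared length, which leaves exponential moments
  of the coordinates and of \<open>N\<close> only.\<close>

lemma clip_product_bias:
  assumes P: "prob_space P" and \<kappa>: "0 < \<kappa>" and R: "0 \<le> R"
    and sg: "sub_gaussian P \<kappa> I X" "sub_gaussian P \<kappa> J X"
    and I: "finite I" "card I = k" "a \<in> I" and J: "finite J" "card J = k" "b \<in> J"
  shows "\<bar>(\<integral>x. clip R I (\<lambda>a. X a x) a
      * clip R J (\<lambda>a. X a x) b \<partial>P) - (\<integral>x. X a x * X b x \<partial>P)\<bar>
    \<le> 8 * \<kappa>\<^sup>2 * sqrt 2 ^ k * exp (- R\<^sup>2 / (4 * \<kappa>\<^sup>2))"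
proof -
  note [measurable] = sub_gaussian_measurable[OF sg(1)] sub_gaussian_measurable[OF sg(2)]
  note Xa[measurable] = sub_gaussian_measurable[OF sg(1) I(3)] and Xb[measurable] = sub_gaussian_measurable[OF sg(2) J(3)]
  let ?xa = "\<lambda>x. clip R I (\<lambda>a. X a x) a" and ?xb = "\<lambda>x. clip R J (\<lambda>a. X a x) b"
  let ?NI = "\<lambda>x. \<Sum>a\<in>I. (X a x)\<^sup>2" and ?NJ = "\<lambda>x. \<Sum>a\<in>J. (X a x)\<^sup>2"
  define E where "E = exp (- R\<^sup>2 / (4 * \<kappa>\<^sup>2))"
  have E: "0 < E" by (simp add: E_def)
  have i1: "integrable P (\<lambda>x. ?xa x * ?xb x)"
    using sub_gaussian_product_integrable[OF P \<kappa> sub_gaussian_clip[OF sg(1) R] sub_gaussian_clip[OF sg(2) R] I(1,3) J(1,3)] .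
  have i2: "integrable P (\<lambda>x. X a x * X b x)"
    using sub_gaussian_product_integrable[OF P \<kappa> sg I(1,3) J(1,3)] .
  let ?G = "\<lambda>x. \<kappa>\<^sup>2 * E * (exp ((X a x)\<^sup>2 / \<kappa>\<^sup>2)
      + exp ((X b x)\<^sup>2 / \<kappa>\<^sup>2) + exp (?NI x / (2 * \<kappa>\<^sup>2)) + exp (?NJ x / (2 * \<kappa>\<^sup>2)))"
  have coord: "y\<^sup>2 * i \<le> \<kappa>\<^sup>2 * E * (exp (y\<^sup>2 / \<kappa>\<^sup>2) + exp (N / (2 * \<kappa>\<^sup>2)))"
    if i: "i = (if R < sqrt N then 1 else 0)" and N: "0 \<le> N" for y N i :: real
  proof (cases "R < sqrt N")
    case False
    then show ?thesis using E \<kappa> i by (simp add: add_nonneg_nonneg)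
  next
    case True
    then have "R\<^sup>2 \<le> N" using R real_sqrt_pow2[OF N] power_mono[of R "sqrt N" 2] by simp
    then have "0 \<le> - R\<^sup>2 / (4 * \<kappa>\<^sup>2) + N / (4 * \<kappa>\<^sup>2)" using \<kappa> by (simp add: field_simps)
    then have "1 \<le> exp (- R\<^sup>2 / (4 * \<kappa>\<^sup>2) + N / (4 * \<kappa>\<^sup>2))" by (simp only: one_le_exp_iff)
    then have 1: "1 \<le> E * exp (N / (4 * \<kappa>\<^sup>2))" unfolding E_def exp_add by simp
    have "y\<^sup>2 / (2 * \<kappa>\<^sup>2) \<le> exp (y\<^sup>2 / (2 * \<kappa>\<^sup>2))"
      using exp_ge_add_one_self[of "y\<^sup>2 / (2 * \<kappa>\<^sup>2)"] by linarith
    then have 2: "y\<^sup>2 \<le> 2 * \<kappa>\<^sup>2 * exp (y\<^sup>2 / (2 * \<kappa>\<^sup>2))" using \<kappa> by (simp add: field_simps)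
    have "y\<^sup>2 * 1 \<le> (2 * \<kappa>\<^sup>2 * exp (y\<^sup>2 / (2 * \<kappa>\<^sup>2))) * (E * exp (N / (4 * \<kappa>\<^sup>2)))"
      using 1 2 by (intro mult_mono) auto
    also have "\<dots> = \<kappa>\<^sup>2 * E * (2 * exp (y\<^sup>2 / (2 * \<kappa>\<^sup>2)) * exp (N / (4 * \<kappa>\<^sup>2)))" by simp
    also have "\<dots> \<le> \<kappa>\<^sup>2 * E * ((exp (y\<^sup>2 / (2 * \<kappa>\<^sup>2)))\<^sup>2
        + (exp (N / (4 * \<kappa>\<^sup>2)))\<^sup>2)"
      using E by (intro mult_left_mono sum_squares_bound) auto
    finally show ?thesis using i True by (simp add: exp_double[symmetric])
  qed
  have G: "norm (?xa x * ?xb x - X a x * X b x) \<le> ?G x" for x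
  proof -
    define i where "i = (if R < sqrt (?NI x) then 1 else 0 :: real)"
    define j where "j = (if R < sqrt (?NJ x) then 1 else 0 :: real)"
    have c: "\<kappa>\<^sup>2 * E * (exp (y\<^sup>2 / \<kappa>\<^sup>2) + exp (?NI x / (2 * \<kappa>\<^sup>2))) \<ge> y\<^sup>2 * i"
       "\<kappa>\<^sup>2 * E * (exp (y\<^sup>2 / \<kappa>\<^sup>2) + exp (?NJ x / (2 * \<kappa>\<^sup>2))) \<ge> y\<^sup>2 * j" for y
      using coord[OF i_def, of y] coord[OF j_def, of y] by (auto simp: sum_nonneg)
    have "norm (?xa x * ?xb x - X a x * X b x) \<le> \<bar>X a x * X b x\<bar> * (i + j)"
    proof (cases "R < sqrt (?NI x) \<or> R < sqrt (?NJ x)")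
      case False
      then have "?xa x = X a x" "?xb x = X b x"
        using I J by (auto intro!: clip_id simp: L2_set_def)
      then show ?thesis by (simp add: i_def j_def)
    next
      case True
      then have ij: "1 \<le> i + j" by (auto simp: i_def j_def)
      define r where "r = min 1 (R / L2_set (\<lambda>a. X a x) I) * min 1 (R / L2_set (\<lambda>a. X a x) J)"
      have r: "0 \<le> r" "r \<le> 1" using R unfolding r_def by (auto intro!: mult_le_one)
      have "?xa x * ?xb x - X a x * X b x = (X a x * X b x) * (r - 1)"
        by (simp add: clip_def r_def algebra_simps)
      then have "norm (?xa x * ?xb x - X a x * X b x) = \<bar>X a x * X b x\<bar> * (1 - r)" using r by (simp add: abs_mult)
      also have "\<dots> \<le> \<bar>X a x * X b x\<bar> * (i + j)" using r ij by (intro mult_left_mono) auto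
      finally show ?thesis .
    qed
    also have "\<dots> \<le> ((X a x)\<^sup>2 / 2 + (X b x)\<^sup>2 / 2) * (i + j)"
      using sum_squares_bound[of "\<bar>X a x\<bar>" "\<bar>X b x\<bar>"] by (intro mult_right_mono) (auto simp: abs_mult i_def j_def)
    also have "\<dots> = ((X a x)\<^sup>2 * i + (X a x)\<^sup>2 * j + (X b x)\<^sup>2 * i + (X b x)\<^sup>2 * j) / 2"
        by (simp add: field_simps)
    also have "\<dots> \<le> ?G x" using c[of "X a x"] c[of "X b x"] by (simp add: algebra_simps)
    finally show ?thesis .
  qed
  define s2 where "s2 = 2 * sqrt 2 ^ k"
  have s2: "2 \<le> s2" by (simp add: s2_def)
  have \<kappa>E: "0 \<le> \<kappa>\<^sup>2 * E" using E by simp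
  have "ennreal (norm (integral\<^sup>L P (\<lambda>x. ?xa x * ?xb x - X a x * X b x)))
      \<le> (\<integral>\<^sup>+ x. ennreal (norm (?xa x * ?xb x - X a x * X b x)) \<partial>P)"
    using i1 i2 by (intro integral_norm_bound_ennreal) auto
  also have "\<dots> \<le> (\<integral>\<^sup>+ x. ennreal (\<kappa>\<^sup>2 * E)
      * (ennreal (exp ((X a x)\<^sup>2 / \<kappa>\<^sup>2)) + ennreal (exp ((X b x)\<^sup>2 / \<kappa>\<^sup>2))
      + ennreal (exp (?NI x / (2 * \<kappa>\<^sup>2))) + ennreal (exp (?NJ x / (2 * \<kappa>\<^sup>2)))) \<partial>P)"
  proof (intro nn_integral_mono)
    fix x
    have "ennreal (norm (?xa x * ?xb x - X a x * X b x)) \<le> ennreal (?G x)" by (intro ennreal_leI G)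
    also have "\<dots> = ennreal (\<kappa>\<^sup>2 * E) * (ennreal (exp ((X a x)\<^sup>2 / \<kappa>\<^sup>2))
        + ennreal (exp ((X b x)\<^sup>2 / \<kappa>\<^sup>2)) + ennreal (exp (?NI x / (2 * \<kappa>\<^sup>2)))
        + ennreal (exp (?NJ x / (2 * \<kappa>\<^sup>2))))"
      using \<kappa>E by (subst ennreal_mult) (auto simp: add_nonneg_nonneg)
    finally show "ennreal (norm (?xa x * ?xb x - X a x * X b x)) \<le> \<dots>" .
  qed
  also have "\<dots> = ennreal (\<kappa>\<^sup>2 * E)
      * ((\<integral>\<^sup>+ x. ennreal (exp ((X a x)\<^sup>2 / \<kappa>\<^sup>2)) \<partial>P)
      + (\<integral>\<^sup>+ x. ennreal (exp ((X b x)\<^sup>2 / \<kappa>\<^sup>2)) \<partial>P)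
      + (\<integral>\<^sup>+ x. ennreal (exp (?NI x / (2 * \<kappa>\<^sup>2))) \<partial>P)
          + (\<integral>\<^sup>+ x. ennreal (exp (?NJ x / (2 * \<kappa>\<^sup>2))) \<partial>P))"
    by (simp add: nn_integral_cmult nn_integral_add)
  also have "\<dots> \<le> ennreal (\<kappa>\<^sup>2 * E) * (ennreal 2 + ennreal 2 + ennreal s2 + ennreal s2)"
    using sub_gaussian_coord[OF sg(1) I(1,3)] sub_gaussian_coord[OF sg(2) J(1,3)]
      sub_gaussian_norm_exp[OF P I(1) \<kappa> sg(1)] sub_gaussian_norm_exp[OF P J(1) \<kappa> sg(2)] I(2) J(2)
    by (intro mult_left_mono add_mono) (auto simp: s2_def)
  also have "\<dots> = ennreal (\<kappa>\<^sup>2 * E * (2 + 2 + s2 + s2))"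
  proof -
    have p: "ennreal (2 + 2 + s2 + s2) = ennreal 2 + ennreal 2 + ennreal s2 + ennreal s2"
    proof -
      have "ennreal (2 + 2 + s2 + s2) = ennreal (2 + 2 + s2) + ennreal s2" by (rule ennreal_plus) (use s2 in auto)
      also have "ennreal (2 + 2 + s2) = ennreal (2 + 2) + ennreal s2" by (rule ennreal_plus) (use s2 in auto)
      also have "ennreal (2 + 2) = ennreal 2 + ennreal 2" by (rule ennreal_plus) auto
      finally show ?thesis .
    qed
    show ?thesis unfolding p[symmetric] using \<kappa>E s2 by (intro ennreal_mult[symmetric]) auto
  qed
  also have "\<dots> \<le> ennreal (\<kappa>\<^sup>2 * E * (4 * s2))"
    using \<kappa>E s2 by (intro ennreal_leI mult_left_mono) auto
  finally have "norm (integral\<^sup>L P (\<lambda>x. ?xa x * ?xb x - X a x * X b x)) \<le> \<kappa>\<^sup>2 * E * (4 * s2)"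
    using \<kappa>E s2 by (subst (asm) ennreal_le_iff) auto
  then show ?thesis using i1 i2 by (simp add: s2_def E_def mult_ac)
qed

text \<open>The moment of order \<open>k\<close> of a chi-square variable with up to \<open>k\<^sup>2\<close> degrees of freedom; the exponent
  \<open>1 / (4 k)\<close> in the exponential moment is small enough for the latter to stay below \<open>2 ^ k\<close>.\<close>

lemma Gauss_partial_norm_power:
  fixes U :: "'i set"
  assumes U: "finite U" and G: "G \<subseteq> U" and k: "1 \<le> k" and card: "card G \<le> k\<^sup>2"
  shows "(\<integral>\<^sup>+ z. ennreal ((\<Sum>p\<in>G. (z p)\<^sup>2) ^ k) \<partial>Gauss U) \<le> ennreal ((8 * (real k)\<^sup>2) ^ k)"
proof -
  have fin: "finite G" using U G by (rule finite_subset[rotated])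
  have m: "(\<lambda>z. ennreal ((\<Sum>p\<in>G. (z p)\<^sup>2) ^ k)) \<in> borel_measurable (Gauss G)"
    by (intro measurable_compose[OF _ measurable_ennreal] borel_measurable_power borel_measurable_sum Gauss_component)
  have r: "distr (Gauss U) (Gauss G) (\<lambda>z. restrict z G) = Gauss G"
    using prob_space_std_normal U G by (intro product_prob_space.distr_PiM_restrict_finite)
      (auto intro!: product_prob_spaceI intro: finite_subset)
  have "(\<integral>\<^sup>+ z. ennreal ((\<Sum>p\<in>G. (z p)\<^sup>2) ^ k) \<partial>Gauss U)
      = (\<integral>\<^sup>+ z. ennreal ((\<Sum>p\<in>G. (restrict z G p)\<^sup>2) ^ k) \<partial>Gauss U)"
    by simp
  also have "\<dots> = (\<integral>\<^sup>+ z. ennreal ((\<Sum>p\<in>G. (z p)\<^sup>2) ^ k) \<partial>distr (Gauss U) (Gauss G)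
      (\<lambda>z. restrict z G))"
    using m G by (intro nn_integral_distr[symmetric] measurable_restrict_subset) auto
  also have "\<dots> = (\<integral>\<^sup>+ z. ennreal ((\<Sum>p\<in>G. (z p)\<^sup>2) ^ k) \<partial>Gauss G)" unfolding r ..
  also have "\<dots> \<le> (\<integral>\<^sup>+ z. ennreal ((4 * real k) ^ k * fact k) * ennreal (exp (\<Sum>p\<in>G. 0 * z p
      + 1 / (4 * real k) * (z p)\<^sup>2)) \<partial>Gauss G)"
  proof (intro nn_integral_mono)
    fix z :: "'i \<Rightarrow> real"
    let ?s = "\<Sum>a\<in>G. (z a)\<^sup>2"
    have "(?s / (4 * real k)) ^ k \<le> fact k * exp (?s / (4 * real k))" by (rule power_le_fact_exp) (simp add: sum_nonneg)
    then have "(4 * real k) ^ k * (?s / (4 * real k)) ^ k \<le> (4 * real k) ^ k * (fact k * exp (?s / (4 * real k)))"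
      by (rule mult_left_mono) simp
    then have b: "?s ^ k \<le> (4 * real k) ^ k * fact k * exp (?s / (4 * real k))"
      using k by (simp add: power_divide mult.assoc)
    have e: "(\<Sum>a\<in>G. 0 * z a + 1 / (4 * real k) * (z a)\<^sup>2) = ?s / (4 * real k)" by (simp add: sum_divide_distrib)
    show "ennreal (?s ^ k) \<le> ennreal ((4 * real k) ^ k * fact k) * ennreal (exp (\<Sum>p\<in>G. 0 * z p
        + 1 / (4 * real k) * (z p)\<^sup>2))"
      unfolding e by (subst ennreal_mult[symmetric]) (use b in \<open>auto intro: ennreal_leI\<close>)
  qed
  also have "\<dots> = ennreal ((4 * real k) ^ k * fact k) * (\<integral>\<^sup>+ z. ennreal (exp (\<Sum>p\<in>G. 0 * z p
      + 1 / (4 * real k) * (z p)\<^sup>2)) \<partial>Gauss G)"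
    by (rule nn_integral_cmult) (auto intro!: borel_measurable_sum Gauss_component)
  also have "\<dots> = ennreal ((4 * real k) ^ k * fact k) * ennreal (1 / sqrt (1 - 2 * (1 / (4 * real k))) ^ card G)"
    using nn_integral_exp_Gauss[OF fin, of "1 / (4 * real k)" "\<lambda>_. 0"] k by simp
  also have "\<dots> \<le> ennreal ((4 * real k) ^ k * real k ^ k) * ennreal (2 ^ k)"
  proof (intro mult_mono ennreal_leI mult_left_mono)
    show "fact k \<le> real k ^ k" using fact_le_power[of k, where 'a=real] by simp
    define x where "x = 1 / (2 * real k)"
    have x: "0 \<le> x" "x \<le> 1/2" using k by (auto simp: x_def)
    have "1 \<le> (1 + 2 * x) * (1 - x)" using x mult_left_mono[OF x(2), of "2 * x"] by (simp add: algebra_simps)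
    also have "\<dots> \<le> exp (2 * x) * (1 - x)" using x by (intro mult_right_mono exp_ge_add_one_self) auto
    finally have "1 / (1 - x) \<le> exp (2 * x)" using x by (simp add: field_simps)
    then have "sqrt (1 / (1 - x)) \<le> sqrt (exp (2 * x))" by (rule real_sqrt_le_mono)
    also have "sqrt (exp (2 * x)) = exp x" by (rule real_sqrt_unique) (auto simp: exp_double[symmetric])
    finally have sq: "1 / sqrt (1 - x) \<le> exp x" by (simp add: real_sqrt_divide)
    have "1 / sqrt (1 - 2 * (1 / (4 * real k))) ^ card G = (1 / sqrt (1 - x)) ^ card G" by (simp add: x_def power_one_over)
    also have "\<dots> \<le> exp x ^ card G" using sq x by (intro power_mono) auto
    also have "\<dots> \<le> exp x ^ k\<^sup>2" using x card by (intro power_increasing) auto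
    also have "\<dots> = exp (1/2) ^ k"
    proof -
      have "real (k\<^sup>2) * x = real k * (1/2)" using k by (simp add: x_def power2_eq_square)
      then show ?thesis by (simp only: exp_of_nat_mult[symmetric])
    qed
    also have "\<dots> \<le> 2 ^ k"
    proof (intro power_mono)
      have "(exp (1/2 :: real))\<^sup>2 \<le> 2\<^sup>2" using exp_le by (simp add: exp_double[symmetric])
      then show "exp (1/2 :: real) \<le> 2" by (rule power2_le_imp_le) simp
    qed simp
    finally show "1 / sqrt (1 - 2 * (1 / (4 * real k))) ^ card G \<le> 2 ^ k" .
  qed auto
  also have "\<dots> = ennreal ((4 * real k) ^ k * real k ^ k * 2 ^ k)" by (rule ennreal_mult[symmetric]) auto
  also have "(4 * real k) ^ k * real k ^ k * 2 ^ k = (4 * real k * real k * 2) ^ k" by (simp only: power_mult_distrib)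
  also have "4 * real k * real k * 2 = 8 * (real k)\<^sup>2" by (simp add: power2_eq_square)
  finally show ?thesis .
qed

lemma truncated_moment_le:
  assumes f[measurable]: "f \<in> borel_measurable P" and f0: "\<And>x. 0 \<le> f x" and m: "0 \<le> m" and T: "0 < T" and k: "1 \<le> k"
    and E: "(\<integral>\<^sup>+ x. ennreal (f x ^ k) \<partial>P) \<le> ennreal (m ^ k)"
  shows "(\<integral>\<^sup>+ x. ennreal (if T < f x then f x else 0) \<partial>P) \<le> ennreal (T * (m / T) ^ k)"
proof -
  have le: "(if T < f x then f x else 0) \<le> 1 / T ^ (k - 1) * f x ^ k" for x
  proof (cases "T < f x")
    case True
    have "f x * T ^ (k - 1) \<le> f x * f x ^ (k - 1)" using True T f0 by (intro mult_left_mono power_mono) auto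
    also have "\<dots> = f x ^ k" using k by (cases k) auto
    finally show ?thesis using True T by (simp add: field_simps)
  qed (use f0 T in auto)
  have "(\<integral>\<^sup>+ x. ennreal (if T < f x then f x else 0) \<partial>P)
      \<le> (\<integral>\<^sup>+ x. ennreal (1 / T ^ (k - 1)) * ennreal (f x ^ k) \<partial>P)"
    using le T f0 by (intro nn_integral_mono) (auto simp: ennreal_mult[symmetric] intro!: ennreal_leI)
  also have "\<dots> = ennreal (1 / T ^ (k - 1)) * (\<integral>\<^sup>+ x. ennreal (f x ^ k) \<partial>P)" by (simp add: nn_integral_cmult)
  also have "\<dots> \<le> ennreal (1 / T ^ (k - 1)) * ennreal (m ^ k)" by (intro mult_left_mono E) simp
  also have "\<dots> = ennreal (1 / T ^ (k - 1) * m ^ k)" using T m by (intro ennreal_mult[symmetric]) auto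
  also have "1 / T ^ (k - 1) * m ^ k = T * (m / T) ^ k"
    using T k by (cases k) (auto simp: power_divide)
  finally show ?thesis .
qed

text \<open>Here \<open>sA\<close>, \<open>sT\<close>, \<open>sE\<close> stand for the squared norms of the answer, of the signal and of the error. If
  \<open>sE \<le> T / 4\<close>, a kept answer forces a signal above \<open>T / 4\<close>, and a rejected one forces a signal of
  at most \<open>5 T / 2\<close>.\<close>

lemma threshold_error_le:
  fixes sA sT sE T :: real
  assumes 1: "sA \<le> 2 * sT + 2 * sE" and 2: "sT \<le> 2 * sA + 2 * sE" and nn: "0 \<le> T" "0 \<le> sA" "0 \<le> sT" "0 \<le> sE"
  shows "(if T < sA then sE else sT) \<le> 10 * min sT T + 10 * (if T / 4 < sE then sE else 0)"
  using assms by (auto simp: min_def)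

section \<open>Geometry of the dyadic blocks\<close>

locale admissible_estimator = adaptive_estimator +
  assumes adm: admissible and rho_pos: "0 < \<rho>" and C_pos: "0 < C" and c0_pos: "0 < c0"
begin

lemma k0_pos: "0 < k0" and k0_le: "real k0 \<le> c0 * real n"
  using adm unfolding admissible_def by auto

lemma n_pos: "0 < n"
proof (rule ccontr)
  assume "\<not> 0 < n"
  then show False using k0_le k0_pos by simp
qed

lemma d_pos: "0 < d" and k0_le_d: "k0 \<le> d"
  using k0_pos unfolding k0_def by auto

lemma k_pos: "0 < k m" and k_0: "k 0 = k0" and k_Suc: "k (Suc m) = 2 * k m"
  using k0_pos by (auto simp: k_def)

lemma k_mono: "m \<le> m' \<Longrightarrow> k m \<le> k m'"
  unfolding k_def by simp

definition depth where "depth = (LEAST j. d \<le> 2 ^ j * k0)"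

lemma D_eq: "D = k depth"
  unfolding D_def depth_def k_def ..

lemma d_le_D: "d \<le> D"
proof -
  have "d \<le> 2 ^ d" by (simp add: less_imp_le)
  also have "\<dots> \<le> 2 ^ d * k0" using k0_pos by simp
  finally have "d \<le> 2 ^ depth * k0" unfolding depth_def by (rule LeastI)
  then show ?thesis by (simp add: D_eq k_def)
qed

lemma D_pos: "0 < D"
  using d_le_D d_pos by simp

lemma D_le: "D \<le> 2 * d"
proof (cases depth)
  case 0
  then show ?thesis using k0_le_d by (simp add: D_eq k_0)
next
  case (Suc j)
  then have "\<not> d \<le> 2 ^ j * k0" using not_less_Least[of j "\<lambda>j. d \<le> 2 ^ j * k0"] unfolding depth_def by simp
  then show ?thesis using Suc by (simp add: D_eq k_def)
qed

definition max_level :: nat where "max_level = S - 1"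

lemma max_level_props:
  shows S_eq: "S = Suc max_level" and max_level_le_depth: "max_level \<le> depth" and k_max_level_le: "real (k max_level) \<le> c0 * real n"
    and max_level_greatest: "\<And>m. real (k m) \<le> c0 * real n \<Longrightarrow> m \<le> depth \<Longrightarrow> m \<le> max_level"
proof -
  let ?L = "{m. real (k m) \<le> min (c0 * real n) (real D)}"
  have le_depth: "m \<le> depth" if "m \<in> ?L" for m
  proof (rule ccontr)
    assume "\<not> m \<le> depth"
    then have "k (Suc depth) \<le> k m" by (intro k_mono) simp
    then show False using that k_pos[of depth] by (simp add: k_Suc D_eq)
  qed
  then have fin: "finite ?L" by (intro finite_subset[of ?L "{..depth}"]) auto
  have "k 0 \<le> k depth" by (rule k_mono) simp
  then have ne: "0 \<in> ?L" using k0_le by (simp add: k_0 D_eq)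
  show S: "S = Suc max_level" by (simp add: max_level_def S_def)
  then have max_level: "max_level = Max ?L" by (simp add: S_def)
  have "max_level \<in> ?L" unfolding max_level using fin ne by (intro Max_in) auto
  then show "max_level \<le> depth" "real (k max_level) \<le> c0 * real n" using le_depth by auto
  show "m \<le> max_level" if "real (k m) \<le> c0 * real n" "m \<le> depth" for m
  proof -
    have "k m \<le> D" using k_mono[OF that(2)] by (simp add: D_eq)
    then show ?thesis unfolding max_level using fin that(1) by (intro Max_ge) auto
  qed
qed

lemma S_pos: "0 < S" by (simp add: S_eq)

lemma N_eq: assumes "m \<le> max_level" shows "N m = 2 ^ (depth - m)" and N_mult_k: "N m * k m = D"
proof -
  have "D = 2 ^ (depth - m) * k m" using assms max_level_le_depth
    by (simp add: D_eq k_def mult.assoc[symmetric] power_add[symmetric])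
  then show "N m = 2 ^ (depth - m)" "N m * k m = D" using k_pos[of m] by (simp_all add: N_def)
qed

lemma N_pos: "m \<le> max_level \<Longrightarrow> 0 < N m" by (simp add: N_eq)

lemma budget_pos: "m \<le> max_level \<Longrightarrow> 0 < budget m"
  using rho_pos S_pos N_pos[of m] N_pos[of 0] by (simp add: budget_def)

text \<open>The number, counted from zero, of the interval of level \<open>m\<close> that contains \<open>a\<close>. Unlike the intervals
  themselves it is defined by division, so that passing to the next level is halving.\<close>

definition idx :: "nat \<Rightarrow> nat \<Rightarrow> nat" where "idx m a = (a - 1) div k m"

lemma I_iff: assumes "1 \<le> a" "1 \<le> l" shows "a \<in> I m l \<longleftrightarrow> idx m a = l - 1"
proof -
  obtain a' l' where [simp]: "a = Suc a'" "l = Suc l'" using assms by (cases a; cases l) auto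
  have "idx m a = l' \<longleftrightarrow> l' * k m \<le> a' \<and> a' < Suc l' * k m"
  proof
    assume "idx m a = l'"
    then show "l' * k m \<le> a' \<and> a' < Suc l' * k m"
      using div_times_less_eq_dividend[of a' "k m"] dividend_less_div_times[OF k_pos, of a' m] by (auto simp: idx_def)
  next
    assume "l' * k m \<le> a' \<and> a' < Suc l' * k m"
    then show "idx m a = l'" unfolding idx_def by (intro div_nat_eqI) (auto simp: mult.commute)
  qed
  then show ?thesis by (auto simp: I_def)
qed

lemma I_finite: "finite (I m l)" and card_I: "1 \<le> l \<Longrightarrow> card (I m l) = k m"
  by (auto simp: I_def) (metis One_nat_def Suc_le_D Suc_leD diff_Suc_Suc diff_add_inverse2 diff_zero minus_nat.diff_0 mult_Suc)

lemma I_subset: "m \<le> max_level \<Longrightarrow> l \<le> N m \<Longrightarrow> I m l \<subseteq> {1..D}"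
  using N_mult_k[of m] mult_le_mono1[of l "N m" "k m"] by (auto simp: I_def)

lemma idx_Suc: "idx (Suc m) a = idx m a div 2"
  by (simp add: idx_def k_Suc div_mult2_eq mult.commute[of 2])

lemma idx_mono: "a \<le> b \<Longrightarrow> idx m a \<le> idx m b"
  unfolding idx_def by (intro div_le_mono) simp

lemma idx_less_N: "m \<le> max_level \<Longrightarrow> 1 \<le> a \<Longrightarrow> a \<le> D \<Longrightarrow> idx m a < N m"
  unfolding idx_def N_mult_k[of m, symmetric] by (intro less_mult_imp_div_less) simp

lemma idx_dist: assumes "idx m a + 2 \<le> idx m b" shows "a + k m < b"
proof -
  have "k m * (idx m a + 2) \<le> k m * idx m b" by (rule mult_le_mono2[OF assms])
  also have "\<dots> \<le> b - 1" unfolding idx_def by simp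
  finally have "k m * idx m a + 2 * k m \<le> b - 1" by (simp add: algebra_simps)
  moreover have "a - 1 < k m * idx m a + k m" unfolding idx_def
    using dividend_less_times_div[OF k_pos] by (simp add: add.commute)
  ultimately show ?thesis by linarith
qed

definition region :: "nat \<times> nat \<times> nat \<Rightarrow> (nat \<times> nat) set" where
  "region = (\<lambda>(m, l, r). if m = 0 then B 0 l r else \<Gamma> m l)"

lemma queries_cases:
  assumes "q \<in> queries"
  obtains l r where "q = (0, l, r)" "1 \<le> l" "r \<le> 1" "l + r \<le> N 0"
  | m l where "q = (m, l, 1)" "1 \<le> m" "m \<le> max_level" "1 \<le> l" "l + 1 \<le> N m"
  using assms unfolding queries_def max_level_def by fastforce

lemma queries_props:
  assumes "(m, l, r) \<in> queries"
  shows "m \<le> max_level" "1 \<le> l" "r \<le> 1" "l + r \<le> N m" "m \<noteq> 0 \<Longrightarrow> r = 1"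
  using assms by (auto elim!: queries_cases)

lemma finite_queries: "finite queries"
proof -
  have "queries \<subseteq> (\<lambda>(m, l). (m, l, 0)) ` ({..max_level} \<times> {..N 0}) \<union> (\<lambda>(m, l). (m, l, 1))
      ` (SIGMA m:{..max_level}. {..N m})"
    by (auto elim!: queries_cases simp: le_Suc_eq image_iff)
  then show ?thesis by (rule finite_subset) auto
qed

text \<open>Level \<open>0\<close> has at most two queries per interval, every higher level at most one.\<close>

lemma sum_queries_le:
  fixes g :: "nat \<Rightarrow> real"
  assumes g: "\<And>m. 0 \<le> g m"
  shows "(\<Sum>q\<in>queries. g (fst q)) \<le> 2 * real (N 0) * g 0 + (\<Sum>m=1..max_level. real (N m) * g m)"
proof -
  let ?Q0 = "(\<lambda>(l, r). (0, l, r)) ` ({1..N 0} \<times> {0, 1::nat})" and ?Q1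
      = "(\<lambda>(m, l). (m, l, 1::nat)) ` (SIGMA m:{1..max_level}. {1..N m})"
  have "queries \<subseteq> ?Q0 \<union> ?Q1"
    by (auto elim!: queries_cases simp: le_Suc_eq image_iff)
  then have "(\<Sum>q\<in>queries. g (fst q)) \<le> (\<Sum>q\<in>?Q0 \<union> ?Q1. g (fst q))"
    using g by (intro sum_mono2) auto
  also have "\<dots> = (\<Sum>q\<in>?Q0. g (fst q)) + (\<Sum>q\<in>?Q1. g (fst q))"
    by (subst sum.union_disjoint) auto
  also have "(\<Sum>q\<in>?Q0. g (fst q)) = (\<Sum>(l, r)\<in>{1..N 0} \<times> {0, 1::nat}. g 0)"
    by (subst sum.reindex) (auto simp: inj_on_def split_def)
  also have "\<dots> = 2 * real (N 0) * g 0" by (simp add: split_def)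
  also have "(\<Sum>q\<in>?Q1. g (fst q)) = (\<Sum>(m, l)\<in>(SIGMA m:{1..max_level}. {1..N m}). g m)"
    by (subst sum.reindex) (auto simp: inj_on_def split_def)
  also have "\<dots> = (\<Sum>m=1..max_level. real (N m) * g m)"
    by (subst sum.Sigma[symmetric]) auto
  finally show ?thesis .
qed

lemma region_subset_B: "region (m, l, r) \<subseteq> I m l \<times> I m (l + r)" if "(m, l, r) \<in> queries"
  using queries_props[OF that] by (auto simp: region_def B_def \<Gamma>_def)

lemma region_subset: "q \<in> queries \<Longrightarrow> region q \<subseteq> {1..D} \<times> {1..D}"
proof -
  assume q: "q \<in> queries"
  obtain m l r where [simp]: "q = (m, l, r)" by (cases q)
  have "m \<le> max_level" "l + r \<le> N m" using queries_props[of m l r] q by auto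
  then have "I m l \<subseteq> {1..D}" "I m (l + r) \<subseteq> {1..D}"
    by (intro I_subset; simp)+
  then show ?thesis using region_subset_B[of m l r] q by auto
qed

lemma region0_iff:
  assumes "1 \<le> a" "1 \<le> b" "1 \<le> l"
  shows "(a, b) \<in> region (0, l, r) \<longleftrightarrow> idx 0 a + 1 = l \<and> idx 0 b = idx 0 a + r"
  using assms by (auto simp: region_def B_def I_iff)

lemma region_Suc_iff:
  assumes "1 \<le> a" "1 \<le> b" "1 \<le> l"
  shows "(a, b) \<in> region (Suc m, l, 1) \<longleftrightarrow>
    idx (Suc m) a + 1 = l \<and> idx (Suc m) b = idx (Suc m) a + 1 \<and> idx m a + 2 \<le> idx m b"
proof -
  have "(a, b) \<in> region (Suc m, l, 1) \<longleftrightarrow> idx (Suc m) a + 1 = l \<and> idx (Suc m) b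
      = l \<and> \<not> (idx m a + 1 = 2 * l \<and> idx m b = 2 * l)"
    using assms by (auto simp: region_def B_def \<Gamma>_def I_iff)
  then show ?thesis unfolding idx_Suc by (auto; presburger)
qed

text \<open>The level on which a pair is estimated is the first one on which its indices lie in equal or
  neighbouring intervals; the block removed in \<open>\<Gamma>\<close> holds exactly the pairs that were neighbours one
  level earlier.\<close>

lemma region_level_iff:
  assumes q: "(m, l, r) \<in> queries" and ab: "1 \<le> a" "a \<le> b"
  shows "(a, b) \<in> region (m, l, r) \<longleftrightarrow>
    idx m a + 1 = l \<and> idx m b = idx m a + r \<and> (\<forall>m'<m. idx m' a + 2 \<le> idx m' b)"
proof (cases m)
  case 0
  then show ?thesis using region0_iff[of a b l r] queries_props[OF q] ab by simp
next
  case (Suc p)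
  have [simp]: "r = 1" using queries_props[OF q] Suc by simp
  have up: "idx p' a + 2 \<le> idx p' b" if "idx p a + 2 \<le> idx p b" "p' \<le> p" for p'
    using that(2,1)
  proof (induction p rule: dec_induct)
    case (step p)
    then show ?case using idx_mono[OF ab(2), of p] unfolding idx_Suc by presburger
  qed
  show ?thesis
    using region_Suc_iff[of a b l p] queries_props[OF q] ab up unfolding Suc by (auto simp: less_Suc_eq_le)
qed

lemma region_unique:
  assumes q: "q \<in> queries" "q' \<in> queries" and ab: "1 \<le> a" "a \<le> b" and r: "(a, b) \<in> region q" "(a, b) \<in> region q'"
  shows "q = q'"
proof -
  obtain m l r m' l' r' where qq: "q = (m, l, r)" "q' = (m', l', r')" by (cases q; cases q')
  have 1: "idx m a + 1 = l" "idx m b = idx m a + r" "\<And>p. p < m \<Longrightarrow> idx p a + 2 \<le> idx p b"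
    and 2: "idx m' a + 1 = l'" "idx m' b = idx m' a + r'" "\<And>p. p < m' \<Longrightarrow> idx p a + 2 \<le> idx p b"
    using region_level_iff[of m l r a b] region_level_iff[of m' l' r' a b] q ab r unfolding qq by auto
  have "r \<le> 1" "r' \<le> 1" using queries_props[of m l r] queries_props[of m' l' r'] q unfolding qq by auto
  then have "\<not> m < m'" "\<not> m' < m" using 1(2) 2(2) 1(3)[of m'] 2(3)[of m] by auto
  then show ?thesis using 1 2 qq by simp
qed

text \<open>If no region contains the pair, its indices are not even neighbours on the last level. Then this
  level has several intervals, so what stopped the levels was the bound \<open>c0 n\<close> and not the dimension.\<close>

lemma uncovered_far:
  assumes ab: "1 \<le> a" "a \<le> b" "b \<le> D" and un: "\<And>q. q \<in> queries \<Longrightarrow> (a, b) \<notin> region q"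
  shows "a + k max_level < b" and "c0 * real n < 2 * real (k max_level)" and "c0 * real n < real D"
proof -
  \<comment> \<open>On the first level with equal or neighbouring intervals there would be a query for the pair.\<close>
  have far: "idx m a + 2 \<le> idx m b" if "m \<le> max_level" for m
    using that
  proof (induction m rule: less_induct)
    case (less m)
    show ?case
    proof (rule ccontr)
      assume "\<not> idx m a + 2 \<le> idx m b"
      then have "idx m b = idx m a \<or> idx m b = idx m a + 1" using idx_mono[OF ab(2), of m] by linarith
      then obtain r where r: "r = 0 \<or> r = 1" "idx m b = idx m a + r" by auto
      have prev: "\<forall>m'<m. idx m' a + 2 \<le> idx m' b" using less by auto
      have N: "idx m a + 1 + r \<le> N m" using idx_less_N[of m b] less.prems ab r by auto
      have "m = 0 \<or> r = 1"
      proof (cases m)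
        case (Suc p)
        then have "idx p a + 2 \<le> idx p b" using prev by simp
        then show ?thesis using r unfolding Suc idx_Suc by presburger
      qed simp
      then have q: "(m, idx m a + 1, r) \<in> queries"
      proof
        assume "m = 0" then show ?thesis using N r by (auto simp: queries_def)
      next
        assume "r = 1" then show ?thesis using N less.prems unfolding queries_def max_level_def
          by (cases m) auto
      qed
      then have "(a, b) \<in> region (m, idx m a + 1, r)"
        using region_level_iff[OF q] ab prev r by simp
      then show False using un[OF q] by simp
    qed
  qed
  from far[of max_level] show "a + k max_level < b" by (intro idx_dist) simp
  have "idx max_level b < N max_level" using idx_less_N[of max_level b] ab by simp
  then have "2 < N max_level" using far[of max_level] by simp
  then have "max_level \<noteq> depth" by (auto simp: N_eq)
  then have td: "Suc max_level \<le> depth" using max_level_le_depth by simp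
  have *: "c0 * real n < real (k (Suc max_level))" using max_level_greatest[OF _ td] by fastforce
  then show "c0 * real n < 2 * real (k max_level)" by (simp add: k_Suc)
  have "k (Suc max_level) \<le> D" unfolding D_eq by (rule k_mono[OF td])
  then show "c0 * real n < real D" using * by linarith
qed

lemma region_far:
  assumes q: "(m, l, r) \<in> queries" and m: "m \<noteq> 0" and ab: "(a, b) \<in> region (m, l, r)"
  shows "2 * a + k m < 2 * b"
proof -
  obtain p where p: "m = Suc p" using m by (cases m) auto
  have r: "r = 1" using queries_props[OF q] m by simp
  have pos: "1 \<le> a" "1 \<le> b" using region_subset[OF q] ab by auto
  have "idx p a + 2 \<le> idx p b" using region_Suc_iff[of a b l p] pos queries_props[OF q] ab unfolding p r by simp
  from idx_dist[OF this] show ?thesis by (simp add: p k_Suc)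
qed

end

section \<open>Privacy of the estimator\<close>

lemma sum_clip_sq_le:
  assumes "0 \<le> R"
  shows "(\<Sum>a\<in>I. (clip R I z a)\<^sup>2) \<le> R\<^sup>2"
proof -
  have "(\<Sum>a\<in>I. (clip R I z a)\<^sup>2) = (min 1 (R / L2_set z I))\<^sup>2 * (L2_set z I)\<^sup>2"
    by (simp add: clip_def power_mult_distrib sum_distrib_right[symmetric] L2_set_def sum_nonneg mult.commute)
  also have "\<dots> = (min 1 (R / L2_set z I) * L2_set z I)\<^sup>2" by (simp add: power_mult_distrib)
  also have "\<dots> \<le> R\<^sup>2"
  proof (rule power_mono)
    show "min 1 (R / L2_set z I) * L2_set z I \<le> R"
      using assms mult_right_mono[OF min.cobounded2[of 1 "R / L2_set z I"] L2_set_nonneg[of z I]]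
      by (cases "L2_set z I = 0") auto
    show "0 \<le> min 1 (R / L2_set z I) * L2_set z I" using assms L2_set_nonneg[of z I] by simp
  qed
  finally show ?thesis .
qed

context admissible_estimator
begin

text \<open>Coordinates of the symmetric Gaussian matrices.\<close>

definition upper :: "(nat \<times> nat) set" where "upper = {(a, b). 1 \<le> a \<and> a \<le> b \<and> b \<le> D}"

lemma finite_upper: "finite upper"
  by (rule finite_subset[of _ "{1..D} \<times> {1..D}"]) (auto simp: upper_def)

definition radius :: "nat \<Rightarrow> real" where "radius m = sqrt (C * real (k m))"

lemma radius_pos: "0 < radius m" using C_pos k_pos by (simp add: radius_def)

definition noise_sd :: "nat \<times> nat \<times> nat \<Rightarrow> real" where
  "noise_sd = (\<lambda>(m, l, r). sqrt (18 * radius m ^ 4 / (budget m * (real n)\<^sup>2)))"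

lemma noise_sd_pos: "q \<in> queries \<Longrightarrow> 0 < noise_sd q"
  using radius_pos[of "fst q"] budget_pos[of "fst q"] n_pos
  by (auto simp: noise_sd_def intro!: divide_pos_pos mult_pos_pos elim!: queries_cases)

definition block :: "nat \<times> nat \<times> nat \<Rightarrow> (nat \<times> nat) set" where
  "block = (\<lambda>(m, l, r). I m l \<times> I m (l + r))"

definition clipped_cov :: "nat \<times> nat \<times> nat \<Rightarrow> (nat \<Rightarrow> nat \<Rightarrow> real) \<Rightarrow> mat" where
  "clipped_cov = (\<lambda>(m, l, r) X (a, b). (1 / real n) *
     (\<Sum>i=1..n. clip (radius m) (I m l) (pad X i) a * clip (radius m) (I m (l + r)) (pad X i) b))"

text \<open>The answer to a query as a function of the clipped matrix \<open>F\<close> and of standard Gaussian upper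
  triangular entries \<open>z\<close>.\<close>

definition noisy :: "nat \<times> nat \<times> nat \<Rightarrow> mat \<Rightarrow> mat \<Rightarrow> mat" where
  "noisy q F z = restrict (mat_on (\<lambda>(a, b). F (a, b) + noise_sd q * z (min a b, max a b)) (block q)) ({1..D} \<times> {1..D})"

lemma block_subset: "q \<in> queries \<Longrightarrow> block q \<subseteq> {1..D} \<times> {1..D}"
proof -
  assume q: "q \<in> queries"
  obtain m l r where [simp]: "q = (m, l, r)" by (cases q)
  have "m \<le> max_level" "l + r \<le> N m" using queries_props[of m l r] q by auto
  then have "I m l \<subseteq> {1..D}" "I m (l + r) \<subseteq> {1..D}" by (intro I_subset; simp)+
  then show ?thesis by (auto simp: block_def)
qed

lemma finite_block: "finite (block q)"
  by (cases q) (simp add: block_def I_finite)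

lemma minmax_upper: "a \<in> {1..D} \<Longrightarrow> b \<in> {1..D} \<Longrightarrow> (min a b, max a b) \<in> upper"
  by (auto simp: upper_def)

lemma noisy_measurable [measurable]: "noisy q F \<in> measurable (Gauss upper) (Mat D)"
  unfolding noisy_def mat_on_def
proof (rule measurable_restrict)
  fix p assume p: "p \<in> {1..D} \<times> {1..D}"
  obtain a b where pab: "p = (a, b)" by (cases p)
  have [measurable]: "(\<lambda>z. z (min a b, max a b)) \<in> borel_measurable (Gauss upper)"
    using p unfolding pab by (intro Gauss_component minmax_upper) auto
  show "(\<lambda>z. if p \<in> block q then (case p of (a, b) \<Rightarrow> F (a, b)
      + noise_sd q * z (min a b, max a b)) else 0) \<in> borel_measurable (Gauss upper)"
    unfolding pab prod.case by measurable
qed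

lemma dp_cov_block_eq:
  "dp_cov_block D n (pad X) (I m l) (I m (l + r)) (budget m) (sqrt (C * real (k m)))
    = distr (Gauss upper) (Mat D) (noisy (m, l, r) (clipped_cov (m, l, r) X))"
proof -
  let ?s = "\<lambda>z. restrict (\<lambda>(a, b). z (min a b, max a b)) ({1..D} \<times> {1..D})"
  let ?g = "\<lambda>G. restrict (mat_on (\<lambda>(a, b). (1 / real n) * (\<Sum>i=1..n. clip (radius m) (I m l) (pad X i) a
      * clip (radius m) (I m (l + r)) (pad X i) b)
                      + sqrt (18 * radius m ^ 4 / (budget m * (real n)\<^sup>2)) * G (a, b)) (I m l \<times> I m (l
                          + r))) ({1..D} \<times> {1..D})"
  have s: "?s \<in> measurable (Gauss upper) (Mat D)"
  proof (rule measurable_restrict)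
    fix p assume p: "p \<in> {1..D} \<times> {1..D}"
    then show "(\<lambda>z. case p of (a, b) \<Rightarrow> z (min a b, max a b)) \<in> borel_measurable (Gauss upper)"
      by (cases p) (auto intro!: Gauss_component minmax_upper)
  qed
  have g: "?g \<in> measurable (Mat D) (Mat D)"
    unfolding mat_on_def by (rule measurable_restrict) (auto simp: split_def)
  have "dp_cov_block D n (pad X) (I m l) (I m (l + r)) (budget m) (sqrt (C * real (k m)))
      = distr (distr (Gauss upper) (Mat D) ?s) (Mat D) ?g"
    unfolding dp_cov_block_def sym_gauss_def upper_def[symmetric] radius_def[symmetric] ..
  also have "\<dots> = distr (Gauss upper) (Mat D) (?g \<circ> ?s)"
    by (rule distr_distr[OF g s])
  also have "?g \<circ> ?s = noisy (m, l, r) (clipped_cov (m, l, r) X)"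
    by (intro ext) (auto simp: noisy_def clipped_cov_def noise_sd_def block_def mat_on_def restrict_def)
  finally show ?thesis .
qed

lemma contribution_eq:
  "contribution A q p = (if p \<in> region q \<and>
     (fst q \<noteq> 0 \<longrightarrow> real (k (fst q)) * tau_sq (fst q) < (frob D (mat_on (A q) (region q)))\<^sup>2) then A q p else 0)"
  by (cases q) (auto simp: contribution_def region_def mat_on_def Let_def)

lemma assemble_measurable [measurable]: "assemble \<in> measurable (Pi\<^sub>M queries (\<lambda>_. Mat D)) (Mat d)"
  unfolding assemble_def
proof (rule measurable_restrict)
  fix p assume "p \<in> {1..d} \<times> {1..d}"
  obtain a b where p: "p = (a, b)" by (cases p)
  have entry: "(\<lambda>A. mat_on (A q) (region q) p') \<in> borel_measurable (Pi\<^sub>M queries (\<lambda>_. Mat D))"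
    if q: "q \<in> queries" for q p'
  proof (cases "p' \<in> region q")
    case True
    then have "p' \<in> {1..D} \<times> {1..D}" using region_subset[OF q] by auto
    then have "(\<lambda>B. B p') \<in> borel_measurable (Mat D)" by (rule measurable_component_singleton)
    from measurable_compose[OF measurable_component_singleton[OF q] this]
    show ?thesis using True by (simp add: mat_on_def)
  qed (simp add: mat_on_def)
  have contr: "(\<lambda>A. contribution A q p') \<in> borel_measurable (Pi\<^sub>M queries (\<lambda>_. Mat D))" if q: "q \<in>
      queries" for q p'
  proof -
    note [measurable] = entry[OF q]
    have eq: "contribution A q p' = (if fst q = 0 \<or> real (k (fst q))
        * tau_sq (fst q) < (L2_set (mat_on (A q) (region q)) ({1..D} \<times> {1..D}))\<^sup>2
        then mat_on (A q) (region q) p' else 0)" for A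
      by (auto simp: contribution_eq frob_def mat_on_def)
    show ?thesis unfolding eq L2_set_def by measurable
  qed
  show "(\<lambda>A. case p of (a, b) \<Rightarrow> \<Sum>q\<in>queries. contribution A q (min a b, max a b)) \<in>
      borel_measurable (Pi\<^sub>M queries (\<lambda>_. Mat D))"
    unfolding p prod.case by (intro borel_measurable_sum contr)
qed

definition noise :: "(nat \<times> nat \<times> nat \<Rightarrow> mat) measure" where
  "noise = Pi\<^sub>M queries (\<lambda>_. Gauss upper)"

lemma prob_space_noise: "prob_space noise"
  unfolding noise_def by (intro prob_space_PiM prob_space_Gauss)

text \<open>All randomness comes from one Gaussian array, indexed by queries and upper triangular entries.\<close>

lemma answers_eq:
  "answers X = distr noise (Pi\<^sub>M queries (\<lambda>_. Mat D)) (\<lambda>z. \<lambda>q\<in>queries. noisy q (clipped_cov q X) (z q))"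
proof -
  have "answers X = Pi\<^sub>M queries (\<lambda>q. distr (Gauss upper) (Mat D) (noisy q (clipped_cov q X)))"
    unfolding answers_def by (intro PiM_cong refl) (auto simp: dp_cov_block_eq)
  also have "\<dots> = distr noise (Pi\<^sub>M queries (\<lambda>_. Mat D)) (\<lambda>z. \<lambda>q\<in>queries. noisy q
      (clipped_cov q X) (z q))"
    unfolding noise_def by (rule PiM_distr[OF finite_queries prob_space_Gauss noisy_measurable])
  finally show ?thesis .
qed

lemma estimator_eq:
  "estimator X = distr noise (Mat d) (\<lambda>z. assemble (\<lambda>q\<in>queries. noisy q (clipped_cov q X) (z q)))"
proof -
  have m: "(\<lambda>z. \<lambda>q\<in>queries. noisy q (clipped_cov q X) (z q)) \<in> measurable noise (Pi\<^sub>M queries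
      (\<lambda>_. Mat D))"
    unfolding noise_def by (intro measurable_restrict) measurable
  show ?thesis
    unfolding estimator_def answers_eq using distr_distr[OF assemble_measurable m] by (simp add: comp_def)
qed

lemma pad_measurable [measurable]: "i \<in> {1..n} \<Longrightarrow> (\<lambda>X. pad X i a) \<in> borel_measurable (Dataset n (Vec d))"
proof -
  assume i: "i \<in> {1..n}"
  show ?thesis
  proof (cases "a \<in> {1..d}")
    case True
    from measurable_compose[OF measurable_component_singleton[OF i] measurable_component_singleton[OF this]]
    show ?thesis using True by (simp add: pad_def)
  next
    case False
    then have "(\<lambda>X. pad X i a) = (\<lambda>_. 0)" by (auto simp: pad_def)
    then show ?thesis by simp
  qed
qed

lemma clip_pad_measurable [measurable]:
  "i \<in> {1..n} \<Longrightarrow> (\<lambda>X. clip R A (pad X i) a) \<in> borel_measurable (Dataset n (Vec d))"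
  unfolding clip_def L2_set_def by measurable

lemma clipped_cov_measurable [measurable]:
  "(\<lambda>X. clipped_cov q X p) \<in> borel_measurable (Dataset n (Vec d))"
  unfolding clipped_cov_def split_def
  by (intro borel_measurable_times borel_measurable_const borel_measurable_sum clip_pad_measurable)

lemma estimator_measurable: "estimator \<in> measurable (Dataset n (Vec d)) (prob_algebra (Mat d))"
proof -
  let ?X = "Dataset n (Vec d)"
  have "(\<lambda>(X, z). assemble (\<lambda>q\<in>queries. noisy q (clipped_cov q X) (z q))) \<in> measurable (?X
      \<Otimes>\<^sub>M noise) (Mat d)"
    unfolding split_def
  proof (intro measurable_compose[OF _ assemble_measurable] measurable_restrict)
    fix q assume q: "q \<in> queries"
    show "(\<lambda>p. noisy q (clipped_cov q (fst p)) (snd p q)) \<in> measurable (?X \<Otimes>\<^sub>M noise) (Mat D)"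
      unfolding noisy_def mat_on_def
    proof (rule measurable_restrict)
      fix p assume p: "p \<in> {1..D} \<times> {1..D}"
      obtain a b where pab: "p = (a, b)" by (cases p)
      have "(\<lambda>z. z (min a b, max a b)) \<in> borel_measurable (Gauss upper)"
        using p unfolding pab by (intro Gauss_component minmax_upper) auto
      from measurable_compose[OF measurable_component_singleton[OF q] this]
      have "(\<lambda>z. z q (min a b, max a b)) \<in> borel_measurable noise" unfolding noise_def by simp
      note [measurable] = measurable_compose[OF measurable_snd this] measurable_compose[OF measurable_fst clipped_cov_measurable]
      show "(\<lambda>y. if p \<in> block q then (case p of (a, b) \<Rightarrow> clipped_cov q (fst y) (a, b)
          + noise_sd q * snd y q (min a b, max a b)) else 0)
         \<in> borel_measurable (?X \<Otimes>\<^sub>M noise)"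
        unfolding pab prod.case by measurable
    qed
  qed
  moreover have "(\<lambda>_. noise) \<in> measurable ?X (prob_algebra noise)"
    using prob_space_noise by (intro measurable_const) (simp add: space_prob_algebra)
  ultimately have "(\<lambda>X. distr noise (Mat d) (\<lambda>z. assemble (\<lambda>q\<in>queries. noisy q (clipped_cov q X) (z
      q)))) \<in> measurable ?X (prob_algebra (Mat d))"
    by (intro measurable_distr_prob_space2)
  then show ?thesis unfolding estimator_eq[abs_def] .
qed

lemma I_less: assumes "a \<in> I m l" "b \<in> I m (l + 1)" "1 \<le> l" shows "a < b"
  using assms by (auto simp: I_def)

text \<open>Diagonal blocks are symmetric and the others lie above the diagonal. Hence a clipped matrix is
  determined by its upper triangular entries, and adding it to the noise is a shift of the Gaussian
  array.\<close>

lemma clipped_cov_minmax: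
  assumes q: "q \<in> queries" and p: "(a, b) \<in> block q"
  shows "clipped_cov q X (min a b, max a b) = clipped_cov q X (a, b)" "(min a b, max a b) \<in> block q"
proof -
  obtain m l r where [simp]: "q = (m, l, r)" by (cases q)
  have "r = 0 \<or> r = 1" using queries_props[of m l r] q by auto
  then have "clipped_cov q X (min a b, max a b) = clipped_cov q X (a, b) \<and> (min a b, max a b) \<in> block q"
  proof
    assume "r = 0"
    then show ?thesis using p by (auto simp: block_def clipped_cov_def min_def max_def mult.commute)
  next
    assume "r = 1"
    then have "a < b" using p queries_props[of m l r] q by (auto simp: block_def intro: I_less[of a m l])
    then show ?thesis using p by simp
  qed
  then show "clipped_cov q X (min a b, max a b) = clipped_cov q X (a, b)" "(min a b, max a b) \<in> block q" by auto
qed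

text \<open>Both observations that differ contribute a rank one matrix of Frobenius norm at most \<open>R\<^sup>2\<close>.\<close>

lemma clipped_cov_sensitivity:
  assumes adj: "adjacent n X X'"
  shows "(\<Sum>p\<in>block (m, l, r). (clipped_cov (m, l, r) X p - clipped_cov (m, l, r) X' p)\<^sup>2)
      \<le> 4 * radius m ^ 4 / (real n)\<^sup>2"
proof -
  obtain i where i: "i \<in> {1..n}" and eq: "\<And>j. j \<in> {1..n} - {i} \<Longrightarrow> X j = X' j"
    using adj unfolding adjacent_def by auto
  define u where "u Y a = clip (radius m) (I m l) (pad Y i) a" for Y a
  define v where "v Y a = clip (radius m) (I m (l + r)) (pad Y i) a" for Y a
  have diff: "clipped_cov (m, l, r) X (a, b) - clipped_cov (m, l, r) X' (a, b) = (1 / real n) * (u X a * v X b - u X' a * v X' b)" for a b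
  proof -
    let ?g = "\<lambda>Y j. clip (radius m) (I m l) (pad Y j) a * clip (radius m) (I m (l + r)) (pad Y j) b"
    have pe: "pad X j = pad X' j" if "j \<in> {1..n} - {i}" for j using eq[OF that] by (auto simp: pad_def)
    have "(\<Sum>j=1..n. ?g X j) = ?g X i + (\<Sum>j\<in>{1..n}-{i}. ?g X j)" "(\<Sum>j=1..n. ?g X' j)
        = ?g X' i + (\<Sum>j\<in>{1..n}-{i}. ?g X' j)"
      using i by (simp_all add: sum.remove)
    moreover have "(\<Sum>j\<in>{1..n}-{i}. ?g X j) = (\<Sum>j\<in>{1..n}-{i}. ?g X' j)"
      by (intro sum.cong refl) (simp only: pe)
    ultimately show ?thesis by (simp add: clipped_cov_def u_def v_def diff_divide_distrib[symmetric])
  qed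
  have uv: "(\<Sum>p\<in>I m l \<times> I m (l + r). (u Y (fst p) * v Y (snd p))\<^sup>2) \<le> radius m ^ 4" for Y
  proof -
    have "(\<Sum>p\<in>I m l \<times> I m (l + r). (u Y (fst p) * v Y (snd p))\<^sup>2)
        = (\<Sum>a\<in>I m l. (u Y a)\<^sup>2) * (\<Sum>b\<in>I m (l + r). (v Y b)\<^sup>2)"
      by (simp add: sum.cartesian_product sum_product power_mult_distrib split_def)
    also have "\<dots> \<le> (radius m)\<^sup>2 * (radius m)\<^sup>2"
      unfolding u_def v_def using radius_pos[of m] by (intro mult_mono sum_clip_sq_le sum_nonneg) auto
    finally show ?thesis by (simp add: power_add[symmetric])
  qed
  have "(\<Sum>p\<in>block (m, l, r). (clipped_cov (m, l, r) X p - clipped_cov (m, l, r) X' p)\<^sup>2)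
      \<le> (\<Sum>p\<in>I m l \<times> I m (l + r). (1 / real n)\<^sup>2 * (2 * (u X (fst p) * v X (snd p))\<^sup>2
          + 2 * (u X' (fst p) * v X' (snd p))\<^sup>2))"
    unfolding block_def split
  proof (intro sum_mono, goal_cases)
    case (1 p)
    have sq: "(x - y)\<^sup>2 \<le> 2 * x\<^sup>2 + 2 * y\<^sup>2" for x y :: real
      using sum_squares_bound[of x "- y"] by (simp add: power2_eq_square algebra_simps)
    have "(clipped_cov (m, l, r) X p - clipped_cov (m, l, r) X' p)\<^sup>2
        = (1 / real n)\<^sup>2 * (u X (fst p) * v X (snd p) - u X' (fst p) * v X' (snd p))\<^sup>2"
      using diff[of "fst p" "snd p"] by (simp add: power_divide)
    then show ?case using mult_left_mono[OF sq, of "(1 / real n)\<^sup>2"] by simp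
  qed
  also have "\<dots> = (1 / real n)\<^sup>2 * (2 * (\<Sum>p\<in>I m l \<times> I m (l
      + r). (u X (fst p) * v X (snd p))\<^sup>2) + 2 * (\<Sum>p\<in>I m l \<times> I m (l + r). (u X' (fst p) * v X' (snd p))\<^sup>2))"
    by (simp add: sum_distrib_left[symmetric] sum.distrib)
  also have "\<dots> \<le> (1 / real n)\<^sup>2 * (2 * radius m ^ 4 + 2 * radius m ^ 4)"
    using uv by (intro mult_left_mono add_mono) auto
  finally show ?thesis by (simp add: power_divide)
qed

lemma sum_budget_le: "(\<Sum>q\<in>queries. budget (fst q)) \<le> \<rho>"
proof -
  define g where "g m = (if m \<le> max_level then budget m else 0)" for m
  have "(\<Sum>q\<in>queries. budget (fst q)) = (\<Sum>q\<in>queries. g (fst q))"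
    by (intro sum.cong refl) (auto simp: g_def elim!: queries_cases)
  also have "\<dots> \<le> 2 * real (N 0) * g 0 + (\<Sum>m=1..max_level. real (N m) * g m)"
    by (rule sum_queries_le) (auto simp: g_def intro: less_imp_le budget_pos)
  also have "2 * real (N 0) * g 0 = \<rho> / real S"
    using N_pos[of 0] S_pos by (simp add: g_def budget_def)
  also have "(\<Sum>m=1..max_level. real (N m) * g m) = (\<Sum>m=1..max_level. \<rho> / real S)"
    using N_pos by (intro sum.cong refl) (auto simp: g_def budget_def)
  also have "\<rho> / real S + (\<Sum>m=1..max_level. \<rho> / real S) = real S * (\<rho> / real S)"
    by (simp add: S_eq ring_distribs add_divide_distrib)
  also have "\<dots> = \<rho>" using S_pos by simp
  finally show ?thesis .
qed

text \<open>The estimator is a fixed map of the Gaussian array shifted by \<open>\<mu>\<close>, the clipped matrices in units of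
  the noise. By sensitivity and noise level, each query
  adds at most \<open>2/9\<close> of its budget to the squared distance of two shifts.\<close>

theorem estimator_zCDP: "zCDP n (Vec d) (Mat d) \<rho> estimator"
  unfolding zCDP_def
proof (intro conjI ballI allI impI)
  show "estimator \<in> measurable (Dataset n (Vec d)) (prob_algebra (Mat d))"
    by (rule estimator_measurable)
  fix X X' :: "nat \<Rightarrow> nat \<Rightarrow> real" and t :: real
  assume adj: "adjacent n X X'" and t: "1 < t"
  define \<mu> where "\<mu> Y q w = (if w \<in> block q then clipped_cov q Y w / noise_sd q else 0)" for Y
      and q :: "nat \<times> nat \<times> nat" and w :: "nat \<times> nat"
  let ?g = "\<lambda>z. assemble (\<lambda>q\<in>queries. noisy q (\<lambda>_. 0) (z q))"
  have g: "?g \<in> measurable (Pi\<^sub>M queries (\<lambda>_. Gauss upper)) (Mat d)"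
    by (intro measurable_compose[OF _ assemble_measurable] measurable_restrict) measurable
  have est: "estimator Y = distr (Pi\<^sub>M queries (\<lambda>_. Gauss upper)) (Mat d) (\<lambda>z. ?g (\<lambda>q\<in>queries.
      \<lambda>w\<in>upper. z q w + \<mu> Y q w))" for Y
  proof -
    have "noisy q (clipped_cov q Y) z = noisy q (\<lambda>_. 0) (\<lambda>w\<in>upper. z w
        + \<mu> Y q w)" if q: "q \<in> queries" for q and z :: mat
    proof
      fix p :: "nat \<times> nat"
      obtain a b where [simp]: "p = (a, b)" by (cases p)
      show "noisy q (clipped_cov q Y) z p = noisy q (\<lambda>_. 0) (\<lambda>w\<in>upper. z w + \<mu> Y q w) p"
        using clipped_cov_minmax(1)[OF q, of a b Y] clipped_cov_minmax(2)[OF q, of a b] noise_sd_pos[OF q] minmax_upper[of a b]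
        by (auto simp: noisy_def mat_on_def \<mu>_def restrict_def field_simps)
    qed
    then have "(\<lambda>q\<in>queries. noisy q (clipped_cov q Y) (z q))
        = (\<lambda>q\<in>queries. noisy q (\<lambda>_. 0) ((\<lambda>q\<in>queries. \<lambda>w\<in>upper. z q w + \<mu> Y q w) q))" for z
      by (intro restrict_ext) simp
    then show ?thesis unfolding estimator_eq noise_def by simp
  qed
  have q_le: "(\<Sum>w\<in>upper. (\<mu> X q w - \<mu> X' q w)\<^sup>2) \<le> 2 / 9 * budget (fst q)" if q: "q \<in> queries" for q
  proof -
    obtain m l r where [simp]: "q = (m, l, r)" by (cases q)
    have bp: "0 < budget m" using budget_pos queries_props[of m l r] q by auto
    have "(\<Sum>w\<in>upper. (\<mu> X q w - \<mu> X' q w)\<^sup>2)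
        \<le> (\<Sum>w\<in>upper \<union> block q. (\<mu> X q w - \<mu> X' q w)\<^sup>2)"
      using finite_upper finite_block by (intro sum_mono2) auto
    also have "\<dots> = (\<Sum>w\<in>block q. (\<mu> X q w - \<mu> X' q w)\<^sup>2)"
      using finite_upper finite_block by (intro sum.mono_neutral_right) (auto simp: \<mu>_def)
    also have "\<dots> = (\<Sum>w\<in>block q. (clipped_cov q X w - clipped_cov q X' w)\<^sup>2) / (noise_sd q)\<^sup>2"
      unfolding sum_divide_distrib by (intro sum.cong refl) (auto simp: \<mu>_def power_divide diff_divide_distrib[symmetric])
    also have "\<dots> \<le> (4 * radius m ^ 4 / (real n)\<^sup>2) / (noise_sd q)\<^sup>2"
      using clipped_cov_sensitivity[OF adj, of m l r] by (intro divide_right_mono) auto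
    also have "(noise_sd q)\<^sup>2 = 18 * radius m ^ 4 / (budget m * (real n)\<^sup>2)"
      using bp radius_pos[of m] by (simp add: noise_sd_def)
    also have "(4 * radius m ^ 4 / (real n)\<^sup>2) / \<dots> = 2 / 9 * budget (fst q)"
      using bp radius_pos[of m] n_pos by (simp add: field_simps)
    finally show ?thesis .
  qed
  have "(\<Sum>q\<in>queries. \<Sum>w\<in>upper. (\<mu> X q w - \<mu> X' q w)\<^sup>2) \<le> (\<Sum>q\<in>queries. 2 / 9 * budget (fst q))"
    by (intro sum_mono q_le)
  also have "\<dots> = 2 / 9 * (\<Sum>q\<in>queries. budget (fst q))" by (rule sum_distrib_left[symmetric])
  also have "\<dots> \<le> 2 / 9 * \<rho>" using sum_budget_le by simp
  also have "\<dots> \<le> 2 * \<rho>" using rho_pos by simp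
  finally have sum_le: "(\<Sum>q\<in>queries. \<Sum>w\<in>upper. (\<mu> X q w - \<mu> X' q w)\<^sup>2) \<le> 2 * \<rho>" .
  have "renyi_divergence t (estimator X) (estimator X')
      \<le> ereal (t * (\<Sum>q\<in>queries. \<Sum>w\<in>upper. (\<mu> X q w - \<mu> X' q w)\<^sup>2) / 2)"
    unfolding est[of X] est[of X'] by (rule renyi_divergence_Gauss_shift_le[OF finite_queries finite_upper t g])
  also have "\<dots> \<le> ereal (\<rho> * t)"
    using mult_left_mono[OF sum_le, of t] t by (simp add: mult.commute)
  finally show "renyi_divergence t (estimator X) (estimator X') \<le> ereal (\<rho> * t)" .
qed

end

section \<open>The statistical model\<close>

abbreviation to_upper :: "nat \<times> nat \<Rightarrow> nat \<times> nat" where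
  "to_upper p \<equiv> (min (fst p) (snd p), max (fst p) (snd p))"

lemma Gauss_coord_sq: assumes "finite V" "w \<in> V"
  shows "(\<integral>\<^sup>+ z. ennreal ((z w)\<^sup>2) \<partial>Gauss V) = 1"
proof -
  define c where "c v = (if v = w then 1 else 0 :: real)" for v
  have 1: "(\<Sum>v\<in>V. c v * z v) = z w" for z
  proof -
    have "(\<Sum>v\<in>V. c v * z v) = (\<Sum>v\<in>V. if v = w then z w else 0)" by (intro sum.cong) (auto simp: c_def)
    then show ?thesis using assms by simp
  qed
  have "(\<Sum>v\<in>V. (c v)\<^sup>2) = (\<Sum>v\<in>V. if v = w then 1 else 0)" by (intro sum.cong) (auto simp: c_def)
  then have 2: "(\<Sum>v\<in>V. (c v)\<^sup>2) = 1" using assms by simp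
  show ?thesis using nn_integral_Gauss_linear_power[OF assms(1), of c 1] unfolding 1 2 by simp
qed

text \<open>The parameter \<open>A\<close> is the exponential rate, per coordinate of a block, at which the clipping bias
  decays; it is governed by the clipping constant \<open>C\<close>. The last two conditions put the threshold far
  above the typical sampling error and the typical noise.\<close>

locale estimator_model = admissible_estimator +
  fixes K M0 M \<alpha> A :: real and P :: "(nat \<Rightarrow> real) measure" and \<Sigma> :: mat
  assumes K_pos: "0 < K" and M_pos: "0 < M" and alpha_pos: "0 < \<alpha>" and c0_le_1: "c0 \<le> 1" and A_ge: "2 \<le> A"
    and data: "data_distribution d K \<Sigma> P" and cls: "\<Sigma> \<in> cov_class d \<alpha> M0 M"
    and C_large: "sqrt 2 * exp (- C / (4 * (2 * K)\<^sup>2)) \<le> exp (- A)"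
    and L1_large: "exp 5 * (36 * 10368 * (2 * K) ^ 4) \<le> L1" "exp 5 * (36 * 144 * C\<^sup>2) \<le> L1"
begin

definition \<kappa> where "\<kappa> = 2 * K"
definition padded :: "nat \<Rightarrow> (nat \<Rightarrow> real) \<Rightarrow> real" where "padded a x
    = (if a \<in> {1..d} then x a else 0)"
definition \<Sigma>' :: mat where "\<Sigma>' p = (if p \<in> {1..d} \<times> {1..d} then \<Sigma> p else 0)"

lemma kappa_pos: "0 < \<kappa>" using K_pos by (simp add: \<kappa>_def)

lemma pad_eq: "pad X i = (\<lambda>a. padded a (X i))" by (auto simp: pad_def padded_def)

lemma prob_P: "prob_space P" and sets_P: "sets P = sets (Vec d)"
  using data by (auto simp: data_distribution_def)

lemma padded_measurable: "padded a \<in> borel_measurable P"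
proof (cases "a \<in> {1..d}")
  case True
  then have "(\<lambda>x. x a) \<in> borel_measurable (Vec d)" by (rule measurable_component_singleton)
  then show ?thesis using True unfolding padded_def[abs_def] by (simp cong: measurable_cong_sets add: sets_P)
next
  case False
  then have "padded a = (\<lambda>_. 0)" by (auto simp: padded_def)
  then show ?thesis by simp
qed

text \<open>The infimum in \<open>psi2_norm\<close> need not be attained, so twice \<open>K\<close> serves as the scale.\<close>

lemma sub_gaussian_padded:
  assumes V: "finite V"
  shows "sub_gaussian P \<kappa> V padded"
  unfolding sub_gaussian_def
proof (intro conjI ballI allI impI padded_measurable)
  fix u :: "nat \<Rightarrow> real" assume u: "(\<Sum>a\<in>V. (u a)\<^sup>2) \<le> 1"
  interpret prob_space P by (rule prob_P)
  define v where "v a = (if a \<in> V then u a else 0)" for a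
  have lin: "(\<Sum>a\<in>V. u a * padded a x) = (\<Sum>a=1..d. v a * x a)" for x
  proof -
    have "(\<Sum>a\<in>V. u a * padded a x) = (\<Sum>a\<in>V \<inter> {1..d}. u a * x a)"
      using V by (intro sum.mono_neutral_cong_right) (auto simp: padded_def)
    also have "\<dots> = (\<Sum>a=1..d. v a * x a)"
      by (intro sum.mono_neutral_cong_left) (auto simp: v_def)
    finally show ?thesis .
  qed
  let ?s = "\<Sum>a=1..d. (v a)\<^sup>2"
  have "?s = (\<Sum>a\<in>V \<inter> {1..d}. (u a)\<^sup>2)"
    by (intro sum.mono_neutral_cong_right) (auto simp: v_def)
  also have "\<dots> \<le> (\<Sum>a\<in>V. (u a)\<^sup>2)" using V by (intro sum_mono2) auto
  finally have s1: "?s \<le> 1" using u by simp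
  show "(\<integral>\<^sup>+ x. ennreal (exp ((\<Sum>a\<in>V. u a * padded a x)\<^sup>2 / \<kappa>\<^sup>2)) \<partial>P) \<le> 2"
  proof (cases "?s = 0")
    case True
    then have "\<And>a. a \<in> {1..d} \<Longrightarrow> v a = 0" by (simp add: sum_nonneg_eq_0_iff)
    then have "(\<Sum>a=1..d. v a * x a) = 0" for x by (intro sum.neutral) auto
    then show ?thesis unfolding lin by (simp add: emeasure_space_1)
  next
    case False
    then have s: "0 < ?s" by (simp add: less_le sum_nonneg)
    define w where "w a = v a / sqrt ?s" for a
    have w: "L2_set w {1..d} = 1"
      using s by (simp add: L2_set_def w_def power_divide sum_divide_distrib[symmetric])
    let ?T = "{t :: real. 0 < t \<and> (\<integral>\<^sup>+ x. ennreal (exp ((\<Sum>a=1..d. w a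
        * x a)\<^sup>2 / t\<^sup>2)) \<partial>P) \<le> 2}"
    have "(INF t \<in> ?T. ennreal t) \<le> psi2_norm d P"
      unfolding psi2_norm_def using w by (intro SUP_upper) simp
    also have "\<dots> \<le> ennreal K" using data by (simp add: data_distribution_def)
    also have "\<dots> < ennreal \<kappa>" using K_pos by (simp add: \<kappa>_def ennreal_less_iff)
    finally obtain t where t: "t \<in> ?T" "ennreal t < ennreal \<kappa>" unfolding INF_less_iff by auto
    then have t': "0 < t" "t \<le> \<kappa>" by (auto simp: ennreal_less_iff)
    have "(\<Sum>a=1..d. v a * x a)\<^sup>2 / \<kappa>\<^sup>2 \<le> (\<Sum>a=1..d. w a * x a)\<^sup>2 / t\<^sup>2" for x
    proof -
      have "(\<Sum>a=1..d. v a * x a)\<^sup>2 = ?s * (\<Sum>a=1..d. w a * x a)\<^sup>2"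
        using s by (simp add: w_def sum_divide_distrib[symmetric] power_divide)
      also have "\<dots> \<le> (\<Sum>a=1..d. w a * x a)\<^sup>2"
          using s1 by (simp add: mult_right_le_one_le sum_nonneg mult_left_le_one_le)
      finally show ?thesis using t' by (intro frac_le) (auto intro: power_mono)
    qed
    then have "(\<integral>\<^sup>+ x. ennreal (exp ((\<Sum>a=1..d. v a * x a)\<^sup>2 / \<kappa>\<^sup>2)) \<partial>P)
        \<le> (\<integral>\<^sup>+ x. ennreal (exp ((\<Sum>a=1..d. w a * x a)\<^sup>2 / t\<^sup>2)) \<partial>P)"
      by (intro nn_integral_mono ennreal_leI) simp
    also have "\<dots> \<le> 2" using t by simp
    finally show ?thesis unfolding lin .
  qed
qed

lemma integral_padded: "(\<integral>x. padded a x * padded b x \<partial>P) = \<Sigma>' (a, b)"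
proof (cases "a \<in> {1..d} \<and> b \<in> {1..d}")
  case True
  then have "mean P a = 0" "mean P b = 0" "covariance P (a, b) = \<Sigma> (a, b)"
    using data by (auto simp: data_distribution_def)
  then show ?thesis using True by (simp add: covariance_def padded_def \<Sigma>'_def)
qed (auto simp: padded_def \<Sigma>'_def)

lemma Sigma_decay: assumes "a < b" shows "\<bar>\<Sigma>' (a, b)\<bar> \<le> M * (real b - real a) powr (- (\<alpha> + 1))"
proof (cases "(a, b) \<in> {1..d} \<times> {1..d}")
  case True
  have *: "\<forall>i\<in>{1..d}. \<forall>j\<in>{1..d}. i \<noteq> j \<longrightarrow> \<bar>\<Sigma> (i, j)\<bar>
      \<le> M * \<bar>real i - real j\<bar> powr (- (\<alpha> + 1))"
    using cls unfolding cov_class_def by (elim CollectE conjE)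
  have **: "\<forall>j\<in>{1..d}. a \<noteq> j \<longrightarrow> \<bar>\<Sigma> (a, j)\<bar>
      \<le> M * \<bar>real a - real j\<bar> powr (- (\<alpha> + 1))"
    by (rule bspec[OF *]) (use True in simp)
  have "a \<noteq> b \<longrightarrow> \<bar>\<Sigma> (a, b)\<bar> \<le> M * \<bar>real a - real b\<bar> powr (- (\<alpha> + 1))"
    by (rule bspec[OF **]) (use True in simp)
  then have "\<bar>\<Sigma> (a, b)\<bar> \<le> M * \<bar>real a - real b\<bar> powr (- (\<alpha> + 1))" using assms by simp
  moreover have "\<bar>real a - real b\<bar> = real b - real a" using assms by simp
  ultimately show ?thesis using True by (simp add: \<Sigma>'_def)
qed (use M_pos in \<open>auto simp: \<Sigma>'_def\<close>)

definition clipped_mean :: "nat \<times> nat \<times> nat \<Rightarrow> mat" where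
  "clipped_mean = (\<lambda>(m, l, r) (a, b). \<integral>x. clip (radius m) (I m l) (\<lambda>a. padded a x) a
      * clip (radius m) (I m (l + r)) (\<lambda>a. padded a x) b \<partial>P)"

definition sampling_dev :: "nat \<times> nat \<times> nat \<Rightarrow> (nat \<Rightarrow> nat \<Rightarrow> real) \<Rightarrow> real" where
  "sampling_dev q X = (\<Sum>p\<in>block q. (clipped_cov q X p - clipped_mean q p)\<^sup>2)"

definition noise_dev :: "nat \<times> nat \<times> nat \<Rightarrow> mat \<Rightarrow> real" where
  "noise_dev q z = (noise_sd q)\<^sup>2 * (\<Sum>p\<in>region q. (z (to_upper p))\<^sup>2)"

abbreviation sample :: "(nat \<Rightarrow> nat \<Rightarrow> real) measure" where "sample \<equiv> Pi\<^sub>M {1..n} (\<lambda>_. P)"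

lemma prob_sample: "prob_space sample" by (intro prob_space_PiM prob_P)

lemma k_le_n: assumes "m \<le> max_level" shows "k m \<le> n"
proof -
  have "real (k m) \<le> real (k max_level)" using k_mono[OF assms] by simp
  also have "\<dots> \<le> c0 * real n" by (rule k_max_level_le)
  also have "\<dots> \<le> real n" using mult_right_mono[OF c0_le_1, of "real n"] by simp
  finally show ?thesis by simp
qed

lemma sampling_dev_nonneg: "0 \<le> sampling_dev q X" by (simp add: sampling_dev_def sum_nonneg)
lemma noise_dev_nonneg: "0 \<le> noise_dev q z" by (simp add: noise_dev_def sum_nonneg)

lemma sampling_dev_measurable: "sampling_dev q \<in> borel_measurable sample"
proof -
  obtain m l r where q: "q = (m, l, r)" by (cases q)
  note [measurable] = padded_measurable
  show ?thesis unfolding sampling_dev_def[abs_def] q clipped_cov_def block_def split_def pad_eq clip_def L2_set_def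
    by measurable
qed

lemma sampling_dev_moment:
  assumes q: "(m, l, r) \<in> queries"
  shows "(\<integral>\<^sup>+ X. ennreal (sampling_dev (m, l, r) X ^ k m) \<partial>sample)
      \<le> ennreal ((10368 * \<kappa> ^ 4 * (real (k m))\<^sup>2 / real n) ^ k m)"
proof -
  note qp = queries_props[OF q]
  let ?I = "I m l" and ?J = "I m (l + r)"
  have fin: "finite ?I" "card ?I = k m" "finite ?J" "card ?J = k m"
    using qp by (auto intro: I_finite card_I)
  have sg: "sub_gaussian P \<kappa> ?I (\<lambda>a x. clip (radius m) ?I (\<lambda>a. padded a x) a)" "sub_gaussian P \<kappa> ?J
      (\<lambda>a x. clip (radius m) ?J (\<lambda>a. padded a x) a)"
    using fin radius_pos[of m] by (auto intro!: sub_gaussian_clip sub_gaussian_padded)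
  have "sampling_dev (m, l, r) X = (\<Sum>a\<in>?I. \<Sum>b\<in>?J. ((1 / real n)
      * (\<Sum>i=1..n. clip (radius m) ?I (\<lambda>a. padded a (X i)) a * clip (radius m) ?J (\<lambda>a. padded a (X i)) b)
       - (\<integral>x. clip (radius m) ?I (\<lambda>a. padded a x) a
           * clip (radius m) ?J (\<lambda>a. padded a x) b \<partial>P))\<^sup>2)" for X
    by (simp add: sampling_dev_def block_def clipped_cov_def clipped_mean_def pad_eq sum.cartesian_product split_def)
  then show ?thesis
    using sample_cov_frob_moment[OF prob_P kappa_pos sg fin, of n] k_pos[of m] k_le_n[of m] qp by simp
qed

lemma bias_bound:
  assumes q: "(m, l, r) \<in> queries" and p: "(a, b) \<in> block (m, l, r)"
  shows "\<bar>clipped_mean (m, l, r) (a, b) - \<Sigma>' (a, b)\<bar> \<le> 8 * \<kappa>\<^sup>2 * exp (- A * real (k m))"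
proof -
  note qp = queries_props[OF q]
  let ?I = "I m l" and ?J = "I m (l + r)"
  have ab: "a \<in> ?I" "b \<in> ?J" using p by (auto simp: block_def)
  have fin: "finite ?I" "card ?I = k m" "finite ?J" "card ?J = k m"
    using qp by (auto intro: I_finite card_I)
  have "\<bar>clipped_mean (m, l, r) (a, b) - \<Sigma>' (a, b)\<bar>
      \<le> 8 * \<kappa>\<^sup>2 * sqrt 2 ^ k m * exp (- (radius m)\<^sup>2 / (4 * \<kappa>\<^sup>2))"
    using clip_product_bias[OF prob_P kappa_pos _ sub_gaussian_padded[OF fin(1)] sub_gaussian_padded[OF fin(3)] fin(1,2) ab(1)
        fin(3,4) ab(2), of "radius m"]
      radius_pos[of m] by (simp add: clipped_mean_def integral_padded)
  also have "exp (- (radius m)\<^sup>2 / (4 * \<kappa>\<^sup>2)) = exp (- C / (4 * \<kappa>\<^sup>2)) ^ k m"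
    using C_pos k_pos[of m] by (simp add: radius_def exp_of_nat_mult[symmetric] mult_ac)
  also have "8 * \<kappa>\<^sup>2 * sqrt 2 ^ k m * exp (- C / (4 * \<kappa>\<^sup>2)) ^ k m
      = 8 * \<kappa>\<^sup>2 * (sqrt 2 * exp (- C / (4 * \<kappa>\<^sup>2))) ^ k m"
    by (simp only: power_mult_distrib mult.assoc)
  also have "\<dots> \<le> 8 * \<kappa>\<^sup>2 * exp (- A) ^ k m"
    using C_large by (intro mult_left_mono power_mono) (auto simp: \<kappa>_def)
  also have "exp (- A) ^ k m = exp (- A * real (k m))" by (simp add: exp_of_nat_mult[symmetric] mult.commute)
  finally show ?thesis .
qed

lemma card_block: "(m, l, r) \<in> queries \<Longrightarrow> card (block (m, l, r)) = (k m)\<^sup>2"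
  using queries_props[of m l r] by (simp add: block_def card_cartesian_product card_I power2_eq_square)

lemma region_subset_block: "q \<in> queries \<Longrightarrow> region q \<subseteq> block q"
  using region_subset_B by (cases q) (auto simp: block_def)

lemma card_region_le: "(m, l, r) \<in> queries \<Longrightarrow> card (region (m, l, r)) \<le> (k m)\<^sup>2"
  using card_mono[OF finite_block region_subset_block, of "(m, l, r)"] card_block[of m l r] by simp

lemma finite_region: "q \<in> queries \<Longrightarrow> finite (region q)"
  using finite_subset[OF region_subset_block finite_block] .

definition bias_sq :: "nat \<Rightarrow> real" where "bias_sq m = 64 * \<kappa> ^ 4 * (real (k m))\<^sup>2 * exp (- 2 * A * real (k m))"

lemma bias_sq_bound:
  assumes q: "(m, l, r) \<in> queries"
  shows "(\<Sum>p\<in>region (m, l, r). (clipped_mean (m, l, r) p - \<Sigma>' p)\<^sup>2) \<le> bias_sq m"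
proof -
  have "(\<Sum>p\<in>region (m, l, r). (clipped_mean (m, l, r) p - \<Sigma>' p)\<^sup>2)
      \<le> (\<Sum>p\<in>block (m, l, r). (clipped_mean (m, l, r) p - \<Sigma>' p)\<^sup>2)"
    using region_subset_block[OF q] finite_block by (intro sum_mono2) auto
  also have "\<dots> \<le> (\<Sum>p\<in>block (m, l, r). (8 * \<kappa>\<^sup>2 * exp (- A * real (k m)))\<^sup>2)"
  proof (intro sum_mono)
    fix p assume p: "p \<in> block (m, l, r)"
    obtain a b where ab: "p = (a, b)" by (cases p)
    show "(clipped_mean (m, l, r) p - \<Sigma>' p)\<^sup>2 \<le> (8 * \<kappa>\<^sup>2 * exp (- A * real (k m)))\<^sup>2"
      using power_mono[OF bias_bound[OF q p[unfolded ab]], of 2] by (simp add: ab)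
  qed
  also have "\<dots> = bias_sq m"
    using card_block[OF q] by (simp add: bias_sq_def power_mult_distrib exp_double[symmetric] mult_ac flip: power_mult)
  finally show ?thesis .
qed

lemma region_error_le:
  assumes q: "q \<in> queries"
  shows "(\<Sum>p\<in>region q. (noisy q (clipped_cov q X) z p - \<Sigma>' p)\<^sup>2)
      \<le> 3 * sampling_dev q X + 3 * bias_sq (fst q) + 3 * noise_dev q z"
proof -
  obtain m l r where mlr: "q = (m, l, r)" by (cases q)
  have "(\<Sum>p\<in>region q. (noisy q (clipped_cov q X) z p - \<Sigma>' p)\<^sup>2)
     \<le> (\<Sum>p\<in>region q. 3 * (clipped_cov q X p - clipped_mean q p)\<^sup>2
         + 3 * (clipped_mean q p - \<Sigma>' p)\<^sup>2 + 3 * ((noise_sd q)\<^sup>2 * (z (to_upper p))\<^sup>2))"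
  proof (intro sum_mono)
    fix p assume "p \<in> region q"
    then have "p \<in> block q" "p \<in> {1..D} \<times> {1..D}" using region_subset_block[OF q] block_subset[OF q] by auto
    then have eq: "noisy q (clipped_cov q X) z p = clipped_cov q X p + noise_sd q * z (to_upper p)"
      by (auto simp: noisy_def mat_on_def)
    have sq: "(x + y + w)\<^sup>2 \<le> 3 * x\<^sup>2 + 3 * y\<^sup>2 + 3 * w\<^sup>2" for x y w :: real
      using sum_squares_bound[of x y] sum_squares_bound[of x w] sum_squares_bound[of y w] by (simp add: power2_eq_square algebra_simps)
    show "(noisy q (clipped_cov q X) z p - \<Sigma>' p)\<^sup>2
        \<le> 3 * (clipped_cov q X p - clipped_mean q p)\<^sup>2 + 3 * (clipped_mean q p - \<Sigma>' p)\<^sup>2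
        + 3 * ((noise_sd q)\<^sup>2 * (z (to_upper p))\<^sup>2)"
    proof -
      have "noisy q (clipped_cov q X) z p - \<Sigma>' p = (clipped_cov q X p - clipped_mean q p)
          + (clipped_mean q p - \<Sigma>' p) + noise_sd q * z (to_upper p)"
        unfolding eq by simp
      then show ?thesis
        using sq[of "clipped_cov q X p - clipped_mean q p" "clipped_mean q p - \<Sigma>' p" "noise_sd q * z (to_upper p)"]
        by (simp only: power_mult_distrib)
    qed
  qed
  also have "\<dots> = 3 * (\<Sum>p\<in>region q. (clipped_cov q X p - clipped_mean q p)\<^sup>2)
      + 3 * (\<Sum>p\<in>region q. (clipped_mean q p - \<Sigma>' p)\<^sup>2) + 3 * noise_dev q z"
    by (simp add: sum.distrib sum_distrib_left noise_dev_def)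
  also have "\<dots> \<le> 3 * sampling_dev q X + 3 * bias_sq (fst q) + 3 * noise_dev q z"
    using bias_sq_bound[of m l r] q region_subset_block[OF q] finite_block
    by (intro add_mono mult_left_mono) (auto simp: mlr sampling_dev_def intro!: sum_mono2)
  finally show ?thesis .
qed

text \<open>Indices in a region of level \<open>m \<ge> 1\<close> differ by more than half the block size.\<close>

lemma region_signal_le:
  assumes q: "(m, l, r) \<in> queries" and m: "m \<noteq> 0"
  shows "(\<Sum>p\<in>region (m, l, r). (\<Sigma>' p)\<^sup>2)
      \<le> (real (k m))\<^sup>2 * (M\<^sup>2 * (real (k m) / 2) powr (- 2 * (\<alpha> + 1)))"
proof -
  let ?b = "M\<^sup>2 * (real (k m) / 2) powr (- 2 * (\<alpha> + 1))"
  have "(\<Sigma>' p)\<^sup>2 \<le> ?b" if p: "p \<in> region (m, l, r)" for p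
  proof -
    obtain a b where ab: "p = (a, b)" by (cases p)
    have far: "2 * a + k m < 2 * b" using region_far[OF q m] p ab by simp
    then have "\<bar>\<Sigma>' p\<bar> \<le> M * (real b - real a) powr (- (\<alpha> + 1))" unfolding ab by (intro Sigma_decay) simp
    also have "\<dots> \<le> M * (real (k m) / 2) powr (- (\<alpha> + 1))"
      using far alpha_pos k_pos[of m] M_pos by (intro mult_left_mono powr_mono2') auto
    finally have "(\<Sigma>' p)\<^sup>2 \<le> (M * (real (k m) / 2) powr (- (\<alpha> + 1)))\<^sup>2"
      using power_mono[of "\<bar>\<Sigma>' p\<bar>" _ 2] by simp
    also have "\<dots> = ?b" by (simp add: power_mult_distrib power2_eq_square[of "_ powr _"] flip: powr_add)
    finally show ?thesis .
  qed
  then have "(\<Sum>p\<in>region (m, l, r). (\<Sigma>' p)\<^sup>2) \<le> (\<Sum>p\<in>region (m, l, r). ?b)" by (intro sum_mono)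
  also have "\<dots> = real (card (region (m, l, r))) * ?b" by simp
  also have "\<dots> \<le> real ((k m)\<^sup>2) * ?b"
    using card_region_le[OF q] by (intro mult_right_mono) (auto simp del: of_nat_power)
  finally show ?thesis by simp
qed

end

section \<open>Expected error of one query\<close>

context estimator_model
begin

definition keep_above :: "real \<Rightarrow> real \<Rightarrow> real" where "keep_above T x = (if T < x then x else 0)"

definition sampling_cut :: "nat \<Rightarrow> real" where "sampling_cut m = L1 * (real (k m))\<^sup>2 / (36 * real n)"
definition noise_cut :: "nat \<Rightarrow> real" where "noise_cut m = L1 * real (k m) ^ 4 / (36 * budget m * (real n)\<^sup>2)"
definition signal_bound :: "nat \<Rightarrow> real" where
  "signal_bound m = (real (k m))\<^sup>2 * (M\<^sup>2 * (real (k m) / 2) powr (- 2 * (\<alpha> + 1)))"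

definition fixed_error :: "nat \<Rightarrow> real" where
  "fixed_error m = (if m = 0 then 3 * bias_sq 0 else 10 * min (signal_bound m) (real (k m) * tau_sq m))"
definition sampling_error :: "nat \<times> nat \<times> nat \<Rightarrow> (nat \<Rightarrow> nat \<Rightarrow> real)
    \<Rightarrow> real" where
  "sampling_error q X = (if fst q = 0 then 3 * sampling_dev q X else 90 * keep_above (sampling_cut (fst q)) (sampling_dev q X))"
definition noise_error :: "nat \<times> nat \<times> nat \<Rightarrow> mat \<Rightarrow> real" where
  "noise_error q z = (if fst q = 0 then 3 * noise_dev q z else 90 * keep_above (noise_cut (fst q)) (noise_dev q z))"

lemma L1_pos: "0 < L1"
proof -
  have "0 < exp 5 * (36 * 144 * C\<^sup>2)" using C_pos by simp
  then show ?thesis using L1_large(2) by linarith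
qed

lemma one_le_D: "1 \<le> real D" using D_pos by simp

lemma noise_var: "m \<le> max_level \<Longrightarrow> (noise_sd (m, l, r))\<^sup>2
    = 18 * C\<^sup>2 * (real (k m))\<^sup>2 / (budget m * (real n)\<^sup>2)"
proof -
  assume m: "m \<le> max_level"
  have "radius m ^ 4 = (C * real (k m))\<^sup>2"
    using C_pos by (simp add: radius_def power4_eq_xxxx power2_eq_square real_sqrt_mult_self mult.assoc[symmetric])
  then show ?thesis using budget_pos[OF m] by (simp add: noise_sd_def power_mult_distrib mult.assoc)
qed

text \<open>The three summands of the threshold dominate, in this order, sampling error, noise and clipping
  bias.\<close>

lemma threshold_lower:
  assumes m: "m \<le> max_level"
  shows "sampling_cut m \<le> real (k m) * tau_sq m / 36" "noise_cut m \<le> real (k m) * tau_sq m / 36"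
    "L1 * real (k m) * exp (- 2 * real (k m)) / 36 \<le> real (k m) * tau_sq m / 36" "0 \<le> tau_sq m"
proof -
  let ?k = "real (k m)"
  have kp: "0 < ?k" using k_pos[of m] by simp
  have lD: "0 \<le> ln (real D)" using one_le_D by simp
  have n: "0 < real n" using n_pos by simp
  have b: "0 < budget m" using budget_pos[OF m] .
  define u where "u = ?k / real n"
  define v where "v = ?k\<^sup>2 * ?k / (budget m * (real n)\<^sup>2)"
  define w where "w = exp (- 2 * ?k)"
  have pos: "0 \<le> u" "0 \<le> v" "0 \<le> w" using kp n b by (auto simp: u_def v_def w_def)
  have "u + v + w \<le> (?k + ln (real D)) / real n + ?k\<^sup>2 * (?k + ln (real D)) / (budget m * (real n)\<^sup>2) + exp (- 2 * ?k)"
    unfolding u_def v_def w_def using lD n b kp by (intro add_mono divide_right_mono mult_left_mono) auto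
  then have t: "L1 * (u + v + w) \<le> tau_sq m" unfolding tau_sq_def using L1_pos by (intro mult_left_mono) auto
  then have t': "?k * (L1 * (u + v + w)) / 36 \<le> ?k * tau_sq m / 36" using kp by (intro divide_right_mono mult_left_mono) auto
  have one: "?k * (L1 * x) / 36 \<le> ?k * (L1 * (u + v + w)) / 36" if "x \<le> u + v + w" for x
    using that kp L1_pos by (intro divide_right_mono mult_left_mono) auto
  have "sampling_cut m = ?k * (L1 * u) / 36" by (simp add: sampling_cut_def u_def power2_eq_square mult_ac)
  then show "sampling_cut m \<le> ?k * tau_sq m / 36" using one[of u] t' pos by linarith
  have "noise_cut m = ?k * (L1 * v) / 36" by (simp add: noise_cut_def v_def power2_eq_square power4_eq_xxxx mult_ac)
  then show "noise_cut m \<le> ?k * tau_sq m / 36" using one[of v] t' pos by linarith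
  have "L1 * ?k * exp (- 2 * ?k) / 36 = ?k * (L1 * w) / 36" by (simp add: w_def)
  then show "L1 * ?k * exp (- 2 * ?k) / 36 \<le> ?k * tau_sq m / 36" using one[of w] t' pos by linarith
  have "0 \<le> L1 * (u + v + w)" using L1_pos pos by simp
  then show "0 \<le> tau_sq m" using t by linarith
qed

lemma sampling_cut_pos: "0 < sampling_cut m" using L1_pos k_pos[of m] n_pos by (simp add: sampling_cut_def)
lemma noise_cut_pos: "m \<le> max_level \<Longrightarrow> 0 < noise_cut m"
    using L1_pos k_pos[of m] n_pos budget_pos[of m] by (simp add: noise_cut_def)

lemma bias_sq_le_threshold:
  assumes m: "m \<le> max_level" shows "bias_sq m \<le> real (k m) * tau_sq m / 36"
proof -
  let ?k = "real (k m)"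
  have kp: "1 \<le> ?k" using k_pos[of m] by simp
  have "2 * (2 * ?k) \<le> 2 * (A * ?k)" using A_ge kp by (intro mult_left_mono mult_right_mono) auto
  then have "exp (- 2 * A * ?k) \<le> exp (- 2 * ?k) * exp (- 2 * ?k)" by (simp add: exp_add[symmetric])
  then have "?k * exp (- 2 * A * ?k) \<le> ?k * (exp (- 2 * ?k) * exp (- 2 * ?k))" using kp by (intro mult_left_mono) auto
  also have "\<dots> \<le> exp (2 * ?k) * (exp (- 2 * ?k) * exp (- 2 * ?k))"
  proof (intro mult_right_mono)
    show "?k \<le> exp (2 * ?k)" using exp_ge_add_one_self[of "2 * ?k"] kp by linarith
  qed auto
  also have "\<dots> = exp (- 2 * ?k)" by (simp add: exp_add[symmetric])
  finally have "64 * \<kappa> ^ 4 * ?k * (?k * exp (- 2 * A * ?k)) \<le> 64 * \<kappa> ^ 4 * ?k * exp (- 2 * ?k)"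
    by (intro mult_left_mono) auto
  also have "\<dots> \<le> L1 / 36 * ?k * exp (- 2 * ?k)"
  proof (intro mult_right_mono)
    have "1 * (36 * 10368 * \<kappa> ^ 4) \<le> exp 5 * (36 * 10368 * \<kappa> ^ 4)" by (intro mult_right_mono) auto
    then show "64 * \<kappa> ^ 4 \<le> L1 / 36" using L1_large(1)[folded \<kappa>_def] zero_le_power[of \<kappa> 4] kappa_pos by linarith
  qed auto
  finally have "bias_sq m \<le> L1 * ?k * exp (- 2 * ?k) / 36" by (simp add: bias_sq_def power2_eq_square mult_ac)
  then show ?thesis using threshold_lower(3)[OF m] by linarith
qed

text \<open>Let \<open>T\<close> be the threshold. The bias is below \<open>T / 36\<close>, so an error above \<open>T / 4\<close> forces the sampling
  deviation or the noise above \<open>T / 36\<close>, and the larger of the two then controls the error. The bound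
  is a sum of a constant, a function of the data and a function of the noise, which are integrated
  separately.\<close>

lemma query_error_le:
  assumes q: "q \<in> queries" and Aq: "Y q = noisy q (clipped_cov q X) z"
  shows "(\<Sum>p\<in>region q. (contribution Y q p - \<Sigma>' p)\<^sup>2)
      \<le> fixed_error (fst q) + sampling_error q X + noise_error q z"
proof -
  obtain m l r where mlr: "q = (m, l, r)" by (cases q)
  have m: "m \<le> max_level" using queries_props[of m l r] q mlr by simp
  let ?E = "\<Sum>p\<in>region q. (Y q p - \<Sigma>' p)\<^sup>2"
  have E: "?E \<le> 3 * sampling_dev q X + 3 * bias_sq (fst q) + 3 * noise_dev q z"
    unfolding Aq by (rule region_error_le[OF q])
  show ?thesis
  proof (cases "m = 0")
    case True
    then have "(\<Sum>p\<in>region q. (contribution Y q p - \<Sigma>' p)\<^sup>2) = ?E"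
      by (intro sum.cong refl) (simp add: contribution_eq mlr)
    then show ?thesis using E True by (simp add: fixed_error_def sampling_error_def noise_error_def mlr)
  next
    case False
    let ?T = "real (k m) * tau_sq m"
    define sA where "sA = (\<Sum>p\<in>region q. (Y q p)\<^sup>2)"
    define sT where "sT = (\<Sum>p\<in>region q. (\<Sigma>' p)\<^sup>2)"
    have fr: "(frob D (mat_on (Y q) (region q)))\<^sup>2 = sA"
    proof -
      have "(frob D (mat_on (Y q) (region q)))\<^sup>2 = (\<Sum>p\<in>{1..D} \<times> {1..D}. (mat_on (Y q) (region q) p)\<^sup>2)"
        by (simp add: frob_def L2_set_def sum_nonneg)
      also have "\<dots> = sA" unfolding sA_def
        using region_subset[OF q] by (intro sum.mono_neutral_cong_right) (auto simp: mat_on_def)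
      finally show ?thesis .
    qed
    have err: "(\<Sum>p\<in>region q. (contribution Y q p - \<Sigma>' p)\<^sup>2) = (if ?T < sA then ?E else sT)"
      unfolding sT_def using False by (auto intro!: sum.cong simp: contribution_eq fr mlr[symmetric]) (auto simp: mlr)
    have sq: "x\<^sup>2 \<le> 2 * y\<^sup>2 + 2 * (x - y)\<^sup>2" "y\<^sup>2 \<le> 2 * x\<^sup>2 + 2 * (x - y)\<^sup>2" for x y :: real
      using zero_le_power2[of "x - 2 * y"] zero_le_power2[of "2 * x - y"] by (simp_all add: power2_eq_square algebra_simps)
    have 1: "sA \<le> 2 * sT + 2 * ?E" "sT \<le> 2 * sA + 2 * ?E"
      unfolding sA_def sT_def sum_distrib_left sum.distrib[symmetric] by (auto intro!: sum_mono sq)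
    have T0: "0 \<le> ?T" using threshold_lower(4)[OF m] by simp
    have "(if ?T < sA then ?E else sT) \<le> 10 * min sT ?T + 10 * (if ?T / 4 < ?E then ?E else 0)"
      using 1 T0 by (intro threshold_error_le) (auto simp: sA_def sT_def sum_nonneg)
    also have "min sT ?T \<le> min (signal_bound m) ?T"
      using region_signal_le[of m l r] q False unfolding sT_def mlr signal_bound_def by (auto simp: min_le_iff_disj)
    also have "(if ?T / 4 < ?E then ?E else 0) \<le> 9 * keep_above (sampling_cut m) (sampling_dev q X)
        + 9 * keep_above (noise_cut m) (noise_dev q z)"
      using E bias_sq_le_threshold[OF m] threshold_lower(1,2)[OF m] sampling_dev_nonneg[of q X] noise_dev_nonneg[of q z]
          sampling_cut_pos[of m] noise_cut_pos[OF m]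
      unfolding keep_above_def mlr by auto
    finally show ?thesis unfolding err using False by (simp add: fixed_error_def sampling_error_def noise_error_def mlr)
  qed
qed

definition sampling_cost :: "nat \<Rightarrow> real" where
  "sampling_cost m = (if m = 0 then 3 * (10368 * \<kappa> ^ 4 * (real (k 0))\<^sup>2 / real n) else 90 * (sampling_cut m
      * exp (- 5 * real (k m))))"
definition noise_cost :: "nat \<Rightarrow> real" where
  "noise_cost m = (if m = 0 then 3 * (18 * C\<^sup>2 * real (k 0) ^ 4 / (budget 0 * (real n)\<^sup>2)) else 90 * (noise_cut m
      * exp (- 5 * real (k m))))"

text \<open>Above level \<open>0\<close>, only an exponentially small part of the expectation is left beyond the cut, which is
  at least \<open>exp 5\<close> times the \<open>k\<close>-th root of the moment of order \<open>k\<close>. At level \<open>0\<close> the power mean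
  inequality suffices.\<close>

lemma sampling_error_expectation:
  assumes q: "q \<in> queries"
  shows "(\<integral>\<^sup>+ X. ennreal (sampling_error q X) \<partial>sample) \<le> ennreal (sampling_cost (fst q))"
proof -
  obtain m l r where mlr: "q = (m, l, r)" by (cases q)
  note mom = sampling_dev_moment[OF q[unfolded mlr]]
  let ?w = "10368 * \<kappa> ^ 4 * (real (k m))\<^sup>2 / real n"
  have k1: "1 \<le> k m" using k_pos[of m] by simp
  have w0: "0 \<le> ?w" by simp
  note [measurable] = sampling_dev_measurable[of q]
  show ?thesis
  proof (cases "m = 0")
    case True
    have "(\<integral>\<^sup>+ X. ennreal (sampling_dev q X) \<partial>sample) \<le> ennreal ?w"
      using power_mean_nn_integral[OF prob_sample k1 sampling_dev_measurable sampling_dev_nonneg w0 mom] by (simp add: mlr)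
    then have "ennreal 3 * (\<integral>\<^sup>+ X. ennreal (sampling_dev q X) \<partial>sample) \<le> ennreal 3 * ennreal ?w"
        by (rule mult_left_mono) simp
    also have "ennreal 3 * ennreal ?w = ennreal (3 * ?w)" using w0 by (intro ennreal_mult[symmetric]) auto
    also have "ennreal 3 * (\<integral>\<^sup>+ X. ennreal (sampling_dev q X) \<partial>sample)
        = (\<integral>\<^sup>+ X. ennreal 3 * ennreal (sampling_dev q X) \<partial>sample)"
      using sampling_dev_measurable[of q] by (intro nn_integral_cmult[symmetric]) simp
    finally show ?thesis using True sampling_dev_nonneg by (simp add: sampling_error_def sampling_cost_def mlr ennreal_mult)
  next
    case False
    let ?f = "\<lambda>X. if sampling_cut m < sampling_dev q X then sampling_dev q X else 0"
    have "(\<integral>\<^sup>+ X. ennreal (?f X) \<partial>sample) \<le> ennreal (sampling_cut m * (?w / sampling_cut m) ^ k m)"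
      unfolding mlr by (rule truncated_moment_le[OF sampling_dev_measurable sampling_dev_nonneg w0 sampling_cut_pos k1 mom])
    also have "\<dots> \<le> ennreal (sampling_cut m * exp (- 5 * real (k m)))"
    proof (intro ennreal_leI mult_left_mono)
      have "?w / sampling_cut m = 36 * 10368 * \<kappa> ^ 4 / L1" using n_pos k_pos[of m] L1_pos by (simp add: sampling_cut_def field_simps)
      also have "\<dots> \<le> exp (- 5)" using L1_large(1) L1_pos unfolding \<kappa>_def[symmetric] by (simp add: exp_minus field_simps)
      finally have "(?w / sampling_cut m) ^ k m \<le> exp (- 5) ^ k m" using w0 sampling_cut_pos[of m] by (intro power_mono) auto
      then show "(?w / sampling_cut m) ^ k m \<le> exp (- 5 * real (k m))" by (simp add: exp_of_nat_mult[symmetric] mult.commute)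
    qed (use sampling_cut_pos[of m] in auto)
    finally have "ennreal 90 * (\<integral>\<^sup>+ X. ennreal (?f X) \<partial>sample)
        \<le> ennreal 90 * ennreal (sampling_cut m * exp (- 5 * real (k m)))" by (rule mult_left_mono) simp
    also have "\<dots> = ennreal (90 * (sampling_cut m * exp (- 5 * real (k m))))"
        using sampling_cut_pos[of m] by (intro ennreal_mult[symmetric]) auto
    also have "ennreal 90 * (\<integral>\<^sup>+ X. ennreal (?f X) \<partial>sample)
        = (\<integral>\<^sup>+ X. ennreal 90 * ennreal (?f X) \<partial>sample)"
      by (intro nn_integral_cmult[symmetric]) measurable
    also have "\<dots> = (\<integral>\<^sup>+ X. ennreal (sampling_error q X) \<partial>sample)"
    proof (intro nn_integral_cong)
      fix X
      have "sampling_error q X = 90 * ?f X" using False by (simp add: sampling_error_def keep_above_def mlr)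
      then show "ennreal 90 * ennreal (?f X) = ennreal (sampling_error q X)"
        using ennreal_mult[of 90 "?f X"] sampling_dev_nonneg[of q X] by simp
    qed
    finally show ?thesis using False by (simp add: sampling_cost_def mlr)
  qed
qed

lemma region_to_upper:
  assumes q: "q \<in> queries" and m: "fst q \<noteq> 0" and p: "p \<in> region q"
  shows "(to_upper p) = p" "p \<in> upper"
proof -
  obtain m l r where mlr: "q = (m, l, r)" by (cases q)
  obtain a b where ab: "p = (a, b)" by (cases p)
  have "2 * a + k m < 2 * b" using region_far[of m l r a b] q m p by (simp add: mlr ab)
  then show "(to_upper p) = p" "p \<in> upper"
    using region_subset[OF q] p by (auto simp: ab upper_def)
qed

lemma noise_error_expectation:
  assumes q: "q \<in> queries"
  shows "(\<integral>\<^sup>+ z. ennreal (noise_error q z) \<partial>Gauss upper) \<le> ennreal (noise_cost (fst q))"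
proof -
  obtain m l r where mlr: "q = (m, l, r)" by (cases q)
  have m: "m \<le> max_level" using queries_props[of m l r] q mlr by simp
  let ?s = "18 * C\<^sup>2 * (real (k m))\<^sup>2 / (budget m * (real n)\<^sup>2)"
  have s: "(noise_sd q)\<^sup>2 = ?s" unfolding mlr by (rule noise_var[OF m])
  have s0: "0 \<le> ?s" using budget_pos[OF m] by simp
  have k1: "1 \<le> k m" using k_pos[of m] by simp
  have reg: "region q \<subseteq> {1..D} \<times> {1..D}" by (rule region_subset[OF q])
  have comp: "(\<lambda>z. z (to_upper p)) \<in> borel_measurable (Gauss upper)" if "p \<in> region q" for p
    using that reg by (intro Gauss_component minmax_upper) auto
  have Zm[measurable]: "noise_dev q \<in> borel_measurable (Gauss upper)"
    unfolding noise_dev_def[abs_def] using comp by (intro borel_measurable_times borel_measurable_const borel_measurable_sum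
        borel_measurable_power)
  show ?thesis
  proof (cases "m = 0")
    case True
    have "(\<integral>\<^sup>+ z. ennreal (noise_dev q z) \<partial>Gauss upper)
        = (\<integral>\<^sup>+ z. ennreal ?s * (\<Sum>p\<in>region q. ennreal ((z (to_upper p))\<^sup>2)) \<partial>Gauss upper)"
      unfolding noise_dev_def s using s0 by (intro nn_integral_cong) (subst ennreal_mult, auto simp: sum_nonneg sum_ennreal)
    also have "\<dots> = ennreal ?s * (\<integral>\<^sup>+ z. (\<Sum>p\<in>region q. ennreal ((z (to_upper p))\<^sup>2))
        \<partial>Gauss upper)"
      using comp by (intro nn_integral_cmult borel_measurable_sum measurable_compose[OF _ measurable_ennreal] borel_measurable_power)
    also have "(\<integral>\<^sup>+ z. (\<Sum>p\<in>region q. ennreal ((z (to_upper p))\<^sup>2)) \<partial>Gauss upper)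
        = (\<Sum>p\<in>region q. \<integral>\<^sup>+ z. ennreal ((z (to_upper p))\<^sup>2) \<partial>Gauss upper)"
      using comp by (intro nn_integral_sum measurable_compose[OF _ measurable_ennreal] borel_measurable_power)
    also have "\<dots> = (\<Sum>p\<in>region q. 1)"
      using reg by (intro sum.cong refl Gauss_coord_sq finite_upper minmax_upper) auto
    also have "\<dots> = ennreal (real (card (region q)))" by (simp add: ennreal_of_nat_eq_real_of_nat)
    also have "ennreal ?s * ennreal (real (card (region q))) = ennreal (?s * real (card (region q)))"
        using s0 by (intro ennreal_mult[symmetric]) auto
    also have "\<dots> \<le> ennreal (?s * real ((k m)\<^sup>2))"
      using card_region_le[of m l r] q s0 unfolding mlr by (intro ennreal_leI mult_left_mono) (auto simp del: of_nat_power)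
    finally have "ennreal 3 * (\<integral>\<^sup>+ z. ennreal (noise_dev q z) \<partial>Gauss upper)
        \<le> ennreal 3 * ennreal (?s * real ((k m)\<^sup>2))" by (rule mult_left_mono) simp
    also have "\<dots> = ennreal (3 * (?s * real ((k m)\<^sup>2)))" by (intro ennreal_mult[symmetric] mult_nonneg_nonneg s0) auto
    also have "3 * (?s * real ((k m)\<^sup>2)) = noise_cost (fst q)"
        using True by (simp add: noise_cost_def mlr power2_eq_square power4_eq_xxxx)
    also have "ennreal 3 * (\<integral>\<^sup>+ z. ennreal (noise_dev q z) \<partial>Gauss upper)
        = (\<integral>\<^sup>+ z. ennreal 3 * ennreal (noise_dev q z) \<partial>Gauss upper)"
      using Zm by (intro nn_integral_cmult[symmetric]) simp
    finally show ?thesis using True noise_dev_nonneg by (simp add: noise_error_def mlr ennreal_mult)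
  next
    case False
    let ?f = "\<lambda>z. if noise_cut m < noise_dev q z then noise_dev q z else 0" and ?w = "?s * (8 * (real (k m))\<^sup>2)"
    have w0: "0 \<le> ?w" by (intro mult_nonneg_nonneg s0) auto
    have Z: "noise_dev q z = ?s * (\<Sum>p\<in>region q. (z p)\<^sup>2)" for z
      unfolding noise_dev_def s using region_to_upper(1)[OF q] False by (simp add: mlr cong: sum.cong)
    have sn: "0 \<le> (\<Sum>p\<in>region q. (z p)\<^sup>2)" for z :: mat by (simp add: sum_nonneg)
    have "(\<integral>\<^sup>+ z. ennreal (noise_dev q z ^ k m) \<partial>Gauss upper)
        = (\<integral>\<^sup>+ z. ennreal (?s ^ k m) * ennreal ((\<Sum>p\<in>region q. (z p)\<^sup>2) ^ k m) \<partial>Gauss upper)"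
      unfolding Z power_mult_distrib by (intro nn_integral_cong ennreal_mult zero_le_power s0 sn)
    also have "\<dots> = ennreal (?s ^ k m) * (\<integral>\<^sup>+ z. ennreal ((\<Sum>p\<in>region q. (z p)\<^sup>2) ^ k m)
        \<partial>Gauss upper)"
      using region_to_upper(2)[OF q] False
      by (intro nn_integral_cmult measurable_compose[OF _ measurable_ennreal] borel_measurable_power borel_measurable_sum
          Gauss_component) (auto simp: mlr)
    also have "\<dots> \<le> ennreal (?s ^ k m) * ennreal ((8 * (real (k m))\<^sup>2) ^ k m)"
      using region_to_upper(2)[OF q] False card_region_le[of m l r] q
      by (intro mult_left_mono Gauss_partial_norm_power finite_upper k1) (auto simp: mlr)
    also have "\<dots> = ennreal (?w ^ k m)"
      unfolding power_mult_distrib[of ?s] using s0 by (intro ennreal_mult[symmetric]) auto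
    finally have mom: "(\<integral>\<^sup>+ z. ennreal (noise_dev q z ^ k m) \<partial>Gauss upper) \<le> ennreal (?w ^ k m)" .
    have "(\<integral>\<^sup>+ z. ennreal (?f z) \<partial>Gauss upper) \<le> ennreal (noise_cut m * (?w / noise_cut m) ^ k m)"
      by (rule truncated_moment_le[OF Zm noise_dev_nonneg w0 noise_cut_pos[OF m] k1 mom])
    also have "\<dots> \<le> ennreal (noise_cut m * exp (- 5 * real (k m)))"
    proof (intro ennreal_leI mult_left_mono)
      have "?w / noise_cut m = 36 * 144 * C\<^sup>2 / L1"
        using n_pos k_pos[of m] L1_pos budget_pos[OF m] by (simp add: noise_cut_def field_simps power2_eq_square power4_eq_xxxx)
      also have "\<dots> \<le> exp (- 5)" using L1_large(2) L1_pos by (simp add: exp_minus field_simps)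
      finally have "(?w / noise_cut m) ^ k m \<le> exp (- 5) ^ k m" by (intro power_mono divide_nonneg_pos w0 noise_cut_pos m)
      then show "(?w / noise_cut m) ^ k m \<le> exp (- 5 * real (k m))" by (simp add: exp_of_nat_mult[symmetric] mult.commute)
    qed (use noise_cut_pos[OF m] in auto)
    finally have "ennreal 90 * (\<integral>\<^sup>+ z. ennreal (?f z) \<partial>Gauss upper)
        \<le> ennreal 90 * ennreal (noise_cut m * exp (- 5 * real (k m)))" by (rule mult_left_mono) simp
    also have "\<dots> = ennreal (90 * (noise_cut m * exp (- 5 * real (k m))))"
        using noise_cut_pos[OF m] by (intro ennreal_mult[symmetric]) auto
    also have "ennreal 90 * (\<integral>\<^sup>+ z. ennreal (?f z) \<partial>Gauss upper)
        = (\<integral>\<^sup>+ z. ennreal 90 * ennreal (?f z) \<partial>Gauss upper)"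
      by (intro nn_integral_cmult[symmetric]) measurable
    also have "\<dots> = (\<integral>\<^sup>+ z. ennreal (noise_error q z) \<partial>Gauss upper)"
    proof (intro nn_integral_cong)
      fix z
      have "noise_error q z = 90 * ?f z" using False by (simp add: noise_error_def keep_above_def mlr)
      then show "ennreal 90 * ennreal (?f z) = ennreal (noise_error q z)"
        using ennreal_mult[of 90 "?f z"] noise_dev_nonneg[of q z] by simp
    qed
    finally show ?thesis using False by (simp add: noise_cost_def mlr)
  qed
qed

end

section \<open>The risk as a sum over levels\<close>

lemma sum_inverse_squares_le:
  assumes "0 < k" "k \<le> T"
  shows "(\<Sum>t\<in>{k<..T}. 1 / (real t)\<^sup>2) \<le> 1 / real k - 1 / real T"
  using assms(2)
proof (induction T rule: dec_induct)
  case (step T)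
  have "{k<..Suc T} = insert (Suc T) {k<..T}" using step by auto
  moreover have "1 / (real (Suc T))\<^sup>2 \<le> 1 / real T - 1 / real (Suc T)"
  proof -
    have T: "0 < real T" using assms step by simp
    have "1 / real T - 1 / real (Suc T) = 1 / (real T * real (Suc T))" using T by (simp add: field_simps)
    moreover have "1 / (real (Suc T))\<^sup>2 \<le> 1 / (real T * real (Suc T))"
      using T by (intro divide_left_mono) (auto simp: power2_eq_square)
    ultimately show ?thesis by simp
  qed
  ultimately show ?case using step by simp
qed simp

context estimator_model
begin

definition uncovered :: "(nat \<times> nat) set" where
  "uncovered = {(a, b). 1 \<le> a \<and> a \<le> b \<and> b \<le> d \<and> (\<forall>q\<in>queries. (a, b) \<notin> region q)}"

text \<open>The regions are disjoint, so at every pair on or above the diagonal at most one query contributes.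
  Symmetry costs the factor two.\<close>

lemma assemble_error_le:
  "(frob d (\<lambda>p. assemble Y p - \<Sigma> p))\<^sup>2
    \<le> 2 * ((\<Sum>q\<in>queries. \<Sum>p\<in>region q. (contribution Y q p - \<Sigma>' p)\<^sup>2)
        + (\<Sum>p\<in>uncovered. (\<Sigma>' p)\<^sup>2))"
proof -
  define g where "g p = ((\<Sum>q\<in>queries. contribution Y q p) - \<Sigma>' p)\<^sup>2" for p
  define T where "T = {(a, b). 1 \<le> a \<and> a \<le> b \<and> b \<le> d}"
  have T: "finite T" "T \<subseteq> {1..d} \<times> {1..d}" by (auto simp: T_def intro: finite_subset[of _ "{1..d} \<times> {1..d}"])
  let ?f = "\<lambda>p. g (to_upper p)"
  have g0: "0 \<le> g p" for p by (simp add: g_def)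
  have sym: "\<Sigma> (a, b) = \<Sigma> (b, a)" if "a \<in> {1..d}" "b \<in> {1..d}" for a b
    using cls that unfolding cov_class_def by simp
  have "(frob d (\<lambda>p. assemble Y p - \<Sigma> p))\<^sup>2
      = (\<Sum>p\<in>{1..d} \<times> {1..d}. (assemble Y p - \<Sigma> p)\<^sup>2)"
    by (simp add: frob_def L2_set_def sum_nonneg)
  also have "\<dots> = (\<Sum>p\<in>{1..d} \<times> {1..d}. ?f p)"
  proof (intro sum.cong refl)
    fix p :: "nat \<times> nat" assume p: "p \<in> {1..d} \<times> {1..d}"
    obtain a b where ab: "p = (a, b)" by (cases p)
    then show "(assemble Y p - \<Sigma> p)\<^sup>2 = ?f p"
      using p sym[of a b] by (auto simp: assemble_def g_def \<Sigma>'_def min_def max_def)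
  qed
  also have "\<dots> \<le> (\<Sum>p\<in>T \<union> prod.swap ` T. ?f p)"
    using T g0 by (intro sum_mono2) (auto simp: T_def image_iff)
  also have "\<dots> \<le> (\<Sum>p\<in>T. ?f p) + (\<Sum>p\<in>prod.swap ` T. ?f p)"
    using T g0 by (subst sum.union_inter[symmetric]) (auto intro!: sum_nonneg)
  also have "(\<Sum>p\<in>prod.swap ` T. ?f p) = (\<Sum>p\<in>T. ?f p)"
    by (subst sum.reindex) (auto simp: min.commute max.commute)
  also have "(\<Sum>p\<in>T. ?f p) = (\<Sum>p\<in>T. g p)"
    by (intro sum.cong refl) (auto simp: T_def)
  finally have 1: "(frob d (\<lambda>p. assemble Y p - \<Sigma> p))\<^sup>2 \<le> 2 * (\<Sum>p\<in>T. g p)" by simp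
  let ?c = "\<lambda>q p. (contribution Y q p - \<Sigma>' p)\<^sup>2"
  have "(\<Sum>p\<in>T. g p) \<le> (\<Sum>p\<in>T. (\<Sum>q\<in>queries. if p \<in> region q then ?c q p else 0)
      + (if p \<in> uncovered then (\<Sigma>' p)\<^sup>2 else 0))"
  proof (intro sum_mono)
    fix p assume p: "p \<in> T"
    obtain a b where ab: "p = (a, b)" by (cases p)
    have nn: "0 \<le> (\<Sum>q\<in>queries. if p \<in> region q then ?c q p else 0)" by (intro sum_nonneg) auto
    show "g p \<le> (\<Sum>q\<in>queries. if p \<in> region q then ?c q p else 0)
        + (if p \<in> uncovered then (\<Sigma>' p)\<^sup>2 else 0)"
    proof (cases "p \<in> uncovered")
      case True
      then have "(\<Sum>q\<in>queries. contribution Y q p) = 0"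
        by (intro sum.neutral) (auto simp: contribution_eq uncovered_def)
      then show ?thesis using True nn by (simp add: g_def)
    next
      case False
      then obtain q where q: "q \<in> queries" "p \<in> region q" using p by (auto simp: uncovered_def T_def ab)
      have other: "p \<notin> region q'" if "q' \<in> queries" "q' \<noteq> q" for q'
        using region_unique[of q q' a b] q that p by (auto simp: T_def ab)
      have "(\<Sum>q\<in>queries. contribution Y q p) = (\<Sum>q'\<in>{q}. contribution Y q' p)"
        using q finite_queries other by (intro sum.mono_neutral_right) (auto simp: contribution_eq)
      then have "g p = ?c q p" by (simp add: g_def)
      also have "\<dots> = (\<Sum>q'\<in>{q}. if p \<in> region q' then ?c q' p else 0)" using q by simp
      also have "\<dots> \<le> (\<Sum>q\<in>queries. if p \<in> region q then ?c q p else 0)"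
        using q finite_queries by (intro sum_mono2) auto
      finally show ?thesis using False by simp
    qed
  qed
  also have "\<dots> = (\<Sum>q\<in>queries. \<Sum>p\<in>T. if p \<in> region q then ?c q p else 0)
      + (\<Sum>p\<in>T. if p \<in> uncovered then (\<Sigma>' p)\<^sup>2 else 0)"
    unfolding sum.distrib by (subst sum.swap) simp
  also have "\<dots> \<le> (\<Sum>q\<in>queries. \<Sum>p\<in>region q. ?c q p) + (\<Sum>p\<in>uncovered. (\<Sigma>' p)\<^sup>2)"
  proof (intro add_mono sum_mono)
    fix q assume q: "q \<in> queries"
    have "(\<Sum>p\<in>T. if p \<in> region q then ?c q p else 0) = (\<Sum>p\<in>T \<inter> region q. ?c q p)"
      using T by (intro sum.mono_neutral_cong_right) auto
    also have "\<dots> \<le> (\<Sum>p\<in>region q. ?c q p)" using finite_region[OF q] by (intro sum_mono2) auto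
    finally show "(\<Sum>p\<in>T. if p \<in> region q then ?c q p else 0) \<le> (\<Sum>p\<in>region q. ?c q p)" .
  next
    have "(\<Sum>p\<in>T. if p \<in> uncovered then (\<Sigma>' p)\<^sup>2 else 0) = (\<Sum>p\<in>uncovered. (\<Sigma>' p)\<^sup>2)"
      using T by (intro sum.mono_neutral_cong_right) (auto simp: uncovered_def T_def)
    then show "(\<Sum>p\<in>T. if p \<in> uncovered then (\<Sigma>' p)\<^sup>2 else 0)
        \<le> (\<Sum>p\<in>uncovered. (\<Sigma>' p)\<^sup>2)" by simp
  qed
  finally have "(\<Sum>p\<in>T. g p) \<le> (\<Sum>q\<in>queries. \<Sum>p\<in>region q. ?c q p)
      + (\<Sum>p\<in>uncovered. (\<Sigma>' p)\<^sup>2)" .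
  then show ?thesis by (intro order_trans[OF 1] mult_left_mono) auto
qed

definition tail_signal :: real where
  "tail_signal = (if c0 * real n < 2 * real (k max_level) \<and> c0 * real n < real D
           then real d * (M\<^sup>2 * real (k max_level) powr (- (2 * \<alpha> + 1))) else 0)"

lemma tail_signal_nonneg: "0 \<le> tail_signal" by (simp add: tail_signal_def)

text \<open>Squares of the entries at distance \<open>t\<close> from the diagonal are at most
  \<open>M\<^sup>2 * t powr (- 2 * \<alpha>) / t\<^sup>2\<close>; bound the first power at the smallest distance and sum \<open>1 / t\<^sup>2\<close>.\<close>

lemma uncovered_signal_le: "(\<Sum>p\<in>uncovered. (\<Sigma>' p)\<^sup>2) \<le> tail_signal"
proof (cases "uncovered = {}")
  case True
  then show ?thesis using tail_signal_nonneg by simp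
next
  case False
  let ?k = "k max_level"
  have far: "a + ?k < b" "c0 * real n < 2 * real ?k" "c0 * real n < real D" if "(a, b) \<in> uncovered" for a b
    using uncovered_far[of a b] that d_le_D unfolding uncovered_def by auto
  then have tail_signal: "tail_signal = real d * (M\<^sup>2 * real ?k powr (- (2 * \<alpha> + 1)))"
      using False unfolding tail_signal_def by auto
  have kp: "0 < real ?k" using k_pos by simp
  have sub: "uncovered \<subseteq> (SIGMA a:{1..d}. {a + ?k<..d})" using far(1) by (auto simp: uncovered_def)
  have "(\<Sum>p\<in>uncovered. (\<Sigma>' p)\<^sup>2) \<le> (\<Sum>(a, b)\<in>(SIGMA a:{1..d}. {a + ?k<..d}). (\<Sigma>' (a, b))\<^sup>2)"
    using sub by (simp add: split_def) (intro sum_mono2, auto)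
  also have "\<dots> = (\<Sum>a=1..d. \<Sum>b\<in>{a + ?k<..d}. (\<Sigma>' (a, b))\<^sup>2)" by (subst sum.Sigma) auto
  also have "\<dots> \<le> (\<Sum>a=1..d. M\<^sup>2 * real ?k powr (- (2 * \<alpha> + 1)))"
  proof (intro sum_mono)
    fix a assume "a \<in> {1..d}"
    have "(\<Sum>b\<in>{a + ?k<..d}. (\<Sigma>' (a, b))\<^sup>2)
        \<le> (\<Sum>b\<in>{a + ?k<..d}. M\<^sup>2 * real ?k powr (- 2 * \<alpha>) * (1 / (real (b - a))\<^sup>2))"
    proof (intro sum_mono)
      fix b assume b: "b \<in> {a + ?k<..d}"
      let ?t = "real b - real a"
      have t: "real ?k < ?t" using b by auto
      have "\<bar>\<Sigma>' (a, b)\<bar> \<le> M * ?t powr (- (\<alpha> + 1))" using b by (intro Sigma_decay) auto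
      then have "(\<Sigma>' (a, b))\<^sup>2 \<le> (M * ?t powr (- (\<alpha> + 1)))\<^sup>2"
        using power_mono[of "\<bar>\<Sigma>' (a, b)\<bar>" _ 2] by simp
      also have "\<dots> = M\<^sup>2 * (?t powr (- 2 * \<alpha>) * ?t powr (- 2))"
        by (simp add: power_mult_distrib power2_eq_square[of "_ powr _"] flip: powr_add)
      also have "?t powr (- 2) = 1 / ?t\<^sup>2" using t kp by (simp add: powr_minus_divide powr_numeral)
      also have "M\<^sup>2 * (?t powr (- 2 * \<alpha>) * (1 / ?t\<^sup>2))
          \<le> M\<^sup>2 * (real ?k powr (- 2 * \<alpha>) * (1 / ?t\<^sup>2))"
        using t kp alpha_pos by (intro mult_left_mono mult_right_mono powr_mono2') auto
      also have "?t = real (b - a)" using b by auto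
      finally show "(\<Sigma>' (a, b))\<^sup>2 \<le> M\<^sup>2 * real ?k powr (- 2 * \<alpha>)
          * (1 / (real (b - a))\<^sup>2)" by (simp add: mult.assoc)
    qed
    also have "\<dots> = M\<^sup>2 * real ?k powr (- 2 * \<alpha>) * (\<Sum>b\<in>{a + ?k<..d}. 1 / (real (b - a))\<^sup>2)"
      by (simp add: sum_distrib_left)
    also have "(\<Sum>b\<in>{a + ?k<..d}. 1 / (real (b - a))\<^sup>2) \<le> 1 / real ?k"
    proof (cases "a + ?k < d")
      case False
      then show ?thesis by simp
    next
      case True
      have "(\<Sum>b\<in>{a + ?k<..d}. 1 / (real (b - a))\<^sup>2) = (\<Sum>t\<in>{?k<..d - a}. 1 / (real t)\<^sup>2)"
        by (intro sum.reindex_bij_witness[of _ "\<lambda>t. t + a" "\<lambda>b. b - a"]) auto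
      also have "\<dots> \<le> 1 / real ?k - 1 / real (d - a)" using True k_pos by (intro sum_inverse_squares_le) auto
      also have "\<dots> \<le> 1 / real ?k" by simp
      finally show ?thesis .
    qed
    also have "M\<^sup>2 * real ?k powr (- 2 * \<alpha>) * (1 / real ?k) = M\<^sup>2 * real ?k powr (- (2 * \<alpha> + 1))"
      using kp by (simp add: powr_diff powr_minus_divide powr_add field_simps)
    finally show "(\<Sum>b\<in>{a + ?k<..d}. (\<Sigma>' (a, b))\<^sup>2) \<le> M\<^sup>2 * real ?k powr (- (2 * \<alpha> + 1))"
      by (simp add: mult_left_mono)
  qed
  also have "\<dots> = tail_signal" by (simp add: tail_signal)
  finally show ?thesis .
qed

definition cost :: "nat \<Rightarrow> real" where "cost m = fixed_error m + sampling_cost m + noise_cost m"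

lemma bias_sq_nonneg: "0 \<le> bias_sq m" by (simp add: bias_sq_def)

lemma cost_nonneg:
  assumes m: "m \<le> max_level" shows "0 \<le> fixed_error m" "0 \<le> sampling_cost m" "0 \<le> noise_cost m"
proof -
  show "0 \<le> fixed_error m" using threshold_lower(4)[OF m] bias_sq_nonneg by (auto simp: fixed_error_def signal_bound_def)
  show "0 \<le> sampling_cost m" using sampling_cut_pos[of m] by (simp add: sampling_cost_def)
  show "0 \<le> noise_cost m" using noise_cut_pos[OF m] budget_pos[of 0] by (simp add: noise_cost_def)
qed

lemma sampling_error_nonneg: "0 \<le> sampling_error q X" using sampling_dev_nonneg[of q X] by (simp add: sampling_error_def keep_above_def)
lemma noise_error_nonneg: "0 \<le> noise_error q z" using noise_dev_nonneg[of q z] by (simp add: noise_error_def keep_above_def)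

lemma sampling_error_measurable: "sampling_error q \<in> borel_measurable sample"
proof -
  note [measurable] = sampling_dev_measurable[of q]
  show ?thesis unfolding sampling_error_def[abs_def] keep_above_def by measurable
qed

lemma noise_error_measurable: assumes q: "q \<in> queries" shows "noise_error q \<in> borel_measurable (Gauss upper)"
proof -
  have "(\<lambda>z. z (to_upper p)) \<in> borel_measurable (Gauss upper)" if "p \<in> region q" for p
    using that region_subset[OF q] by (intro Gauss_component minmax_upper) auto
  then have [measurable]: "noise_dev q \<in> borel_measurable (Gauss upper)"
    unfolding noise_dev_def[abs_def] by (intro borel_measurable_times borel_measurable_const borel_measurable_sum borel_measurable_power)
  show ?thesis unfolding noise_error_def[abs_def] keep_above_def by measurable
qed

lemma noise_component:
  assumes q: "q \<in> queries" and f: "f \<in> borel_measurable (Gauss upper)"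
  shows "(\<integral>\<^sup>+ z. f (z q) \<partial>noise)
      = (\<integral>\<^sup>+ y. f y \<partial>Gauss upper)" "(\<lambda>z. f (z q)) \<in> borel_measurable noise"
proof -
  have c: "(\<lambda>z. z q) \<in> measurable noise (Gauss upper)" unfolding noise_def using q by (rule measurable_component_singleton)
  then show "(\<lambda>z. f (z q)) \<in> borel_measurable noise" using f by (rule measurable_compose)
  have "distr noise (Gauss upper) (\<lambda>z. z q) = Gauss upper"
    unfolding noise_def using q by (intro distr_PiM_component prob_space_Gauss)
  then show "(\<integral>\<^sup>+ z. f (z q) \<partial>noise) = (\<integral>\<^sup>+ y. f y \<partial>Gauss upper)"
    using nn_integral_distr[OF c, of f] f by simp
qed

lemma frob_risk_le:
  "frob_risk n d P estimator \<Sigma> \<le> ennreal (2 * ((\<Sum>q\<in>queries. cost (fst q)) + tail_signal))"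
proof -
  interpret N: prob_space noise by (rule prob_space_noise)
  interpret X: prob_space sample by (rule prob_sample)
  have cX: "(\<integral>\<^sup>+ X. a \<partial>sample) = a" for a by (simp only: nn_integral_const X.emeasure_space_1 mult_1_right)
  define eC where "eC q = ennreal (fixed_error (fst q))" for q :: "nat \<times> nat \<times> nat"
  define eW where "eW q X = ennreal (sampling_error q X)" for q X
  define eZ where "eZ q z = ennreal (noise_error q z)" for q z
  have lev: "fst q \<le> max_level" if "q \<in> queries" for q using that queries_props by (cases q) auto
  have eW[measurable]: "eW q \<in> borel_measurable sample" for q
    unfolding eW_def[abs_def] using sampling_error_measurable by (rule measurable_compose) simp
  have eZ: "eZ q \<in> borel_measurable (Gauss upper)" if "q \<in> queries" for q
    unfolding eZ_def[abs_def] using noise_error_measurable[OF that] by (rule measurable_compose) simp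
  have fm: "(\<lambda>E. ennreal ((frob d (\<lambda>p. E p - \<Sigma> p))\<^sup>2)) \<in> borel_measurable (Mat d)"
    unfolding frob_def L2_set_def
    by (intro measurable_compose[OF _ measurable_ennreal] borel_measurable_power measurable_compose[OF _ borel_measurable_sqrt]
        borel_measurable_sum
        borel_measurable_diff borel_measurable_const measurable_component_singleton)
  have am: "(\<lambda>z. assemble (\<lambda>q\<in>queries. noisy q (clipped_cov q X) (z q))) \<in> measurable noise (Mat d)" for X
    unfolding noise_def by (intro measurable_compose[OF _ assemble_measurable] measurable_restrict) measurable
  have inner: "(\<integral>\<^sup>+ E. ennreal ((frob d (\<lambda>p. E p - \<Sigma> p))\<^sup>2) \<partial>estimator X)
     \<le> 2 * ((\<Sum>q\<in>queries. eC q + eW q X + ennreal (noise_cost (fst q))) + ennreal tail_signal)" for X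
  proof -
    let ?Y = "\<lambda>z. \<lambda>q\<in>queries. noisy q (clipped_cov q X) (z q)"
    have "(\<integral>\<^sup>+ E. ennreal ((frob d (\<lambda>p. E p - \<Sigma> p))\<^sup>2) \<partial>estimator X)
       = (\<integral>\<^sup>+ z. ennreal ((frob d (\<lambda>p. assemble (?Y z) p - \<Sigma> p))\<^sup>2) \<partial>noise)"
      unfolding estimator_eq by (rule nn_integral_distr[OF am]) (use fm in simp)
    also have "\<dots> \<le> (\<integral>\<^sup>+ z. 2 * ((\<Sum>q\<in>queries. (eC q + eW q X) + eZ q (z q))
        + ennreal tail_signal) \<partial>noise)"
    proof (intro nn_integral_mono)
      fix z
      have "(frob d (\<lambda>p. assemble (?Y z) p - \<Sigma> p))\<^sup>2
          \<le> 2 * ((\<Sum>q\<in>queries. fixed_error (fst q) + sampling_error q X + noise_error q (z q)) + tail_signal)"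
        using assemble_error_le[of "?Y z"] uncovered_signal_le
          sum_mono[of queries "\<lambda>q. \<Sum>p\<in>region q. (contribution (?Y z) q p - \<Sigma>' p)\<^sup>2" "\<lambda>q.
              fixed_error (fst q) + sampling_error q X + noise_error q (z q)"]
          query_error_le[of _ "?Y z" X] by fastforce
      then have "ennreal ((frob d (\<lambda>p. assemble (?Y z) p - \<Sigma> p))\<^sup>2)
          \<le> ennreal (2 * ((\<Sum>q\<in>queries. fixed_error (fst q) + sampling_error q X + noise_error q (z q)) + tail_signal))"
        by (rule ennreal_leI)
      also have "\<dots> = ennreal 2 * ennreal ((\<Sum>q\<in>queries. fixed_error (fst q) + sampling_error q X
          + noise_error q (z q)) + tail_signal)"
        using tail_signal_nonneg cost_nonneg(1)[OF lev] sampling_error_nonneg noise_error_nonneg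
            by (intro ennreal_mult add_nonneg_nonneg sum_nonneg) auto
      also have "ennreal ((\<Sum>q\<in>queries. fixed_error (fst q) + sampling_error q X + noise_error q (z q)) + tail_signal)
          = ennreal (\<Sum>q\<in>queries. fixed_error (fst q) + sampling_error q X + noise_error q (z q)) + ennreal tail_signal"
        using tail_signal_nonneg cost_nonneg(1)[OF lev] sampling_error_nonneg noise_error_nonneg
            by (intro ennreal_plus add_nonneg_nonneg sum_nonneg) auto
      also have "ennreal (\<Sum>q\<in>queries. fixed_error (fst q) + sampling_error q X + noise_error q (z q))
          = (\<Sum>q\<in>queries. ennreal (fixed_error (fst q) + sampling_error q X + noise_error q (z q)))"
        using cost_nonneg(1)[OF lev] sampling_error_nonneg noise_error_nonneg by (intro sum_ennreal[symmetric] add_nonneg_nonneg) auto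
      also have "\<dots> = (\<Sum>q\<in>queries. (eC q + eW q X) + eZ q (z q))"
        unfolding eC_def eW_def eZ_def using cost_nonneg(1)[OF lev] sampling_error_nonneg noise_error_nonneg
        by (intro sum.cong refl) (subst ennreal_plus, auto)
      finally show "ennreal ((frob d (\<lambda>p. assemble (?Y z) p - \<Sigma> p))\<^sup>2)
          \<le> 2 * ((\<Sum>q\<in>queries. (eC q + eW q X) + eZ q (z q)) + ennreal tail_signal)" by (simp only: ennreal_numeral)
    qed
    also have "\<dots> = 2 * (\<integral>\<^sup>+ z. (\<Sum>q\<in>queries. (eC q + eW q X) + eZ q (z q))
        + ennreal tail_signal \<partial>noise)"
      using noise_component(2)[OF _ eZ] by (intro nn_integral_cmult borel_measurable_add borel_measurable_sum borel_measurable_const)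
    also have "(\<integral>\<^sup>+ z. (\<Sum>q\<in>queries. (eC q + eW q X) + eZ q (z q)) + ennreal tail_signal \<partial>noise)
        = (\<integral>\<^sup>+ z. (\<Sum>q\<in>queries. (eC q + eW q X) + eZ q (z q)) \<partial>noise)
            + (\<integral>\<^sup>+ z. ennreal tail_signal \<partial>noise)"
      using noise_component(2)[OF _ eZ] by (intro nn_integral_add borel_measurable_add borel_measurable_sum borel_measurable_const)
    also have "(\<integral>\<^sup>+ z. (\<Sum>q\<in>queries. (eC q + eW q X) + eZ q (z q)) \<partial>noise)
        = (\<Sum>q\<in>queries. \<integral>\<^sup>+ z. (eC q + eW q X) + eZ q (z q) \<partial>noise)"
      using noise_component(2)[OF _ eZ] by (intro nn_integral_sum borel_measurable_add borel_measurable_const)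
    also have "\<dots> \<le> (\<Sum>q\<in>queries. eC q + eW q X + ennreal (noise_cost (fst q)))"
    proof (intro sum_mono)
      fix q assume q: "q \<in> queries"
      have "(\<integral>\<^sup>+ z. (eC q + eW q X) + eZ q (z q) \<partial>noise)
          = (\<integral>\<^sup>+ z. (eC q + eW q X) \<partial>noise) + (\<integral>\<^sup>+ z. eZ q (z q) \<partial>noise)"
        by (intro nn_integral_add borel_measurable_const noise_component(2)[OF q eZ[OF q]])
      also have "\<dots> = (eC q + eW q X) + (\<integral>\<^sup>+ y. eZ q y \<partial>Gauss upper)"
        using noise_component(1)[OF q eZ[OF q]] by (simp add: N.emeasure_space_1)
      also have "\<dots> \<le> eC q + eW q X + ennreal (noise_cost (fst q))"
        unfolding eZ_def by (intro add_left_mono noise_error_expectation q)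
      finally show "(\<integral>\<^sup>+ z. (eC q + eW q X) + eZ q (z q) \<partial>noise)
          \<le> eC q + eW q X + ennreal (noise_cost (fst q))" .
    qed
    finally show ?thesis by (simp add: N.emeasure_space_1 mult_left_mono add_right_mono)
  qed
  have "frob_risk n d P estimator \<Sigma> \<le> (\<integral>\<^sup>+ X. 2 * ((\<Sum>q\<in>queries. eC q + eW q X
      + ennreal (noise_cost (fst q))) + ennreal tail_signal) \<partial>sample)"
    unfolding frob_risk_def by (intro nn_integral_mono inner)
  also have "\<dots> = 2 * (\<integral>\<^sup>+ X. (\<Sum>q\<in>queries. eC q + eW q X + ennreal (noise_cost (fst q)))
      + ennreal tail_signal \<partial>sample)"
    by (intro nn_integral_cmult borel_measurable_add borel_measurable_sum borel_measurable_const eW)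
  also have "(\<integral>\<^sup>+ X. (\<Sum>q\<in>queries. eC q + eW q X + ennreal (noise_cost (fst q)))
      + ennreal tail_signal \<partial>sample)
      = (\<integral>\<^sup>+ X. (\<Sum>q\<in>queries. eC q + eW q X + ennreal (noise_cost (fst q))) \<partial>sample)
          + (\<integral>\<^sup>+ X. ennreal tail_signal \<partial>sample)"
    by (intro nn_integral_add borel_measurable_add borel_measurable_sum borel_measurable_const eW)
  also have "(\<integral>\<^sup>+ X. ennreal tail_signal \<partial>sample) = ennreal tail_signal" by (rule cX)
  also have "(\<integral>\<^sup>+ X. (\<Sum>q\<in>queries. eC q + eW q X + ennreal (noise_cost (fst q))) \<partial>sample)
      = (\<Sum>q\<in>queries. \<integral>\<^sup>+ X. eC q + eW q X + ennreal (noise_cost (fst q)) \<partial>sample)"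
    by (intro nn_integral_sum borel_measurable_add borel_measurable_const eW)
  also have "\<dots> = (\<Sum>q\<in>queries. eC q + (\<integral>\<^sup>+ X. eW q X \<partial>sample) + ennreal (noise_cost (fst q)))"
  proof (intro sum.cong refl)
    fix q
    have "(\<integral>\<^sup>+ X. eC q + eW q X + ennreal (noise_cost (fst q)) \<partial>sample)
        = (\<integral>\<^sup>+ X. eC q + eW q X \<partial>sample) + (\<integral>\<^sup>+ X. ennreal (noise_cost (fst q)) \<partial>sample)"
      by (intro nn_integral_add borel_measurable_add borel_measurable_const eW)
    also have "(\<integral>\<^sup>+ X. eC q + eW q X \<partial>sample)
        = (\<integral>\<^sup>+ X. eC q \<partial>sample) + (\<integral>\<^sup>+ X. eW q X \<partial>sample)"
      by (intro nn_integral_add borel_measurable_const eW)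
    finally show "(\<integral>\<^sup>+ X. eC q + eW q X + ennreal (noise_cost (fst q)) \<partial>sample)
        = eC q + (\<integral>\<^sup>+ X. eW q X \<partial>sample) + ennreal (noise_cost (fst q))"
      by (simp only: cX)
  qed
  also have "2 * ((\<Sum>q\<in>queries. eC q + (\<integral>\<^sup>+ X. eW q X \<partial>sample) + ennreal (noise_cost (fst q)))
      + ennreal tail_signal) \<le> 2 * ((\<Sum>q\<in>queries. eC q + ennreal (sampling_cost (fst q))
      + ennreal (noise_cost (fst q))) + ennreal tail_signal)"
    unfolding eW_def by (intro mult_left_mono add_mono sum_mono sampling_error_expectation) auto
  also have "\<dots> = ennreal (2 * ((\<Sum>q\<in>queries. cost (fst q)) + tail_signal))"
  proof -
    have s: "(\<Sum>q\<in>queries. eC q + ennreal (sampling_cost (fst q)) + ennreal (noise_cost (fst q)))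
        = ennreal (\<Sum>q\<in>queries. cost (fst q))"
    proof -
      have "(\<Sum>q\<in>queries. eC q + ennreal (sampling_cost (fst q)) + ennreal (noise_cost (fst q)))
          = (\<Sum>q\<in>queries. ennreal (cost (fst q)))"
        unfolding eC_def cost_def using cost_nonneg[OF lev] by (intro sum.cong refl) (subst ennreal_plus, auto)
      also have "\<dots> = ennreal (\<Sum>q\<in>queries. cost (fst q))"
        using cost_nonneg[OF lev] by (intro sum_ennreal) (auto simp: cost_def)
      finally show ?thesis .
    qed
    have c0: "0 \<le> (\<Sum>q\<in>queries. cost (fst q))" using cost_nonneg[OF lev] by (intro sum_nonneg) (auto simp: cost_def)
    have "ennreal (2 * ((\<Sum>q\<in>queries. cost (fst q)) + tail_signal))
        = ennreal 2 * ennreal ((\<Sum>q\<in>queries. cost (fst q)) + tail_signal)"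
      using c0 tail_signal_nonneg by (intro ennreal_mult) auto
    also have "ennreal ((\<Sum>q\<in>queries. cost (fst q)) + tail_signal)
        = ennreal (\<Sum>q\<in>queries. cost (fst q)) + ennreal tail_signal"
      using c0 tail_signal_nonneg by (intro ennreal_plus) auto
    finally show ?thesis unfolding s by (simp only: ennreal_numeral)
  qed
  finally show ?thesis .
qed

lemma frob_risk_levels_le:
  "frob_risk n d P estimator \<Sigma> \<le> ennreal (2 * (2 * real (N 0) * cost 0 + (\<Sum>m=1..max_level. real (N m) * cost m)
      + tail_signal))"
proof -
  define g where "g m = (if m \<le> max_level then cost m else 0)" for m
  have "(\<Sum>q\<in>queries. cost (fst q)) = (\<Sum>q\<in>queries. g (fst q))"
    using queries_props by (intro sum.cong refl) (auto simp: g_def)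
  also have "\<dots> \<le> 2 * real (N 0) * g 0 + (\<Sum>m=1..max_level. real (N m) * g m)"
    using cost_nonneg by (intro sum_queries_le) (auto simp: g_def cost_def)
  also have "\<dots> = 2 * real (N 0) * cost 0 + (\<Sum>m=1..max_level. real (N m) * cost m)"
    by (simp add: g_def)
  finally show ?thesis by (intro order_trans[OF frob_risk_le] ennreal_leI mult_left_mono add_mono) auto
qed

end

section \<open>Summation over the levels\<close>

text \<open>The two cases of the bound make the induction over doubling \<open>s\<close> work.\<close>

lemma sum_dyadic_min_le:
  fixes s :: real
  assumes "0 < s"
  shows "(\<Sum>m<T. min (1 / (2 ^ m * s)) (2 ^ m * s)) \<le> (if s < 1 then 3 - s else 2 / s)"
  using assms
proof (induction T arbitrary: s)
  case 0
  then show ?case by auto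
next
  case (Suc T)
  have "(\<Sum>m<Suc T. min (1 / (2 ^ m * s)) (2 ^ m * s)) = min (1 / s) s + (\<Sum>m<T. min (1 / (2 ^ m * (2 * s))) (2 ^ m * (2 * s)))"
    by (subst sum.lessThan_Suc_shift) (simp add: mult_ac)
  also have "\<dots> \<le> min (1 / s) s + (if 2 * s < 1 then 3 - 2 * s else 2 / (2 * s))"
    using Suc.IH[of "2 * s"] Suc.prems by simp
  also have "\<dots> \<le> (if s < 1 then 3 - s else 2 / s)"
  proof -
    consider "2 * s < 1" | "1 \<le> 2 * s" "s < 1" | "1 \<le> s" by linarith
    then show ?thesis
    proof cases
      case 1
      then show ?thesis using Suc.prems by simp
    next
      case 2
      have "0 \<le> (1 - s) * (2 * s - 1)" using 2 by simp
      then have "1 \<le> (3 - 2 * s) * s" by (simp add: algebra_simps)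
      then have "1 / s \<le> 3 - 2 * s" using Suc.prems by (subst pos_divide_le_eq) auto
      then show ?thesis using 2 by simp
    next
      case 3
      then show ?thesis by (simp add: min_def field_simps)
    qed
  qed
  finally show ?case .
qed

text \<open>Rescaling by the point \<open>1 / y\<close> where the two powers meet turns the summands into
  \<open>min (s powr (- \<beta>)) (s powr \<gamma>)\<close>, which is at most \<open>min (1 / s) s\<close> as both exponents are at least one.\<close>

lemma sum_dyadic_powr_min_le:
  fixes x a \<beta> \<gamma> :: real
  assumes x: "0 < x" and a: "0 < a" and \<beta>: "1 \<le> \<beta>" and \<gamma>: "1 \<le> \<gamma>"
  shows "(\<Sum>m=1..T. min ((2 ^ m * x) powr (- \<beta>)) (a * (2 ^ m * x) powr \<gamma>))
      \<le> 3 * a powr (\<beta> / (\<beta> + \<gamma>))"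
proof -
  define y where "y = a powr (1 / (\<beta> + \<gamma>))"
  have y: "0 < y" using a by (simp add: y_def)
  have bg: "0 < \<beta> + \<gamma>" using \<beta> \<gamma> by simp
  have yb: "y powr \<beta> = a powr (\<beta> / (\<beta> + \<gamma>))" by (simp add: y_def powr_powr)
  have yg: "a = y powr \<beta> * y powr \<gamma>"
    using a bg by (simp add: y_def powr_powr powr_add[symmetric] add_divide_distrib[symmetric])
  have term_le: "min (t powr (- \<beta>)) (a * t powr \<gamma>) \<le> y powr \<beta> * min (1 / (t * y)) (t * y)" if t: "0 < t" for t
  proof -
    let ?s = "t * y"
    have s: "0 < ?s" using t y by simp
    have 1: "t powr (- \<beta>) = y powr \<beta> * ?s powr (- \<beta>)" using t y by (simp add: powr_mult powr_minus field_simps)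
    have 2: "a * t powr \<gamma> = y powr \<beta> * ?s powr \<gamma>" using t y by (subst yg) (simp add: powr_mult mult_ac)
    have "min (?s powr (- \<beta>)) (?s powr \<gamma>) \<le> min (1 / ?s) ?s"
    proof (cases "?s \<le> 1")
      case True
      have "?s powr \<gamma> \<le> ?s powr 1" using True s \<gamma> by (intro powr_mono') auto
      moreover have "?s \<le> 1 / ?s" using True s mult_le_one[of ?s ?s] by (simp add: le_divide_eq)
      ultimately show ?thesis using s by (simp add: min_def)
    next
      case False
      have "?s powr (- \<beta>) \<le> ?s powr (- 1)" using False \<beta> by (intro powr_mono) auto
      also have "\<dots> = 1 / ?s" using s by (simp add: powr_minus_divide)
      finally have "?s powr (- \<beta>) \<le> 1 / ?s" .
      moreover have "1 / ?s \<le> ?s" using False s mult_mono[of 1 ?s 1 ?s] by (simp add: divide_le_eq)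
      ultimately show ?thesis by (simp add: min_def)
    qed
    then have "y powr \<beta> * min (?s powr (- \<beta>)) (?s powr \<gamma>) \<le> y powr \<beta> * min (1 / ?s) ?s"
        by (intro mult_left_mono) auto
    then show ?thesis unfolding 1 2 by (simp add: min_mult_distrib_left)
  qed
  have "(\<Sum>m=1..T. min ((2 ^ m * x) powr (- \<beta>)) (a * (2 ^ m * x) powr \<gamma>))
      \<le> (\<Sum>m=1..T. y powr \<beta> * min (1 / (2 ^ m * (x * y))) (2 ^ m * (x * y)))"
    using term_le[of "2 ^ m * x" for m] x by (intro sum_mono) (simp add: mult.assoc)
  also have "\<dots> \<le> (\<Sum>m<Suc T. y powr \<beta> * min (1 / (2 ^ m * (x * y))) (2 ^ m * (x * y)))"
    using x y by (intro sum_mono2) auto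
  also have "\<dots> = y powr \<beta> * (\<Sum>m<Suc T. min (1 / (2 ^ m * (x * y))) (2 ^ m * (x * y)))"
      by (rule sum_distrib_left[symmetric])
  also have "\<dots> \<le> y powr \<beta> * 3"
  proof (intro mult_left_mono order_trans[OF sum_dyadic_min_le])
    show "(if x * y < 1 then 3 - x * y else 2 / (x * y)) \<le> 3"
      using x y by (auto simp: divide_le_eq)
  qed (use x y in auto)
  finally show ?thesis using yb by simp
qed

lemma sum_dyadic_exp_le:
  fixes x :: real
  assumes "1 \<le> x"
  shows "(\<Sum>m=1..T. exp (- 2 * (2 ^ m * x))) \<le> exp (- 2 * x)"
proof -
  have le: "exp (- 2 * (2 ^ m * x)) \<le> exp (- 2 * x) * (1/2) ^ m" for m :: nat
  proof -
    have "real m + 1 \<le> 2 ^ m" by (induction m) auto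
    then have "(real m + 1) * x \<le> 2 ^ m * x" using assms by (intro mult_right_mono) auto
    moreover have "real m \<le> real m * x" using assms by (simp add: mult_le_cancel_left1)
    ultimately have "x + real m \<le> 2 ^ m * x" by (simp add: algebra_simps)
    then have "exp (- 2 * (2 ^ m * x)) \<le> exp (- 2 * x + real m * (- 2))" by simp
    also have "\<dots> = exp (- 2 * x) * exp (- 2) ^ m" by (simp only: exp_add exp_of_nat_mult)
    also have "\<dots> \<le> exp (- 2 * x) * (1/2) ^ m"
    proof (intro mult_left_mono power_mono)
      have "2 \<le> exp (2::real)" using exp_ge_add_one_self[of 2] by linarith
      then show "exp (- 2 :: real) \<le> 1/2" by (simp add: exp_minus field_simps)
    qed auto
    finally show ?thesis .
  qed
  have "(\<Sum>m=1..T. exp (- 2 * (2 ^ m * x))) \<le> (\<Sum>m=1..T. exp (- 2 * x) * (1/2) ^ m)" by (intro sum_mono le)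
  also have "\<dots> = exp (- 2 * x) * (\<Sum>m=1..T. (1/2) ^ m)" by (rule sum_distrib_left[symmetric])
  also have "(\<Sum>m=1..T. (1/2 :: real) ^ m) = 1 - (1/2) ^ T" by (induction T) auto
  also have "exp (- 2 * x) * (1 - (1/2) ^ T) \<le> exp (- 2 * x) * 1" by (intro mult_left_mono) auto
  finally show ?thesis by simp
qed

lemma sum_dyadic_le:
  fixes x :: real assumes "0 \<le> x"
  shows "(\<Sum>m=1..T. 2 ^ m * x) \<le> 2 * (2 ^ T * x)" "(\<Sum>m=1..T. (2 ^ m * x)\<^sup>2) \<le> 2 * (2 ^ T * x)\<^sup>2"
proof -
  have "(\<Sum>m=1..T. 2 ^ m * x) = (2 * 2 ^ T - 2) * x" by (induction T) (auto simp: algebra_simps)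
  also have "\<dots> \<le> 2 * (2 ^ T * x)" using assms by (simp add: algebra_simps)
  finally show "(\<Sum>m=1..T. 2 ^ m * x) \<le> 2 * (2 ^ T * x)" .
  show "(\<Sum>m=1..T. (2 ^ m * x)\<^sup>2) \<le> 2 * (2 ^ T * x)\<^sup>2"
  proof (induction T)
    case (Suc T)
    have "(2 ^ Suc T * x)\<^sup>2 = 4 * (2 ^ T * x)\<^sup>2" by (simp add: power_mult_distrib)
    moreover have "(\<Sum>m=1..Suc T. (2 ^ m * x)\<^sup>2) = (\<Sum>m=1..T. (2 ^ m * x)\<^sup>2) + (2 ^ Suc T * x)\<^sup>2" by simp
    ultimately show ?case using Suc zero_le_power2[of "2 ^ T * x"] by linarith
  qed simp
qed

context estimator_model
begin

text \<open>Up to constants, \<open>k\<^sup>2\<close> times this is the squared noise, per coordinate, in blocks of size \<open>k\<close>; the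
  logarithm comes from splitting the budget among the levels.\<close>

definition noise_level :: real where "noise_level = real d * ln (real n) / (\<rho> * (real n)\<^sup>2)"

context
  fixes c' :: real
  assumes ln_n: "1 \<le> ln (real n)" and C0_ge: "1 \<le> C0" and d_le_sq: "real d
      \<le> (real n)\<^sup>2" and ln_d: "ln (real n) \<le> A * real d"
    and c': "0 < c'" and budget_large: "ln (real n) powr (2 * \<alpha> + 4) \<le> c' * (\<rho> * (real n)\<^sup>2 / real d)"
    and n_large: "(C0 + 1) * ln (real n) \<le> real n powr (1 / (2 * \<alpha> + 2))"
begin

abbreviation \<beta> :: real where "\<beta> \<equiv> 2 * \<alpha> + 1"
abbreviation \<delta> :: real where "\<delta> \<equiv> noise_level"
definition sampling_rate :: real where "sampling_rate = min (real n powr (- (\<beta> / (\<beta> + 1)))) (real d / real n)"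
definition privacy_rate :: real where "privacy_rate = min (\<delta> powr (\<beta> / (\<beta> + 2))) ((real d)\<^sup>2 * \<delta>)"

lemma n_gt_1: "1 < real n"
proof (rule ccontr)
  assume "\<not> 1 < real n"
  then have "ln (real n) \<le> 0" using n_pos by simp
  then show False using ln_n by simp
qed

lemma delta_pos: "0 < \<delta>"
proof -
  have "0 < ln (real n)" "0 < real d" "0 < real n" using ln_n d_pos n_pos by linarith+
  then show ?thesis unfolding noise_level_def by (intro divide_pos_pos mult_pos_pos zero_less_power rho_pos)
qed

lemma rate_eq: "rate \<alpha> n d \<rho> = sampling_rate + privacy_rate"
proof -
  have e: "\<beta> + 1 = 2 * \<alpha> + 2" "\<beta> + 2 = 2 * \<alpha> + 3" by simp_all
  have d3: "real d ^ 3 * ln (real n) / (\<rho> * (real n)\<^sup>2)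
      = (real d)\<^sup>2 * (real d * ln (real n) / (\<rho> * (real n)\<^sup>2))"
    by (simp add: power2_eq_square power3_eq_cube)
  show ?thesis unfolding rate_def sampling_rate_def privacy_rate_def noise_level_def e d3 ..
qed

lemma rates_pos: "0 < sampling_rate" "0 < privacy_rate"
  using n_gt_1 d_pos delta_pos by (auto simp: sampling_rate_def privacy_rate_def)

text \<open>The block sizes double and stay below \<open>n\<close>.\<close>

lemma S_le: "real S \<le> 3 * ln (real n)"
proof -
  have "real (k max_level) \<le> real n" using k_le_n[of max_level] by simp
  moreover have "2 ^ max_level * 1 \<le> 2 ^ max_level * k0" using k0_pos by (intro mult_left_mono) auto
  then have "(2::real) ^ max_level \<le> real (k max_level)" unfolding k_def
    by (metis mult.right_neutral of_nat_le_iff of_nat_numeral of_nat_power)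
  ultimately have "(2::real) ^ max_level \<le> real n" by linarith
  then have "ln ((2::real) ^ max_level) \<le> ln (real n)" using n_pos by (subst ln_le_cancel_iff) auto
  then have "real max_level * ln 2 \<le> ln (real n)" by (simp add: ln_realpow)
  moreover have "real max_level * (1/2) \<le> real max_level * ln 2" using ln2_ge_two_thirds by (intro mult_left_mono) auto
  ultimately show ?thesis using ln_n by (simp add: S_eq)
qed

lemma N_le: "m \<le> max_level \<Longrightarrow> real (N m) * real (k m) \<le> 2 * real d"
  using N_mult_k[of m] D_le by (metis of_nat_le_iff of_nat_mult of_nat_numeral)

lemma budget_inverse_le:
  assumes "m \<le> max_level"
  shows "1 / (budget m * (real n)\<^sup>2) \<le> 12 * \<delta> / real (k m)" "m \<noteq> 0 \<Longrightarrow> 1 / (budget m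
      * (real n)\<^sup>2) \<le> 6 * \<delta> / real (k m)"
proof -
  have kp: "0 < real (k m)" using k_pos by simp
  have np: "0 < real n" using n_pos by simp
  have SN: "real S * real (N m) \<le> 6 * real d * ln (real n) / real (k m)"
  proof -
    have "real S * (real (N m) * real (k m)) \<le> (3 * ln (real n)) * (2 * real d)"
      by (rule mult_mono[OF S_le N_le[OF assms]]) (use ln_n in auto)
    then show ?thesis using kp by (simp add: field_simps)
  qed
  have SN': "real S * real (N m) / (\<rho> * (real n)\<^sup>2) \<le> 6 * \<delta> / real (k m)"
    using divide_right_mono[OF SN, of "\<rho> * (real n)\<^sup>2"] rho_pos np kp by (simp add: noise_level_def field_simps)
  have Sp: "0 < real S" "0 < real (N m)" using S_pos N_pos[OF assms] by auto
  show a: "1 / (budget m * (real n)\<^sup>2) \<le> 6 * \<delta> / real (k m)" if "m \<noteq> 0"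
    using SN' that Sp rho_pos np by (simp add: budget_def)
  show "1 / (budget m * (real n)\<^sup>2) \<le> 12 * \<delta> / real (k m)"
  proof (cases "m = 0")
    case True
    have "1 / (budget m * (real n)\<^sup>2) = 2 * (real S * real (N m) / (\<rho> * (real n)\<^sup>2))"
      using True Sp rho_pos np by (simp add: budget_def)
    then show ?thesis using SN' by simp
  next
    case False
    have "6 * \<delta> / real (k m) \<le> 12 * \<delta> / real (k m)" using delta_pos kp by (intro divide_right_mono) auto
    then show ?thesis using a[OF False] by linarith
  qed
qed

lemma k0_le_ln: "real k0 \<le> (C0 + 1) * ln (real n)"
proof -
  have "k0 \<le> nat \<lceil>C0 * ln (real n)\<rceil>" by (simp add: k0_def)
  then have "real k0 \<le> real (nat \<lceil>C0 * ln (real n)\<rceil>)" by simp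
  also have "\<dots> = of_int \<lceil>C0 * ln (real n)\<rceil>" using C0_ge ln_n by simp
  also have "\<dots> \<le> C0 * ln (real n) + 1" by linarith
  also have "\<dots> \<le> (C0 + 1) * ln (real n)" using ln_n by (simp add: algebra_simps)
  finally show ?thesis .
qed

text \<open>If \<open>k0\<close> is not of logarithmic size, it equals \<open>d\<close>, and then \<open>ln n \<le> A * d\<close> is used.\<close>

lemma exp_k0_le: "exp (- 2 * A * real k0) \<le> 1 / real n"
proof -
  have "ln (real n) \<le> A * real k0"
  proof (cases "k0 = d")
    case True
    then show ?thesis using ln_d by simp
  next
    case False
    then have "k0 = nat \<lceil>C0 * ln (real n)\<rceil>" unfolding k0_def by (simp add: min_def split: if_splits)
    then have "C0 * ln (real n) \<le> real k0" by linarith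
    moreover have "1 * ln (real n) \<le> C0 * ln (real n)" using C0_ge ln_n by (intro mult_right_mono) auto
    moreover have "1 * real k0 \<le> A * real k0" using A_ge by (intro mult_right_mono) auto
    ultimately show ?thesis by linarith
  qed
  moreover have "0 \<le> A * real k0" using A_ge by simp
  ultimately have "- 2 * A * real k0 \<le> - ln (real n)" by simp
  then have "exp (- 2 * A * real k0) \<le> exp (- ln (real n))" by simp
  also have "\<dots> = 1 / real n" using n_pos by (simp add: exp_minus inverse_eq_divide)
  finally show ?thesis .
qed

lemma k0_rate: "real k0 / real n \<le> sampling_rate" "1 / real n \<le> sampling_rate"
proof -
  have b: "0 < \<beta> + 1" using alpha_pos by simp
  have np: "0 < real n" using n_pos by simp
  have "real k0 / real n \<le> real n powr (1 / (2 * \<alpha> + 2)) / real n"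
    using k0_le_ln n_large np by (intro divide_right_mono) auto
  also have "\<dots> = real n powr (1 / (2 * \<alpha> + 2) - 1)" using np by (simp add: powr_diff)
  also have "1 / (2 * \<alpha> + 2) - 1 = - (\<beta> / (\<beta> + 1))" using alpha_pos by (simp add: field_simps)
  finally have 1: "real k0 / real n \<le> real n powr (- (\<beta> / (\<beta> + 1)))" .
  have "real k0 / real n \<le> real d / real n" using k0_le_d np by (intro divide_right_mono) auto
  with 1 show k: "real k0 / real n \<le> sampling_rate" by (simp add: sampling_rate_def)
  have "1 / real n \<le> real k0 / real n" using k0_pos np by (intro divide_right_mono) auto
  then show "1 / real n \<le> sampling_rate" using k by linarith
qed

lemma delta_le: "\<delta> \<le> c' * ln (real n) powr (- (\<beta> + 2))"
proof -
  let ?l = "ln (real n)"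
  have dp: "0 < real d" and np: "0 < real n" using d_pos n_pos by auto
  have "?l powr (2 * \<alpha> + 4) = ?l powr (\<beta> + 2) * ?l" using ln_n powr_add[of ?l "\<beta> + 2" 1] by (simp add: add.assoc)
  then have "?l powr (\<beta> + 2) * ?l \<le> c' * (\<rho> * (real n)\<^sup>2 / real d)" using budget_large by simp
  then have "?l powr (\<beta> + 2) * \<delta> \<le> c'" using dp np rho_pos by (simp add: noise_level_def field_simps)
  moreover have "0 < ?l powr (\<beta> + 2)" using ln_n by simp
  ultimately have "\<delta> \<le> c' / ?l powr (\<beta> + 2)" by (subst pos_le_divide_eq) (simp_all add: mult.commute)
  then show ?thesis unfolding powr_minus_divide[of ?l "\<beta> + 2"] by simp
qed

text \<open>The growth condition on the budget bounds \<open>noise_level\<close> by a constant times \<open>ln n powr (- (\<beta> + 2))\<close>,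
  which is exactly what makes \<open>(ln n)\<^sup>2 * noise_level\<close> at most of order
  \<open>noise_level powr (\<beta> / (\<beta> + 2))\<close>.\<close>

lemma k0_delta_rate: "(real k0)\<^sup>2 * \<delta> \<le> max 1 ((C0 + 1)\<^sup>2 * c' powr (2 / (\<beta> + 2))) * privacy_rate"
proof -
  let ?l = "ln (real n)"
  have b: "0 < \<beta> + 2" using alpha_pos by simp
  have "\<delta> powr (2 / (\<beta> + 2)) \<le> (c' * ?l powr (- (\<beta> + 2))) powr (2 / (\<beta> + 2))"
    using delta_le delta_pos b by (intro powr_mono2) auto
  also have "\<dots> = c' powr (2 / (\<beta> + 2)) * ?l powr (- 2)"
  proof -
    have gen: "- q * (2 / q) = - 2" if "q \<noteq> 0" for q :: real using that by simp
    have e: "- (\<beta> + 2) * (2 / (\<beta> + 2)) = - 2" by (rule gen) (use b in simp)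
    have "(c' * ?l powr (- (\<beta> + 2))) powr (2 / (\<beta> + 2))
        = c' powr (2 / (\<beta> + 2)) * (?l powr (- (\<beta> + 2))) powr (2 / (\<beta> + 2))"
      by (rule powr_mult)
    then show ?thesis unfolding powr_powr e .
  qed
  also have "?l powr (- 2) = 1 / ?l\<^sup>2" using ln_n by (simp add: powr_minus_divide powr_numeral)
  finally have "?l\<^sup>2 * \<delta> powr (2 / (\<beta> + 2)) \<le> c' powr (2 / (\<beta> + 2))" using ln_n by (simp add: field_simps)
  then have "?l\<^sup>2 * \<delta> powr (2 / (\<beta> + 2)) * \<delta> powr (\<beta> / (\<beta> + 2))
      \<le> c' powr (2 / (\<beta> + 2)) * \<delta> powr (\<beta> / (\<beta> + 2))"
    by (intro mult_right_mono) auto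
  moreover have "\<delta> powr (2 / (\<beta> + 2)) * \<delta> powr (\<beta> / (\<beta> + 2)) = \<delta>"
    using b delta_pos by (simp add: powr_add[symmetric] add_divide_distrib[symmetric] add.commute)
  ultimately have l: "?l\<^sup>2 * \<delta> \<le> c' powr (2 / (\<beta> + 2)) * \<delta> powr (\<beta> / (\<beta> + 2))"
      by (simp add: mult.assoc)
  have "(real k0)\<^sup>2 \<le> ((C0 + 1) * ?l)\<^sup>2" using k0_le_ln by (intro power_mono) auto
  then have "(real k0)\<^sup>2 * \<delta> \<le> ((C0 + 1) * ?l)\<^sup>2 * \<delta>" using delta_pos by (intro mult_right_mono) auto
  also have "\<dots> = (C0 + 1)\<^sup>2 * (?l\<^sup>2 * \<delta>)" by (simp add: power_mult_distrib)
  also have "\<dots> \<le> (C0 + 1)\<^sup>2 * (c' powr (2 / (\<beta> + 2)) * \<delta> powr (\<beta> / (\<beta> + 2)))"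
      using l by (intro mult_left_mono) auto
  also have "\<dots> \<le> max 1 ((C0 + 1)\<^sup>2 * c' powr (2 / (\<beta> + 2))) * \<delta> powr (\<beta> / (\<beta> + 2))"
    unfolding mult.assoc[symmetric] by (intro mult_right_mono) auto
  finally have 1: "(real k0)\<^sup>2 * \<delta> \<le> max 1 ((C0 + 1)\<^sup>2 * c' powr (2 / (\<beta>
      + 2))) * \<delta> powr (\<beta> / (\<beta> + 2))" .
  have "(real k0)\<^sup>2 * \<delta> \<le> 1 * ((real d)\<^sup>2 * \<delta>)"
      using k0_le_d delta_pos by (simp add: mult_right_mono power_mono)
  also have "\<dots> \<le> max 1 ((C0 + 1)\<^sup>2 * c' powr (2 / (\<beta> + 2))) * ((real d)\<^sup>2 * \<delta>)"
      using delta_pos by (intro mult_right_mono) auto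
  finally show ?thesis using 1 by (simp add: privacy_rate_def min_mult_distrib_left le_max_iff_disj)
qed

definition growth_const :: real where "growth_const = max 1 ((C0 + 1)\<^sup>2 * c' powr (2 / (\<beta> + 2)))"

lemma level_zero_le: "2 * (2 * real (N 0) * cost 0) / real d
    \<le> 8 * 31296 * \<kappa> ^ 4 * sampling_rate + 5184 * C\<^sup>2 * growth_const * privacy_rate"
proof -
  let ?k = "real k0"
  have kp: "0 < ?k" using k0_pos by simp
  have dp: "0 < real d" and np: "0 < real n" using d_pos n_pos by auto
  have c0: "0 \<le> cost 0" using cost_nonneg[of 0] by (simp add: cost_def)
  have b: "fixed_error 0 \<le> 192 * \<kappa> ^ 4 * ?k\<^sup>2 * (1 / real n)"
    using mult_left_mono[OF exp_k0_le, of "192 * \<kappa> ^ 4 * ?k\<^sup>2"] by (simp add: fixed_error_def bias_sq_def k_0 mult_ac)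
  have w: "sampling_cost 0 = 31104 * \<kappa> ^ 4 * ?k\<^sup>2 * (1 / real n)" by (simp add: sampling_cost_def k_0)
  have z: "noise_cost 0 \<le> 648 * C\<^sup>2 * ?k ^ 3 * \<delta>"
  proof -
    have "noise_cost 0 = 54 * C\<^sup>2 * ?k ^ 4 * (1 / (budget 0 * (real n)\<^sup>2))" by (simp add: noise_cost_def k_0)
    also have "\<dots> \<le> 54 * C\<^sup>2 * ?k ^ 4 * (12 * \<delta> / ?k)"
      using budget_inverse_le(1)[of 0] by (intro mult_left_mono) (auto simp: k_0)
    also have "\<dots> = 648 * C\<^sup>2 * ?k ^ 3 * \<delta>" using kp by (simp add: power4_eq_xxxx power3_eq_cube)
    finally show ?thesis .
  qed
  have "real (N 0) * ?k \<le> 2 * real d" using N_le[of 0] by (simp add: k_0)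
  then have "2 * (2 * real (N 0) * cost 0) / real d \<le> 8 / ?k * cost 0"
    using kp dp mult_right_mono[OF _ c0, of "real (N 0) * ?k" "2 * real d"] by (simp add: field_simps)
  also have "\<dots> \<le> 8 / ?k * (192 * \<kappa> ^ 4 * ?k\<^sup>2 * (1 / real n)
      + 31104 * \<kappa> ^ 4 * ?k\<^sup>2 * (1 / real n) + 648 * C\<^sup>2 * ?k ^ 3 * \<delta>)"
    unfolding cost_def using b w z kp by (intro mult_left_mono add_mono) auto
  also have "\<dots> = 8 * 31296 * \<kappa> ^ 4 * (?k / real n) + 5184 * C\<^sup>2 * (?k\<^sup>2 * \<delta>)"
    using kp np by (simp add: field_simps power2_eq_square power3_eq_cube)
  also have "\<dots> \<le> 8 * 31296 * \<kappa> ^ 4 * sampling_rate + 5184 * C\<^sup>2 * (growth_const * privacy_rate)"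
    using k0_rate(1) k0_delta_rate unfolding growth_const_def[symmetric] by (intro add_mono mult_left_mono) auto
  finally show ?thesis by (simp add: mult.assoc)
qed

text \<open>A level beyond the first exists only if \<open>k0 < d\<close>, and then \<open>k0\<close> is at least \<open>C0 * ln n\<close>. From there
  on logarithmic terms are dominated by the block size.\<close>

lemma higher_level_k:
  assumes "1 \<le> max_level"
  shows "ln (real n) \<le> real k0"
proof -
  have "k0 \<noteq> d"
  proof
    assume "k0 = d"
    then have "depth = 0" unfolding depth_def by (intro Least_equality) auto
    then show False using assms max_level_le_depth by simp
  qed
  then have "k0 = nat \<lceil>C0 * ln (real n)\<rceil>" unfolding k0_def by (simp add: min_def split: if_splits)
  then have "C0 * ln (real n) \<le> real k0" by linarith
  moreover have "1 * ln (real n) \<le> C0 * ln (real n)" using C0_ge ln_n by (intro mult_right_mono) auto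
  ultimately show ?thesis by linarith
qed

lemma ln_D_le: "ln (real D) \<le> 3 * ln (real n)"
proof -
  have np: "0 < real n" using n_pos by simp
  have "real D \<le> 2 * real d" using D_le by (metis of_nat_le_iff of_nat_mult of_nat_numeral)
  also have "\<dots> \<le> 2 * (real n)\<^sup>2" using d_le_sq by simp
  finally have "ln (real D) \<le> ln (2 * (real n)\<^sup>2)" using D_pos np by (subst ln_le_cancel_iff) auto
  also have "\<dots> = ln 2 + 2 * ln (real n)" using np by (simp add: ln_mult ln_realpow)
  also have "ln (2::real) \<le> 1" using ln_add_one_self_le_self[of 1] by simp
  finally show ?thesis using ln_n by linarith
qed

definition level_const :: real where "level_const = max (M\<^sup>2 * 2 powr (2 * (\<alpha> + 1))) (24 * L1)"

text \<open>Per coordinate, signal and threshold are at most \<open>level_const\<close> times the expressions in the minima;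
  sampling error and noise beyond the threshold leave terms that are exponentially small in the
  block size.\<close>

lemma level_cost_le:
  assumes m: "m \<in> {1..max_level}"
  defines "x \<equiv> real (k m)"
  shows "2 * (real (N m) * cost m) / real d
    \<le> 40 * level_const * (min (x powr (- \<beta>)) (1 / real n * x powr 1) + min (x powr (- \<beta>)) (\<delta> * x powr 2)
        + exp (- 2 * x))
      + 10 * L1 / real n * exp (- 2 * x) + 60 * L1 * \<delta> * exp (- 2 * x)"
proof -
  have ml: "m \<le> max_level" "m \<noteq> 0" "1 \<le> max_level" using m by auto
  have np: "0 < real n" and dp: "0 < real d" using n_pos d_pos by auto
  have x1: "1 \<le> x" using k_pos[of m] by (simp add: x_def)
  then have xp: "0 < x" by simp
  have x_ln: "ln (real n) \<le> x"
    using higher_level_k[OF ml(3)] k_mono[of 0 m] by (simp add: x_def k_0)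
  let ?e = "exp (- 2 * x)" and ?p = "x powr (- \<beta>)" and ?q = "1 / real n * x powr 1" and ?r = "\<delta> * x powr 2"
  have L1: "0 < L1" by (rule L1_pos)
  have bi: "1 / (budget m * (real n)\<^sup>2) \<le> 6 * \<delta> / x" using budget_inverse_le(2)[OF ml(1,2)] by (simp add: x_def)
  have tau: "tau_sq m \<le> 24 * L1 * (?q + ?r + ?e)"
  proof -
    have kl: "x + ln (real D) \<le> 4 * x" using ln_D_le x_ln by linarith
    have "(x + ln (real D)) / real n \<le> 4 * ?q" using kl np xp by (simp add: divide_right_mono)
    have "x\<^sup>2 * (x + ln (real D)) / (budget m * (real n)\<^sup>2) \<le> 24 * ?r"
    proof -
      have "x\<^sup>2 * (x + ln (real D)) * (1 / (budget m * (real n)\<^sup>2)) \<le> x\<^sup>2 * (4 * x) * (6 * \<delta> / x)"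
        using kl bi xp delta_pos budget_pos[OF ml(1)] by (intro mult_mono mult_left_mono) auto
      also have "\<dots> = 24 * ?r" using xp by (simp add: powr_numeral)
      finally show ?thesis by simp
    qed
    have "(x + ln (real D)) / real n + x\<^sup>2 * (x + ln (real D)) / (budget m * (real n)\<^sup>2) + ?e \<le> 24 * (?q + ?r + ?e)"
    proof -
      have "0 \<le> ?q" "0 \<le> ?e" using np by auto
      moreover have "a + b + e \<le> 24 * (q + r + e)" if "a \<le> 4 * q" "b \<le> 24 * r" "0 \<le> q" "0 \<le> e" for a b q r e :: real
        using that by simp
      ultimately show ?thesis
        using \<open>(x + ln (real D)) / real n \<le> 4 * ?q\<close> \<open>x\<^sup>2 * (x
            + ln (real D)) / (budget m * (real n)\<^sup>2) \<le> 24 * ?r\<close> by blast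
    qed
    then have "L1 * ((x + ln (real D)) / real n + x\<^sup>2 * (x + ln (real D)) / (budget m * (real n)\<^sup>2) + ?e)
        \<le> L1 * (24 * (?q + ?r + ?e))"
      using L1 by (intro mult_left_mono) auto
    then show ?thesis unfolding tau_sq_def x_def by (simp add: mult_ac)
  qed
  have sig: "signal_bound m = x * (M\<^sup>2 * 2 powr (2 * (\<alpha> + 1)) * ?p)"
  proof -
    have "(x / 2) powr (- 2 * (\<alpha> + 1)) = x powr (- 2 * (\<alpha> + 1)) * 2 powr (2 * (\<alpha> + 1))"
    proof -
      have "(x / 2) powr (- g) = x powr (- g) * 2 powr g" for g
        using xp by (simp add: powr_divide powr_minus_divide)
      moreover have "- 2 * (\<alpha> + 1) = - (2 * (\<alpha> + 1))" by simp
      ultimately show ?thesis by (simp only:)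
    qed
    moreover have "x\<^sup>2 * x powr (- 2 * (\<alpha> + 1)) = x * ?p"
    proof -
      have "x\<^sup>2 * x powr (- 2 * (\<alpha> + 1)) = x powr 2 * x powr (- 2 * (\<alpha> + 1))" using xp by (simp add: powr_numeral)
      also have "\<dots> = x powr 1 * x powr (- \<beta>)" by (simp only: powr_add[symmetric]) (simp add: algebra_simps)
      finally show ?thesis using xp by simp
    qed
    ultimately show ?thesis unfolding signal_bound_def x_def[symmetric] by (simp add: mult_ac)
  qed
  have C: "4 / x * fixed_error m \<le> 40 * level_const * (min ?p ?q + min ?p ?r + ?e)"
  proof -
    have "fixed_error m = 10 * (x * min (M\<^sup>2 * 2 powr (2 * (\<alpha> + 1)) * ?p) (tau_sq m))"
      using ml xp unfolding fixed_error_def sig x_def[symmetric] by (simp add: min_mult_distrib_left)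
    then have "4 / x * fixed_error m = 40 * min (M\<^sup>2 * 2 powr (2 * (\<alpha> + 1)) * ?p) (tau_sq m)" using xp by simp
    also have "\<dots> \<le> 40 * min (level_const * ?p) (level_const * (?q + ?r + ?e))"
    proof (intro mult_left_mono min.mono)
      show "M\<^sup>2 * 2 powr (2 * (\<alpha> + 1)) * ?p \<le> level_const * ?p" unfolding level_const_def by (intro mult_right_mono) auto
      have "24 * L1 * (?q + ?r + ?e) \<le> level_const * (?q + ?r + ?e)"
        unfolding level_const_def using delta_pos by (intro mult_right_mono add_nonneg_nonneg) auto
      then show "tau_sq m \<le> level_const * (?q + ?r + ?e)" using tau by linarith
    qed auto
    also have "\<dots> = 40 * level_const * min ?p (?q + ?r + ?e)"
      using L1 by (simp add: min_mult_distrib_left level_const_def)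
    also have "\<dots> \<le> 40 * level_const * (min ?p ?q + min ?p ?r + ?e)"
    proof (intro mult_left_mono)
      have nn: "0 \<le> ?p" "0 \<le> ?q" "0 \<le> ?r" "0 \<le> ?e" using delta_pos by auto
      have "min p (q + r + e) \<le> min p q + min p r + e" if "0 \<le> p" "0 \<le> q" "0 \<le> r" "0 \<le> e" for p q r e :: real
        using that by (auto simp: min_def)
      from this[OF nn] show "min ?p (?q + ?r + ?e) \<le> min ?p ?q + min ?p ?r + ?e" .
    qed (use L1 in \<open>simp add: level_const_def\<close>)
    finally show ?thesis .
  qed
  have xe: "x \<le> exp x" using exp_ge_add_one_self[of x] by linarith
  have e5: "exp (- 5 * x) * exp (3 * x) = ?e" by (simp add: exp_add[symmetric])
  have xe3: "x \<le> exp (3 * x)" using xe xp by (intro order_trans[OF xe]) simp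
  have "x\<^sup>2 \<le> (exp x)\<^sup>2" using xe xp by (intro power_mono) auto
  also have "\<dots> = exp (2 * x)" by (simp add: exp_double)
  also have "\<dots> \<le> exp (3 * x)" using xp by simp
  finally have x2e3: "x\<^sup>2 \<le> exp (3 * x)" .
  have W: "4 / x * sampling_cost m \<le> 10 * L1 / real n * ?e"
  proof -
    have "4 / x * sampling_cost m = 10 * L1 / real n * (exp (- 5 * x) * x)"
      using ml xp np unfolding sampling_cost_def sampling_cut_def x_def[symmetric] by (simp add: field_simps power2_eq_square)
    also have "\<dots> \<le> 10 * L1 / real n * (exp (- 5 * x) * exp (3 * x))"
      using L1 xe3 by (intro mult_left_mono) auto
    finally show ?thesis unfolding e5 .
  qed
  have Z: "4 / x * noise_cost m \<le> 60 * L1 * \<delta> * ?e"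
  proof -
    have "4 / x * noise_cost m = 10 * L1 * x ^ 3 * exp (- 5 * x) * (1 / (budget m * (real n)\<^sup>2))"
      using ml xp np unfolding noise_cost_def noise_cut_def x_def[symmetric] by (simp add: field_simps power4_eq_xxxx power3_eq_cube)
    also have "\<dots> \<le> 10 * L1 * x ^ 3 * exp (- 5 * x) * (6 * \<delta> / x)"
      using bi L1 xp by (intro mult_left_mono) auto
    also have "\<dots> = 60 * L1 * \<delta> * (exp (- 5 * x) * x\<^sup>2)" using xp by (simp add: power3_eq_cube power2_eq_square)
    also have "\<dots> \<le> 60 * L1 * \<delta> * (exp (- 5 * x) * exp (3 * x))"
      using L1 delta_pos x2e3 by (intro mult_left_mono) auto
    finally show ?thesis unfolding e5 .
  qed
  have cn: "0 \<le> cost m" using cost_nonneg[OF ml(1)] by (simp add: cost_def)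
  have "2 * (real (N m) * cost m) / real d \<le> 4 / x * cost m"
    using xp dp mult_right_mono[OF N_le[OF ml(1)] cn] by (simp add: field_simps x_def)
  also have "\<dots> = 4 / x * fixed_error m + 4 / x * sampling_cost m + 4 / x * noise_cost m" by (simp add: cost_def distrib_left)
  also have "\<dots> \<le> 40 * level_const * (min ?p ?q + min ?p ?r + ?e) + 10 * L1 / real n * ?e + 60 * L1 * \<delta> * ?e"
    using C W Z by (intro add_mono) auto
  finally show ?thesis .
qed

text \<open>Each sum of minima has two bounds: the balance of signal and variance, and the sum of the variances
  alone, which is dominated by the last level, of size at most \<open>2 * d\<close>.\<close>

lemma higher_levels_le:
  "2 * (\<Sum>m=1..max_level. real (N m) * cost m) / real d
      \<le> (200 * level_const + 10 * L1) * sampling_rate + (320 * level_const + 60 * L1 * growth_const) * privacy_rate"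
proof -
  have np: "0 < real n" and dp: "0 < real d" using n_pos d_pos by auto
  have kx: "real (k m) = 2 ^ m * real k0" for m by (simp add: k_def)
  have k0p: "0 < real k0" "1 \<le> real k0" using k0_pos by auto
  have L1: "0 < L1" by (rule L1_pos)
  have level_const: "0 < level_const" using L1 by (simp add: level_const_def)
  have b1: "1 \<le> \<beta>" using alpha_pos by simp
  let ?p = "\<lambda>m. (2 ^ m * real k0) powr (- \<beta>)" and ?q = "\<lambda>m. 1 / real n * (2 ^ m * real k0) powr 1"
    and ?r = "\<lambda>m. \<delta> * (2 ^ m * real k0) powr 2" and ?e = "\<lambda>m. exp (- 2 * (2 ^ m * real k0))"
  define SQ SR SE where "SQ = (\<Sum>m=1..max_level. min (?p m) (?q m))" and "SR = (\<Sum>m=1..max_level. min (?p m) (?r m))"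
    and "SE = (\<Sum>m=1..max_level. ?e m)"
  have kmax: "2 ^ max_level * real k0 \<le> 2 * real d"
  proof -
    have "k max_level \<le> D" unfolding D_eq by (rule k_mono[OF max_level_le_depth])
    then have "k max_level \<le> 2 * d" using D_le by simp
    then have "real (k max_level) \<le> real (2 * d)" by (simp only: of_nat_le_iff)
    then show ?thesis by (simp add: kx)
  qed
  have SQ: "SQ \<le> 4 * sampling_rate"
  proof -
    have "SQ \<le> 3 * (1 / real n) powr (\<beta> / (\<beta> + 1))"
      unfolding SQ_def using np k0p b1 by (intro sum_dyadic_powr_min_le) auto
    also have "(1 / real n) powr (\<beta> / (\<beta> + 1)) = real n powr (- (\<beta> / (\<beta> + 1)))"
      using np by (simp add: powr_divide powr_minus_divide)
    finally have 1: "SQ \<le> 4 * real n powr (- (\<beta> / (\<beta> + 1)))"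
        using powr_ge_zero[of "real n" "- (\<beta> / (\<beta> + 1))"] by linarith
    have "SQ \<le> (\<Sum>m=1..max_level. ?q m)" unfolding SQ_def by (intro sum_mono) simp
    also have "\<dots> = 1 / real n * (\<Sum>m=1..max_level. 2 ^ m * real k0)" using k0p by (simp add: sum_distrib_left)
    also have "\<dots> \<le> 1 / real n * (2 * (2 * real d))"
      using sum_dyadic_le(1)[of "real k0" max_level] kmax k0p np by (intro mult_left_mono) auto
    finally have "SQ \<le> 4 * (real d / real n)" by simp
    with 1 show ?thesis by (simp add: sampling_rate_def min_mult_distrib_left)
  qed
  have SR: "SR \<le> 8 * privacy_rate"
  proof -
    have "SR \<le> 3 * \<delta> powr (\<beta> / (\<beta> + 2))"
      unfolding SR_def using delta_pos k0p b1 by (intro sum_dyadic_powr_min_le) auto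
    then have 1: "SR \<le> 8 * \<delta> powr (\<beta> / (\<beta> + 2))"
        using powr_ge_zero[of \<delta> "\<beta> / (\<beta> + 2)"] by linarith
    have "SR \<le> (\<Sum>m=1..max_level. ?r m)" unfolding SR_def by (intro sum_mono) simp
    also have "\<dots> = \<delta> * (\<Sum>m=1..max_level. (2 ^ m * real k0)\<^sup>2)"
        using k0p by (simp add: sum_distrib_left powr_numeral)
    also have "\<dots> \<le> \<delta> * (2 * (2 ^ max_level * real k0)\<^sup>2)"
      using sum_dyadic_le(2)[of "real k0" max_level] k0p delta_pos by (intro mult_left_mono) auto
    also have "\<dots> \<le> \<delta> * (2 * (2 * real d)\<^sup>2)"
      using kmax k0p delta_pos by (intro mult_left_mono power_mono) auto
    finally have "SR \<le> 8 * ((real d)\<^sup>2 * \<delta>)" by (simp add: power_mult_distrib mult_ac)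
    with 1 show ?thesis by (simp add: privacy_rate_def min_mult_distrib_left)
  qed
  have SE0: "0 \<le> SE" unfolding SE_def by (intro sum_nonneg) auto
  have SEn: "SE \<le> 1 / real n"
  proof (cases "1 \<le> max_level")
    case True
    have "SE \<le> exp (- 2 * real k0)" unfolding SE_def by (rule sum_dyadic_exp_le[OF k0p(2)])
    also have "\<dots> \<le> exp (- ln (real n))" using higher_level_k[OF True] k0p by simp
    also have "\<dots> = 1 / real n" using np by (simp add: exp_minus inverse_eq_divide)
    finally show ?thesis .
  next
    case False
    then show ?thesis using np by (simp add: SE_def)
  qed
  have SE1: "SE \<le> sampling_rate" using SEn k0_rate(2) by linarith
  have n1: "1 / real n \<le> 1" using n_gt_1 by simp
  have SE2: "1 / real n * SE \<le> sampling_rate"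
  proof -
    have "1 / real n * SE \<le> 1 * SE" using SE0 n1 by (intro mult_right_mono) auto
    then show ?thesis using SE1 by linarith
  qed
  have SE3: "\<delta> * SE \<le> growth_const * privacy_rate"
  proof -
    have "SE \<le> 1" using SEn n1 by linarith
    also have "1 \<le> (real k0)\<^sup>2" using k0p by (simp add: one_le_power)
    finally have "\<delta> * SE \<le> \<delta> * (real k0)\<^sup>2" using delta_pos by (intro mult_left_mono) auto
    then show ?thesis using k0_delta_rate unfolding growth_const_def by (simp add: mult.commute)
  qed
  have "2 * (\<Sum>m=1..max_level. real (N m) * cost m) / real d = (\<Sum>m=1..max_level. 2 * (real (N m) * cost m) / real d)"
    by (simp add: sum_distrib_left sum_divide_distrib)
  also have "\<dots> \<le> (\<Sum>m=1..max_level. 40 * level_const * (min (?p m) (?q m) + min (?p m) (?r m) + ?e m)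
      + 10 * L1 / real n * ?e m + 60 * L1 * \<delta> * ?e m)"
    using level_cost_le unfolding kx by (intro sum_mono)
  also have "\<dots> = 40 * level_const * (SQ + SR + SE) + 10 * L1 / real n * SE + 60 * L1 * \<delta> * SE"
    unfolding SQ_def SR_def SE_def by (simp only: sum.distrib sum_distrib_left[symmetric])
  also have "\<dots> = 40 * level_const * (SQ + SR + SE) + 10 * L1 * (1 / real n * SE) + 60 * L1 * (\<delta> * SE)" by simp
  also have "\<dots> \<le> 40 * level_const * (4 * sampling_rate + 8 * privacy_rate + sampling_rate) + 10 * L1 * sampling_rate
      + 60 * L1 * (growth_const * privacy_rate)"
    using SQ SR SE1 SE2 SE3 level_const L1 by (intro add_mono mult_left_mono) auto
  also have "\<dots> = (200 * level_const + 10 * L1) * sampling_rate + (320 * level_const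
      + 60 * L1 * growth_const) * privacy_rate" by (simp add: algebra_simps)
  finally show ?thesis .
qed

text \<open>The last block size exceeds \<open>c0 * n / 2\<close>, and \<open>2 * d\<close> exceeds \<open>c0 * n\<close>, whenever \<open>tail_signal\<close> is not
  zero.\<close>

lemma tail_signal_le: "2 * tail_signal / real d \<le> 2 * M\<^sup>2 * (2 / c0) powr \<beta> * (2 / c0) * sampling_rate"
proof (cases "c0 * real n < 2 * real (k max_level) \<and> c0 * real n < real D")
  case False
  have "0 \<le> 2 * M\<^sup>2 * (2 / c0) powr \<beta> * (2 / c0) * sampling_rate"
    using c0_pos rates_pos(1) by (intro mult_nonneg_nonneg) auto
  moreover have "tail_signal = 0" using False by (auto simp: tail_signal_def)
  ultimately show ?thesis by simp
next
  case True
  have np: "0 < real n" and dp: "0 < real d" using n_pos d_pos by auto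
  have b: "1 \<le> \<beta>" using alpha_pos by simp
  have h: "0 < c0 * real n / 2" using c0_pos np by simp
  have "2 * tail_signal / real d = 2 * M\<^sup>2 * real (k max_level) powr (- \<beta>)" using True dp by (simp add: tail_signal_def)
  also have "\<dots> \<le> 2 * M\<^sup>2 * (c0 * real n / 2) powr (- \<beta>)"
    using True h b by (intro mult_left_mono powr_mono2') auto
  also have "(c0 * real n / 2) powr (- \<beta>) = (2 / c0) powr \<beta> * real n powr (- \<beta>)"
  proof -
    define u where "u = 2 / c0"
    have u: "0 < u" using c0_pos by (simp add: u_def)
    have "c0 * real n / 2 = real n / u" using c0_pos by (simp add: u_def)
    then have "(c0 * real n / 2) powr (- \<beta>) = real n powr (- \<beta>) / u powr (- \<beta>)" using u np by (simp only: powr_divide)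
    also have "\<dots> = u powr \<beta> * real n powr (- \<beta>)" unfolding powr_minus_divide[of u \<beta>] by simp
    finally show ?thesis unfolding u_def .
  qed
  finally have 1: "2 * tail_signal / real d \<le> 2 * M\<^sup>2 * ((2 / c0) powr \<beta> * real n powr (- \<beta>))" .
  have "real n powr (- \<beta>) \<le> 2 / c0 * sampling_rate"
  proof -
    have c: "1 \<le> 2 / c0" using c0_pos c0_le_1 by simp
    have "\<beta> / (\<beta> + 1) \<le> \<beta>" using b mult_left_mono[of 1 "\<beta> + 1" \<beta>] by (simp add: divide_le_eq)
    then have "real n powr (- \<beta>) \<le> real n powr (- (\<beta> / (\<beta> + 1)))" using n_gt_1 by (intro powr_mono) auto
    also have "\<dots> \<le> 2 / c0 * real n powr (- (\<beta> / (\<beta> + 1)))"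
        using mult_right_mono[OF c, of "real n powr (- (\<beta> / (\<beta> + 1)))"] by simp
    finally have a1: "real n powr (- \<beta>) \<le> 2 / c0 * real n powr (- (\<beta> / (\<beta> + 1)))" .
    have "real n powr (- \<beta>) \<le> real n powr 0" using n_gt_1 b by (intro powr_mono) auto
    then have "real n powr (- \<beta>) \<le> 1" using np by simp
    also have "c0 * real n \<le> 2 * real d"
    proof -
      have "real D \<le> real (2 * d)" using D_le by (simp only: of_nat_le_iff)
      then show ?thesis using True by simp
    qed
    then have "1 \<le> 2 / c0 * (real d / real n)" using c0_pos np by (simp add: field_simps)
    finally have a2: "real n powr (- \<beta>) \<le> 2 / c0 * (real d / real n)" .
    show ?thesis using a1 a2 c0_pos by (simp add: sampling_rate_def min_mult_distrib_left)
  qed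
  then have "2 * M\<^sup>2 * ((2 / c0) powr \<beta> * real n powr (- \<beta>))
      \<le> 2 * M\<^sup>2 * ((2 / c0) powr \<beta> * (2 / c0 * sampling_rate))"
    by (intro mult_left_mono) auto
  then show ?thesis using 1 by (simp add: mult.assoc)
qed

definition risk_const :: real where
  "risk_const = (8 * 31296 * \<kappa> ^ 4 + 200 * level_const + 10 * L1 + 2 * M\<^sup>2 * (2 / c0) powr \<beta> * (2 / c0))
      + (5184 * C\<^sup>2 * growth_const + 320 * level_const + 60 * L1 * growth_const)"

lemma frob_risk_rate:
  "ennreal (1 / real d) * frob_risk n d P estimator \<Sigma> \<le> ennreal (risk_const * rate \<alpha> n d \<rho>)"
proof -
  let ?R = "2 * (2 * real (N 0) * cost 0 + (\<Sum>m=1..max_level. real (N m) * cost m) + tail_signal)"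
  have dp: "0 < real d" using d_pos by simp
  define a b where "a = 8 * 31296 * \<kappa> ^ 4 + 200 * level_const + 10 * L1 + 2 * M\<^sup>2 * (2 / c0) powr \<beta> * (2 / c0)"
    and "b = 5184 * C\<^sup>2 * growth_const + 320 * level_const + 60 * L1 * growth_const"
  have pos: "0 \<le> level_const" "0 \<le> L1" "0 \<le> growth_const" using L1_pos by (auto simp: level_const_def growth_const_def)
  have ab: "0 \<le> a" "0 \<le> b" unfolding a_def b_def using pos c0_pos by (auto intro!: add_nonneg_nonneg)
  have "1 / real d * ?R = 2 * (2 * real (N 0) * cost 0) / real d + 2 * (\<Sum>m=1..max_level. real (N m) * cost m) / real d
      + 2 * tail_signal / real d"
    by (simp add: add_divide_distrib distrib_left)
  also have "\<dots> \<le> (8 * 31296 * \<kappa> ^ 4 * sampling_rate + 5184 * C\<^sup>2 * growth_const * privacy_rate)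
      + ((200 * level_const + 10 * L1) * sampling_rate + (320 * level_const + 60 * L1 * growth_const) * privacy_rate)
      + 2 * M\<^sup>2 * (2 / c0) powr \<beta> * (2 / c0) * sampling_rate"
    by (intro add_mono level_zero_le higher_levels_le tail_signal_le)
  also have "\<dots> = a * sampling_rate + b * privacy_rate" by (simp add: a_def b_def algebra_simps)
  also have "\<dots> \<le> (a + b) * sampling_rate + (a + b) * privacy_rate" using ab rates_pos by (intro add_mono mult_right_mono) auto
  also have "\<dots> = risk_const * rate \<alpha> n d \<rho>" unfolding rate_eq risk_const_def a_def b_def by (simp add: distrib_left)
  finally have *: "1 / real d * ?R \<le> risk_const * rate \<alpha> n d \<rho>" .
  have "ennreal (1 / real d) * frob_risk n d P estimator \<Sigma> \<le> ennreal (1 / real d) * ennreal ?R"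
    by (intro mult_left_mono frob_risk_levels_le) simp
  also have "\<dots> = ennreal (1 / real d * ?R)" by (rule ennreal_mult'[symmetric]) simp
  also have "\<dots> \<le> ennreal (risk_const * rate \<alpha> n d \<rho>)" by (rule ennreal_leI[OF *])
  finally show ?thesis .
qed

end

end

section \<open>Asymptotic statement\<close>

text \<open>All conditions of the bound for a single triple hold eventually: \<open>d \<le> n\<^sup>2\<close> because \<open>d / (\<rho> n\<^sup>2)\<close> tends to
  zero while \<open>\<rho>\<close> stays bounded, the others by assumption or because
  logarithms grow more slowly than powers.\<close>

lemma adaptive_estimator_risk_eventually:
  fixes K M0 M c \<rho>max A C0 C L1 c0 \<alpha> c' :: real
  assumes pos: "0 < K" "0 < M" "0 < \<rho>max" "0 < \<alpha>" "0 < c'" and A: "2 \<le> A" "c \<le> A" and c: "0 < c"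
    and C0: "1 \<le> C0" and C: "0 < C" "sqrt 2 * exp (- C / (4 * (2 * K)\<^sup>2)) \<le> exp (- A)"
    and L1: "exp 5 * (36 * 10368 * (2 * K) ^ 4) \<le> L1" "exp 5 * (36 * 144 * C\<^sup>2) \<le> L1"
    and c0: "0 < c0" "c0 \<le> 1"
  shows "\<exists>Const>0. \<forall>n d \<rho>.
          regime c \<rho>max n d \<rho> \<and>
          (\<forall>\<^sub>F s in sequentially.
             ln (real (n s)) powr (2 * \<alpha> + 4) \<le> c' * (\<rho> s * (real (n s))\<^sup>2 / real (d s))) \<longrightarrow>
          (\<forall>\<^sub>F s in sequentially.
             \<forall>P \<Sigma>. data_distribution (d s) K \<Sigma> P \<and> \<Sigma> \<in> cov_class (d s) \<alpha> M0 M \<longrightarrow>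
               ennreal (1 / real (d s)) *
                 frob_risk (n s) (d s) P
                   (adaptive_estimator.estimator C0 C L1 c0 (n s) (d s) (\<rho> s)) \<Sigma>
               \<le> ennreal (Const * rate \<alpha> (n s) (d s) (\<rho> s)))"
proof -
  define Const where "Const = estimator_model.risk_const C0 C L1 c0 K M \<alpha> c'"
  have L1_pos: "0 < L1"
  proof -
    have "0 < exp 5 * (36 * 144 * C\<^sup>2)" using C by simp
    then show ?thesis using L1(2) by linarith
  qed
  have asym1: "\<forall>\<^sub>F x :: real in at_top. 1 \<le> ln x" by real_asymp
  have asym2: "\<forall>\<^sub>F x :: real in at_top. (C0 + 1) * ln x \<le> x powr (1 / (2 * \<alpha> + 2))"
    using pos C0 by real_asymp
  have asym3: "\<forall>\<^sub>F x :: real in at_top. (C0 + 1) * ln x \<le> c0 * x"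
    using c0 C0 by real_asymp
  show ?thesis
  proof (intro exI[of _ "max 1 Const"] conjI allI impI)
    show "0 < max 1 Const" by simp
    fix n d :: "nat \<Rightarrow> nat" and \<rho> :: "nat \<Rightarrow> real"
    assume "regime c \<rho>max n d \<rho> \<and> (\<forall>\<^sub>F s in sequentially.
             ln (real (n s)) powr (2 * \<alpha> + 4) \<le> c' * (\<rho> s * (real (n s))\<^sup>2 / real (d s)))"
    then have n: "filterlim n at_top sequentially"
      and e1: "\<forall>\<^sub>F s in sequentially. ln (real (n s)) \<le> c * real (d s)"
      and e2: "\<forall>\<^sub>F s in sequentially. 0 < \<rho> s \<and> \<rho> s \<le> \<rho>max"
      and lim: "(\<lambda>s. real (d s) / (\<rho> s * (real (n s))\<^sup>2)) \<longlonglongrightarrow> 0"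
      and e3: "\<forall>\<^sub>F s in sequentially. ln (real (n s)) powr (2 * \<alpha> + 4)
          \<le> c' * (\<rho> s * (real (n s))\<^sup>2 / real (d s))"
      unfolding regime_def by auto
    have rn: "filterlim (\<lambda>s. real (n s)) at_top sequentially"
      using n by (rule filterlim_compose[OF filterlim_real_sequentially])
    have e4: "\<forall>\<^sub>F s in sequentially. real (d s) / (\<rho> s * (real (n s))\<^sup>2) < 1 / \<rho>max"
      using order_tendstoD(2)[OF lim, of "1 / \<rho>max"] pos by simp
    note a = asym1[THEN eventually_compose_filterlim[OF _ rn]] asym2[THEN eventually_compose_filterlim[OF _ rn]]
      asym3[THEN eventually_compose_filterlim[OF _ rn]]
    show "\<forall>\<^sub>F s in sequentially.
             \<forall>P \<Sigma>. data_distribution (d s) K \<Sigma> P \<and> \<Sigma> \<in> cov_class (d s) \<alpha> M0 M \<longrightarrow>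
               ennreal (1 / real (d s)) *
                 frob_risk (n s) (d s) P
                   (adaptive_estimator.estimator C0 C L1 c0 (n s) (d s) (\<rho> s)) \<Sigma>
               \<le> ennreal (max 1 Const * rate \<alpha> (n s) (d s) (\<rho> s))"
      using e1 e2 e3 e4 a
    proof eventually_elim
     case (elim s)
     note h = elim
     show ?case
     proof (intro allI impI)
      fix P \<Sigma>
      assume data: "data_distribution (d s) K \<Sigma> P \<and> \<Sigma> \<in> cov_class (d s) \<alpha> M0 M"
      have ln1: "1 \<le> ln (real (n s))" using h by simp
      have np: "0 < real (n s)" using ln1 by (cases "n s = 0") auto
      have dp: "0 < real (d s)"
      proof (rule ccontr)
        assume "\<not> 0 < real (d s)"
        then have "c * real (d s) \<le> 0" using c by simp
        then show False using h(1) ln1 by linarith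
      qed
      interpret adaptive_estimator C0 C L1 c0 "n s" "d s" "\<rho> s" .
      have k0_pos: "1 \<le> k0"
      proof -
        have "1 * 1 \<le> C0 * ln (real (n s))" using C0 ln1 by (intro mult_mono) auto
        then have "1 \<le> nat \<lceil>C0 * ln (real (n s))\<rceil>" by linarith
        then show ?thesis using dp by (simp add: k0_def)
      qed
      have k0_le: "real k0 \<le> c0 * real (n s)"
      proof -
        have "real k0 \<le> real (nat \<lceil>C0 * ln (real (n s))\<rceil>)" by (simp add: k0_def)
        also have "\<dots> = of_int \<lceil>C0 * ln (real (n s))\<rceil>" using C0 ln1 by simp
        also have "\<dots> \<le> C0 * ln (real (n s)) + 1" by linarith
        also have "\<dots> \<le> (C0 + 1) * ln (real (n s))" using ln1 by (simp add: algebra_simps)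
        also have "\<dots> \<le> c0 * real (n s)" using h by simp
        finally show ?thesis .
      qed
      interpret estimator_model C0 C L1 c0 "n s" "d s" "\<rho> s" K M0 M \<alpha> A P \<Sigma>
        using k0_pos k0_le h(2) pos C c0 A L1 data
        by unfold_locales (auto simp: admissible_def)
      have dsq: "real (d s) \<le> (real (n s))\<^sup>2"
      proof -
        have "real (d s) * \<rho>max \<le> \<rho> s * (real (n s))\<^sup>2"
          using h(2,4) pos np by (simp add: field_simps)
        also have "\<dots> \<le> \<rho>max * (real (n s))\<^sup>2" using h(2) by (intro mult_right_mono) auto
        finally show ?thesis using pos by (simp add: mult.commute)
      qed
      have lnd: "ln (real (n s)) \<le> A * real (d s)"
        using h(1) mult_right_mono[OF A(2), of "real (d s)"] by linarith
      have r0: "0 \<le> rate \<alpha> (n s) (d s) (\<rho> s)"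
        using ln1 h(2) np dp unfolding rate_def by (intro add_nonneg_nonneg) auto
      have "ennreal (1 / real (d s)) * frob_risk (n s) (d s) P estimator \<Sigma>
          \<le> ennreal (Const * rate \<alpha> (n s) (d s) (\<rho> s))"
        unfolding Const_def using ln1 C0 dsq lnd pos(5) h(3,6) by (intro frob_risk_rate) auto
      also have "\<dots> \<le> ennreal (max 1 Const * rate \<alpha> (n s) (d s) (\<rho> s))"
        using r0 by (intro ennreal_leI mult_right_mono) auto
      finally show "ennreal (1 / real (d s)) * frob_risk (n s) (d s) P estimator \<Sigma>
          \<le> ennreal (max 1 Const * rate \<alpha> (n s) (d s) (\<rho> s))" .
     qed
    qed
  qed
qed

theorem theorem5p2:
  fixes K M0 M c \<rho>max :: real
  assumes "0 < K" and "0 < M0" and "0 < M" and "0 < c" and "0 < \<rho>max"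
  shows
    "\<forall>\<^sub>F C0 in at_top. \<forall>\<^sub>F C in at_top. \<forall>\<^sub>F L1 in at_top. \<forall>\<^sub>F c0 in at_right 0.
       (\<forall>n d \<rho>. adaptive_estimator.admissible C0 c0 n d \<and> 0 < \<rho> \<longrightarrow>
          zCDP n (Vec d) (Mat d) \<rho> (adaptive_estimator.estimator C0 C L1 c0 n d \<rho>)) \<and>
       (\<forall>\<alpha>>0. \<forall>c'>0. \<exists>Const>0. \<forall>n d \<rho>.
          regime c \<rho>max n d \<rho> \<and>
          (\<forall>\<^sub>F s in sequentially.
             ln (real (n s)) powr (2 * \<alpha> + 4) \<le> c' * (\<rho> s * (real (n s))\<^sup>2 / real (d s))) \<longrightarrow>
          (\<forall>\<^sub>F s in sequentially.
             \<forall>P \<Sigma>. data_distribution (d s) K \<Sigma> P \<and> \<Sigma> \<in> cov_class (d s) \<alpha> M0 M \<longrightarrow>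
               ennreal (1 / real (d s)) *
                 frob_risk (n s) (d s) P
                   (adaptive_estimator.estimator C0 C L1 c0 (n s) (d s) (\<rho> s)) \<Sigma>
               \<le> ennreal (Const * rate \<alpha> (n s) (d s) (\<rho> s))))"
proof -
  \<comment> \<open>The rate \<open>A\<close> must be at least \<open>c\<close>: if \<open>k0 = d\<close>, the bias \<open>exp (- 2 * A * d)\<close> has to be at most \<open>1 / n\<close>,
      and only \<open>ln n \<le> c * d\<close> is known.\<close>
  define A where "A = c + 2"
  have A: "2 \<le> A" "c \<le> A" using assms by (auto simp: A_def)
  have evC: "\<forall>\<^sub>F C :: real in at_top. 0 < C \<and> sqrt 2 * exp (- C / (4 * (2 * K)\<^sup>2)) \<le> exp (- A)"
  proof -
    have "((\<lambda>C :: real. sqrt 2 * exp (- C / (4 * (2 * K)\<^sup>2))) \<longlongrightarrow> 0) at_top"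
      using assms(1) by real_asymp
    then have "\<forall>\<^sub>F C :: real in at_top. sqrt 2 * exp (- C / (4 * (2 * K)\<^sup>2)) < exp (- A)"
      by (rule order_tendstoD) simp
    with eventually_gt_at_top[of "0 :: real"] show ?thesis by eventually_elim auto
  qed
  have evc0: "\<forall>\<^sub>F c0 :: real in at_right 0. 0 < c0 \<and> c0 \<le> 1"
    unfolding eventually_at_right_field by (intro exI[of _ 1]) auto
  show ?thesis
    using eventually_ge_at_top[of "1 :: real"]
  proof eventually_elim
    case (elim C0)
    note C0 = this
    show ?case
      using evC
    proof eventually_elim
      case (elim C)
      note C = this
      show ?case
        using eventually_ge_at_top[of "exp 5 * (36 * 10368 * (2 * K) ^ 4)"] eventually_ge_at_top[of "exp 5 * (36 * 144 * C\<^sup>2)"]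
      proof eventually_elim
        case (elim L1)
        note L1 = this
        show ?case
          using evc0
        proof eventually_elim
         case (elim c0)
         show ?case
         proof (intro conjI)
          show "\<forall>n d \<rho>. adaptive_estimator.admissible C0 c0 n d \<and> 0 < \<rho> \<longrightarrow>
              zCDP n (Vec d) (Mat d) \<rho> (adaptive_estimator.estimator C0 C L1 c0 n d \<rho>)"
          proof (intro allI impI)
            fix n d :: nat and \<rho> :: real
            assume "adaptive_estimator.admissible C0 c0 n d \<and> 0 < \<rho>"
            then interpret admissible_estimator C0 C L1 c0 n d \<rho>
              using C elim by unfold_locales auto
            show "zCDP n (Vec d) (Mat d) \<rho> estimator" by (rule estimator_zCDP)
          qed
         next
          show "\<forall>\<alpha>>0. \<forall>c'>0. \<exists>Const>0. \<forall>n d \<rho>.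
            regime c \<rho>max n d \<rho> \<and>
            (\<forall>\<^sub>F s in sequentially.
               ln (real (n s)) powr (2 * \<alpha> + 4) \<le> c' * (\<rho> s * (real (n s))\<^sup>2 / real (d s))) \<longrightarrow>
            (\<forall>\<^sub>F s in sequentially.
               \<forall>P \<Sigma>. data_distribution (d s) K \<Sigma> P \<and> \<Sigma> \<in> cov_class (d s) \<alpha> M0 M
                   \<longrightarrow>
                 ennreal (1 / real (d s)) *
                   frob_risk (n s) (d s) P
                     (adaptive_estimator.estimator C0 C L1 c0 (n s) (d s) (\<rho> s)) \<Sigma>
                 \<le> ennreal (Const * rate \<alpha> (n s) (d s) (\<rho> s)))"
            using assms A C0 C L1 elim by (intro allI impI adaptive_estimator_risk_eventually) auto
         qed
        qed
      qed
    qed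
  qed
qed

end
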